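(* Suppose that the auxiliary potential $\tilde V$ satisfies $$ |\tilde V(x')-\tilde V(x)|\le L|x'-x|^\alpha\quad\text{for any } 0\le x\le x'\le X,$$ for some $\alpha\in[0,1]$ and $L\ge0$, and let $L\tau h_x^\alpha<8\hbar$. Consider the splitting scheme on the finite space mesh: for any $m\ge1$, $$ i\hbar\,\frac{\breve{\Psi}^m-\Psi^{m-1}}{\tau/2}=(V-\tilde V)\frac{\breve{\Psi}^m+\Psi^{m-1}}{2},\qquad i\hbar\,\frac{\Psi^m-\widetilde{\Psi}^m}{\tau/2}=(V-\tilde V)\frac{\Psi^m+\widetilde{\Psi}^m}{2}\quad\text{on }\omega_h\cup\Gamma_{1h},$$ $$ i\hbar s_N\frac{\widetilde{\Psi}^m-\breve{\Psi}^m}{\tau}=-c_{\hbar}\Delta_{hN}\frac{\widetilde{\Psi}^m+\breve{\Psi}^m}{2}+s_N\Bigl(\tilde V\frac{\widetilde{\Psi}^m+\breve{\Psi}^m}{2}\Bigr)+F^m\quad\text{on }\omega_h,$$ $$ \breve\Psi^m|_{\Gamma_h}=0,\quad \widetilde\Psi^m|_{\Gamma_h}=0,\quad \Psi^m|_{\Gamma_h}=0,\qquad \Psi^0=\Psi^0_h\ \text{ on }\overline\omega_h,$$ $$ \Bigl[c_{\hbar,q}\bar\partial_x\frac{\widetilde\Psi^{m(q)}+\breve\Psi^{m(q)}}{2}-h_xs^-_{\theta_qx}\Bigl(i\hbar\frac{\widetilde\Psi^{m(q)}-\breve\Psi^{m(q)}}{\tau}-V_{\infty,q}\frac{\breve\Psi^{m(q)}+\widetilde\Psi^{m(q)}}{2}\Bigr)\Bigr]\Big|_{j=J}=c_{\hbar,q}\bigl(R_q*\widetilde\Psi^{(q)}_J\bigr)^m,\quad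 1\le q\le K-1.$$ Then the solution to this scheme is unique. In addition, it satisfies the $L^2$-stability bound $$ \max_{0\le m\le M}\|\Psi^m\|_{\widetilde\omega_h}\le\|\Psi^0_h\|_{\widetilde\omega_h}+\frac6\hbar\sum_{m=1}^M\|F^m\|_{\omega_h}\tau\quad\text{for any } M\ge1$$ provided that $\Psi^0_h=0$ on $\Gamma_{1h}$ and $\Psi^0_h|_{j=J-1}=0$.
   Context: Constants: $\hbar>0$, $m_0>0$, $c_\hbar:=\hbar^2/(2m_0)$; $i$ is the imaginary unit. $Y>0$, $X>X_0>0$. The potential $V(x,y)$ is a given real function on the semi-infinite strip $(0,\infty)\times(0,Y)$ with $V(x,y)=V_\infty$ (a constant) for $x\ge X_0$, $0<y<Y$. The auxiliary potential $\tilde V=\tilde V(x)$ is real, depends only on $x$, and satisfies $\tilde V(x)=V_\infty$ for $x\ge X_0$. Space mesh: $x_j=jh_x$, $0\le j\le J$, $h_x=X/J$, with $h_x\le X-X_0$; $y_k=kh_y$, $0\le k\le K$, $h_y=Y/K$. $\overline\omega_h=\{(x_j,y_k): 0\le j\le J,\ 0\le k\le K\}$, $\omega_h=\{(x_j,y_k): 1\le j\le J-1,\ 1\le k\le K-1\}$, $\partial\omega_h=\overline\omega_h\setminus\omega_h$, $\Gamma_{1h}=\{(x_J,y_k): 1\le k\le K-1\}$, $\Gamma_h=\partial\omega_h\setminus\Gamma_{1h}$. The compatibility condition $\Psi^0_h|_{\Gamma_h}=0$ is assumed; $F^m$ ($m\ge1$) is a given complex-valued function on $\omega_h$. Time mesh: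 uniform with step $\tau>0$; the superscript $m$ denotes the time level. Difference operators: $\bar\partial_xW_j=(W_j-W_{j-1})/h_x$, $\partial_xW_j=(W_{j+1}-W_j)/h_x$, and similarly $\bar\partial_y,\partial_y$ in the index $k$ with step $h_y$; $s_{Nx}=I+\frac{h_x^2}{12}\partial_x\bar\partial_x$, $s_{Ny}=I+\frac{h_y^2}{12}\partial_y\bar\partial_y$; $s_N=I+\frac{h_x^2}{12}\partial_x\bar\partial_x+\frac{h_y^2}{12}\partial_y\bar\partial_y$; $\Delta_{hN}=s_{Ny}\partial_x\bar\partial_x+s_{Nx}\partial_y\bar\partial_y$; $s^-_{\theta x}W_j=\theta W_{j-1}+(\frac12-\theta)W_j$. Discrete sine transform in $y$: $Z^{(q)}=\frac2K\sum_{k=1}^{K-1}Z_k\sin\frac{\pi qk}{K}$, $1\le q\le K-1$ (for each fixed $j$ and $m$; $Z^{m(q)}=(Z^m)^{(q)}$). $\lambda_q=\bigl(\frac2{h_y}\sin\frac{\pi qh_y}{2Y}\bigr)^2$, $\sigma_q=1-\frac{h_y^2}{12}\lambda_q\in(\frac23,1)$, $c_{\hbar,q}=c_\hbar\bigl[1+\bigl(\frac{h_xh_y\lambda_q}{12\sigma_q}\bigr)^2\bigr]$, $\theta_q=\frac1{12\sigma_q}$, $V_{\infty,q}=V_\infty+c_\hbar\frac{\lambda_q}{\sigma_q}$. Kernel $R_q=(R_q^m)_{m\ge0}$: $R_q^0=c_{1q}$, $R_q^1=-c_{1q}\varkappa_q\mu_q$, $R_q^m=\frac{2m-3}{m}\varkappa_q\mu_qR_q^{m-1}-\frac{m-3}{m}\varkappa_q^2R_q^{m-2}$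 for $m\ge2$, where $c_{1q}=-\frac{|\alpha_q|^{1/2}}{2}e^{-i(\arg\alpha_q)/2}$, $\varkappa_q=-e^{i\arg\alpha_q}$, $\arg\alpha_q\in(0,2\pi)$, $\mu_q=\beta_q/|\alpha_q|$, $\alpha_q=2a_q+(1-4\theta_q)h_x^2a_q^2$, $\beta_q=2\operatorname{Re}a_q+(1-4\theta_q)h_x^2|a_q|^2$, $a_q=\frac{V_{\infty,q}}{2c_{\hbar,q}}+i\frac{\hbar}{\tau c_{\hbar,q}}$. A subscript $J$ denotes the trace at $x=x_J$. Discrete convolution in time: $(R*Q)^m=\sum_{p=0}^mR^pQ^{m-p}$; in the convolution, $\widetilde\Psi^0_J:=\Psi^0_J$. Norms: $\|W\|_{\omega_h}^2=\sum_{j=1}^{J-1}\sum_{k=1}^{K-1}|W_{j,k}|^2h_xh_y$, $\|W\|_{\widetilde\omega_h}^2=\sum_{j=1}^{J}\sum_{k=1}^{K-1}|W_{j,k}|^2h_xh_y$. *)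

theory Defs
  imports "HOL-Analysis.Analysis"
begin

text \<open>
  Mesh functions are indexed by pairs \<open>j k\<close> of natural numbers standing for the node
  \<open>(x_j, y_k)\<close>; only their values on the closed mesh are meaningful.  The backward difference
  at index 0 is a junk value (\<open>0 - 1 = 0\<close> on naturals), but all operators below are only ever
  evaluated at nodes where the stencil stays inside the closed mesh.
\<close>

type_synonym mesh_fun = "nat \<Rightarrow> nat \<Rightarrow> complex"

definition bdiff :: "real \<Rightarrow> (nat \<Rightarrow> complex) \<Rightarrow> nat \<Rightarrow> complex" where
  "bdiff h W i = (W i - W (i - 1)) / of_real h"

definition fdiff :: "real \<Rightarrow> (nat \<Rightarrow> complex) \<Rightarrow> nat \<Rightarrow> complex" where
  "fdiff h W i = (W (i + 1) - W i) / of_real h"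

definition conv :: "(nat \<Rightarrow> complex) \<Rightarrow> (nat \<Rightarrow> complex) \<Rightarrow> nat \<Rightarrow> complex" where
  "conv R Q m = (\<Sum>p=0..m. R p * Q (m - p))"

definition s_minus :: "real \<Rightarrow> (nat \<Rightarrow> complex) \<Rightarrow> nat \<Rightarrow> complex" where
  "s_minus \<theta> W j = of_real \<theta> * W (j - 1) + of_real (1/2 - \<theta>) * W j"

fun kernel_rec :: "complex \<Rightarrow> complex \<Rightarrow> real \<Rightarrow> nat \<Rightarrow> complex" where
  "kernel_rec c \<kappa> \<mu> 0 = c"
| "kernel_rec c \<kappa> \<mu> (Suc 0) = - c * \<kappa> * of_real \<mu>"
| "kernel_rec c \<kappa> \<mu> (Suc (Suc n)) =
     (let m = real (Suc (Suc n)) in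
       of_real ((2 * m - 3) / m) * \<kappa> * of_real \<mu> * kernel_rec c \<kappa> \<mu> (Suc n)
       - of_real ((m - 3) / m) * \<kappa>\<^sup>2 * kernel_rec c \<kappa> \<mu> n)"

locale splitting_scheme =
  fixes hbar m0 X Y Vinf :: real
    and V :: "real \<Rightarrow> real \<Rightarrow> real" and Vt :: "real \<Rightarrow> real"
    and J K :: nat and \<tau> :: real
begin

definition hx :: real where "hx = X / real J"
definition hy :: real where "hy = Y / real K"
definition x :: "nat \<Rightarrow> real" where "x j = real j * hx"
definition y :: "nat \<Rightarrow> real" where "y k = real k * hy"

definition omega_bar :: "(nat \<times> nat) set" where
  "omega_bar = {0..J} \<times> {0..K}"
definition omega :: "(nat \<times> nat) set" where
  "omega = {1..J - 1} \<times> {1..K - 1}"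
definition bd_omega :: "(nat \<times> nat) set" where
  "bd_omega = omega_bar - omega"
definition Gamma1 :: "(nat \<times> nat) set" where
  "Gamma1 = {J} \<times> {1..K - 1}"
definition Gamma :: "(nat \<times> nat) set" where
  "Gamma = bd_omega - Gamma1"

definition norm_omega :: "mesh_fun \<Rightarrow> real" where
  "norm_omega W = sqrt (\<Sum>j=1..J-1. \<Sum>k=1..K-1. (cmod (W j k))\<^sup>2 * hx * hy)"
definition norm_omega_tilde :: "mesh_fun \<Rightarrow> real" where
  "norm_omega_tilde W = sqrt (\<Sum>j=1..J. \<Sum>k=1..K-1. (cmod (W j k))\<^sup>2 * hx * hy)"

definition c_hbar :: real where "c_hbar = hbar\<^sup>2 / (2 * m0)"

definition dxx :: "mesh_fun \<Rightarrow> mesh_fun" where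
  "dxx W j k = fdiff hx (bdiff hx (\<lambda>j. W j k)) j"
definition dyy :: "mesh_fun \<Rightarrow> mesh_fun" where
  "dyy W j k = fdiff hy (bdiff hy (\<lambda>k. W j k)) k"

definition s_Nx :: "mesh_fun \<Rightarrow> mesh_fun" where
  "s_Nx W j k = W j k + of_real (hx\<^sup>2 / 12) * dxx W j k"
definition s_Ny :: "mesh_fun \<Rightarrow> mesh_fun" where
  "s_Ny W j k = W j k + of_real (hy\<^sup>2 / 12) * dyy W j k"
definition s_N :: "mesh_fun \<Rightarrow> mesh_fun" where
  "s_N W j k = W j k + of_real (hx\<^sup>2 / 12) * dxx W j k + of_real (hy\<^sup>2 / 12) * dyy W j k"
definition Delta_hN :: "mesh_fun \<Rightarrow> mesh_fun" where
  "Delta_hN W j k = s_Ny (dxx W) j k + s_Nx (dyy W) j k"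

definition dst :: "nat \<Rightarrow> mesh_fun \<Rightarrow> nat \<Rightarrow> complex" where
  "dst q Z j = of_real (2 / real K) *
     (\<Sum>k=1..K-1. Z j k * of_real (sin (pi * real q * real k / real K)))"

definition lam :: "nat \<Rightarrow> real" where
  "lam q = (2 / hy * sin (pi * real q * hy / (2 * Y)))\<^sup>2"
definition sig :: "nat \<Rightarrow> real" where
  "sig q = 1 - hy\<^sup>2 / 12 * lam q"
definition c_hbar_q :: "nat \<Rightarrow> real" where
  "c_hbar_q q = c_hbar * (1 + (hx * hy * lam q / (12 * sig q))\<^sup>2)"
definition theta :: "nat \<Rightarrow> real" where
  "theta q = 1 / (12 * sig q)"
definition Vinf_q :: "nat \<Rightarrow> real" where
  "Vinf_q q = Vinf + c_hbar * (lam q / sig q)"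

definition a :: "nat \<Rightarrow> complex" where
  "a q = of_real (Vinf_q q / (2 * c_hbar_q q)) + \<i> * of_real (hbar / (\<tau> * c_hbar_q q))"
definition alpha :: "nat \<Rightarrow> complex" where
  "alpha q = 2 * a q + of_real ((1 - 4 * theta q) * hx\<^sup>2) * (a q)\<^sup>2"
definition beta :: "nat \<Rightarrow> real" where
  "beta q = 2 * Re (a q) + (1 - 4 * theta q) * hx\<^sup>2 * (cmod (a q))\<^sup>2"

text \<open>
  The argument is normalised to \<open>(0, 2 pi)\<close>.  \<^const>\<open>Arg2pi\<close> has range \<open>[0, 2 pi)\<close> and vanishes
  only on the nonnegative reals, which \<open>alpha q\<close> avoids for positive physical and mesh
  parameters, because \<open>Im (a q) > 0\<close> and \<open>4 * theta q < 1/2\<close>.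
\<close>

definition arg_alpha :: "nat \<Rightarrow> real" where
  "arg_alpha q = Arg2pi (alpha q)"
definition c1 :: "nat \<Rightarrow> complex" where
  "c1 q = - of_real (sqrt (cmod (alpha q)) / 2) * exp (- \<i> * of_real (arg_alpha q / 2))"
definition kap :: "nat \<Rightarrow> complex" where
  "kap q = - exp (\<i> * of_real (arg_alpha q))"
definition mu :: "nat \<Rightarrow> real" where
  "mu q = beta q / cmod (alpha q)"
definition R :: "nat \<Rightarrow> nat \<Rightarrow> complex" where
  "R q = kernel_rec (c1 q) (kap q) (mu q)"

text \<open>
  \<open>\<Psi>b\<close> and \<open>\<Psi>t\<close> are the breve and tilde families; they belong to the scheme for time levels
  \<open>m \<ge> 1\<close> only.  The convolution replaces the missing level 0 of \<open>\<Psi>t\<close> by \<open>\<Psi> 0\<close>.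
\<close>

definition TBC :: "(nat \<Rightarrow> mesh_fun) \<Rightarrow> (nat \<Rightarrow> mesh_fun) \<Rightarrow> (nat \<Rightarrow> mesh_fun) \<Rightarrow> nat \<Rightarrow> nat \<Rightarrow> bool"
where
  "TBC \<Psi> \<Psi>b \<Psi>t m q \<longleftrightarrow>
     of_real (c_hbar_q q) * bdiff hx (\<lambda>j. (dst q (\<Psi>t m) j + dst q (\<Psi>b m) j) / 2) J
     - of_real hx * s_minus (theta q)
         (\<lambda>j. \<i> * of_real hbar * ((dst q (\<Psi>t m) j - dst q (\<Psi>b m) j) / of_real \<tau>)
              - of_real (Vinf_q q) * ((dst q (\<Psi>b m) j + dst q (\<Psi>t m) j) / 2)) J
     = of_real (c_hbar_q q) * conv (R q) (\<lambda>p. dst q (if p = 0 then \<Psi> 0 else \<Psi>t p) J) m"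

definition solves ::
  "mesh_fun \<Rightarrow> (nat \<Rightarrow> mesh_fun) \<Rightarrow> (nat \<Rightarrow> mesh_fun) \<Rightarrow> (nat \<Rightarrow> mesh_fun) \<Rightarrow> (nat \<Rightarrow> mesh_fun) \<Rightarrow> bool"
where
  "solves \<Psi>0 F \<Psi> \<Psi>b \<Psi>t \<longleftrightarrow>
     (\<forall>(j, k)\<in>omega_bar. \<Psi> 0 j k = \<Psi>0 j k) \<and>
     (\<forall>m\<ge>1.
       (\<forall>(j, k)\<in>omega \<union> Gamma1.
          \<i> * of_real hbar * ((\<Psi>b m j k - \<Psi> (m - 1) j k) / of_real (\<tau> / 2))
          = of_real (V (x j) (y k) - Vt (x j)) * ((\<Psi>b m j k + \<Psi> (m - 1) j k) / 2)) \<and>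
       (\<forall>(j, k)\<in>omega \<union> Gamma1.
          \<i> * of_real hbar * ((\<Psi> m j k - \<Psi>t m j k) / of_real (\<tau> / 2))
          = of_real (V (x j) (y k) - Vt (x j)) * ((\<Psi> m j k + \<Psi>t m j k) / 2)) \<and>
       (\<forall>(j, k)\<in>omega.
          \<i> * of_real hbar * s_N (\<lambda>j k. (\<Psi>t m j k - \<Psi>b m j k) / of_real \<tau>) j k
          = - of_real c_hbar * Delta_hN (\<lambda>j k. (\<Psi>t m j k + \<Psi>b m j k) / 2) j k
            + s_N (\<lambda>j k. of_real (Vt (x j)) * ((\<Psi>t m j k + \<Psi>b m j k) / 2)) j k
            + F m j k) \<and>
       (\<forall>(j, k)\<in>Gamma. \<Psi>b m j k = 0 \<and> \<Psi>t m j k = 0 \<and> \<Psi> m j k = 0) \<and>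
       (\<forall>q\<in>{1..K - 1}. TBC \<Psi> \<Psi>b \<Psi>t m q))"

definition same_solution ::
  "(nat \<Rightarrow> mesh_fun) \<Rightarrow> (nat \<Rightarrow> mesh_fun) \<Rightarrow> (nat \<Rightarrow> mesh_fun) \<Rightarrow>
   (nat \<Rightarrow> mesh_fun) \<Rightarrow> (nat \<Rightarrow> mesh_fun) \<Rightarrow> (nat \<Rightarrow> mesh_fun) \<Rightarrow> bool"
where
  "same_solution \<Psi> \<Psi>b \<Psi>t \<Psi>' \<Psi>b' \<Psi>t' \<longleftrightarrow>
     (\<forall>(j, k)\<in>omega_bar.
        (\<forall>m. \<Psi> m j k = \<Psi>' m j k) \<and>
        (\<forall>m\<ge>1. \<Psi>b m j k = \<Psi>b' m j k \<and> \<Psi>t m j k = \<Psi>t' m j k))"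

end

end

theory Submission
  imports Defs
begin

text \<open>
  The sine transform in \<open>y\<close> splits the middle equation of the scheme into one-dimensional Numerov
  schemes with the potential \<open>Vt + c_hbar * lam q / sig q\<close>, and the boundary condition says
  exactly that each mode extends to a decaying solution of the same scheme to the right of
  \<open>x J\<close>.  Indeed, as a formal power series in the time variable the extension is
  \<open>N ^ n * g\<close>, where \<open>g\<close> is the trace at \<open>x J\<close> and \<open>N\<close> is the root with
  \<open>\<bar>N $ 0\<bar> < 1\<close> of a quadratic equation whose discriminant is the square of the generating
  function of the kernel.

  On the half line the averaging operator is symmetric and positive, so testing with its inverse
  applied to the mean of the new and the old value yields an \<open>L\<^sup>2\<close> bound for the middle step.
  The two potential steps are multiplications by numbers of
  modulus 1.  Infinite sums are avoided by testing on \<open>1..N\<close> and letting \<open>N\<close> tend to infinity, as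
  the boundary terms at \<open>N + 1\<close> vanish in the limit.  Uniqueness is stability applied to a
  difference; existence holds because each mode is a tridiagonal system, solved by shooting, for
  which uniqueness comes from the same energy argument.
\<close>

unbundle no vec_syntax and fps_syntax

section \<open>Second differences and the Numerov average\<close>

text \<open>The obstacle is that potential steps and boundary condition live in different
  representations: the potential mixes the sine modes, while each mode has its own kernel. They are
  compatible because \<open>hx \<le> X - X0\<close> puts the columns \<open>J - 1\<close> and
  \<open>J\<close> where \<open>V = Vt\<close>. There the potential steps are the identity, so the
  breve trace of level \<open>m\<close> is the trace of level \<open>m - 1\<close>, and the exterior
  extension of one level serves as old value for the next. What is iterated in time is the joint
  norm of all extended modes, never a single mode. The potential sits under the average, so paired
  with the plain mean it need not give a real term. The inverse average frees it and still leaves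
  the difference operator a real form. The price is the norm \<open>1 / (1 - 4 * theta q)\<close> of
  the inverse; together with the normalisation of the mode by \<open>1 / sig q\<close> it yields
  \<open>1 / (sig q - 1/3) < 3\<close>. The modified coefficient \<open>c_hbar_q\<close> is exactly
  what makes the transformed two-dimensional operator a one-dimensional Numerov operator with one
  weight \<open>theta q\<close>.\<close>

definition d2 :: "(nat \<Rightarrow> complex) \<Rightarrow> nat \<Rightarrow> complex" where
  "d2 u j = u (Suc j) - 2 * u j + u (j - 1)"

text \<open>On \<open>exp (i * t * j)\<close> it multiplies by
  \<open>1 - 4 * \<theta> * (sin (t / 2))^2\<close>, hence the recurring condition
  \<open>\<theta> < 1/4\<close>, which keeps the average positive.\<close>

definition numerov :: "real \<Rightarrow> (nat \<Rightarrow> complex) \<Rightarrow> nat \<Rightarrow> complex" where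
  "numerov \<theta> u j = u j + of_real \<theta> * d2 u j"

lemma d2_cong: "u (j - 1) = v (j - 1) \<Longrightarrow> u j = v j \<Longrightarrow> u (Suc j) = v (Suc j) \<Longrightarrow> d2 u j = d2 v j"
  by (simp add: d2_def)

lemma numerov_cong:
  "u (j - 1) = v (j - 1) \<Longrightarrow> u j = v j \<Longrightarrow> u (Suc j) = v (Suc j) \<Longrightarrow> numerov \<theta> u j = numerov \<theta> v j"
  by (simp add: numerov_def d2_def)

lemma d2_shift: "n \<ge> 1 \<Longrightarrow> d2 u (n + p) = d2 (\<lambda>i. u (i + p)) n"
  by (cases n) (simp_all add: d2_def)

lemma numerov_shift: "n \<ge> 1 \<Longrightarrow> numerov \<theta> u (n + p) = numerov \<theta> (\<lambda>i. u (i + p)) n"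
  by (simp add: numerov_def d2_shift)

text \<open>Two summations by parts. The left boundary term vanishes for Dirichlet data; the right
  one is either removed by a second zero or becomes the truncation error at
  \<open>N + 1\<close>.\<close>

lemma Green_identity:
  "(\<Sum>j=1..N. d2 u j * v j) = (\<Sum>j=1..N. u j * d2 v j)
     + u (Suc N) * v N - u N * v (Suc N) - (u 1 * v 0 - u 0 * v 1)"
  by (induction N) (simp_all add: d2_def algebra_simps)

lemma cnj_d2: "cnj (d2 u j) = d2 (\<lambda>i. cnj (u i)) j"
  by (simp add: d2_def)

lemma cnj_numerov: "cnj (numerov \<theta> u j) = numerov \<theta> (\<lambda>i. cnj (u i)) j"
  by (simp add: numerov_def cnj_d2)

lemma Green_identity_numerov:
  "(\<Sum>j=1..N. numerov \<theta> u j * v j) = (\<Sum>j=1..N. u j * numerov \<theta> v j)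
     + of_real \<theta> * (u (Suc N) * v N - u N * v (Suc N) - (u 1 * v 0 - u 0 * v 1))"
proof -
  have "(\<Sum>j=1..N. numerov \<theta> u j * v j)
    = (\<Sum>j=1..N. u j * v j) + of_real \<theta> * (\<Sum>j=1..N. d2 u j * v j)"
    by (simp add: numerov_def distrib_right sum.distrib sum_distrib_left mult.assoc)
  also have "(\<Sum>j=1..N. u j * v j) + of_real \<theta> * (\<Sum>j=1..N. u j * d2 v j)
    = (\<Sum>j=1..N. u j * numerov \<theta> v j)"
    by (simp add: numerov_def distrib_left sum.distrib sum_distrib_left mult.left_commute)
  ultimately show ?thesis
    unfolding Green_identity by (simp add: algebra_simps)
qed

text \<open>\<open>d2\<close> is symmetric under zero end values, so its form is real; this removes
  the difference operator from the imaginary part of the energy identity.\<close>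

lemma Im_sum_mult_d2_cnj:
  assumes "u 0 = 0" "u (Suc N) = 0"
  shows "Im (\<Sum>j=1..N. u j * d2 (\<lambda>i. cnj (u i)) j) = 0"
proof -
  have "cnj (\<Sum>j=1..N. u j * d2 (\<lambda>i. cnj (u i)) j) = (\<Sum>j=1..N. d2 u j * cnj (u j))"
    by (simp add: cnj_d2 mult.commute)
  also have "\<dots> = (\<Sum>j=1..N. u j * d2 (\<lambda>i. cnj (u i)) j)"
    by (subst Green_identity) (simp add: assms)
  finally show ?thesis
    by (metis Im_complex_of_real Reals_cnj_iff Reals_cases)
qed

text \<open>Adding four times the squared norm completes the form to the sum of the squares of
  \<open>u (Suc j) + u j\<close>.\<close>

lemma Re_sum_d2_ge:
  assumes "u 0 = 0" "u (Suc N) = 0"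
  shows "Re (\<Sum>j=1..N. d2 u j * cnj (u j)) \<ge> - 4 * (\<Sum>j=1..N. (cmod (u j))\<^sup>2)"
proof -
  \<comment> \<open>Only \<open>u 0 = 0\<close> enters here, so the identity admits induction on the
    upper bound; the zero at the right end is inserted afterwards.\<close>
  have eq: "(\<Sum>j=1..N. d2 u j * cnj (u j)) + 4 * (\<Sum>j=1..N. u j * cnj (u j))
    = (\<Sum>j=0..N. (u (Suc j) + u j) * cnj (u (Suc j) + u j))
       - u (Suc N) * cnj (u (Suc N)) - u N * cnj (u (Suc N))" for N
    using assms(1) by (induction N) (simp_all add: d2_def algebra_simps)
  have "Re (\<Sum>j=1..N. d2 u j * cnj (u j)) + 4 * (\<Sum>j=1..N. (cmod (u j))\<^sup>2)
    = Re ((\<Sum>j=1..N. d2 u j * cnj (u j)) + 4 * (\<Sum>j=1..N. u j * cnj (u j)))"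
    by (simp add: complex_mult_cnj cmod_power2)
  also have "\<dots> = (\<Sum>j=0..N. (cmod (u (Suc j) + u j))\<^sup>2)"
    unfolding eq using assms(2)
    by (simp only: complex_norm_square[symmetric] Re_sum Re_complex_of_real) simp
  also have "\<dots> \<ge> 0"
    by (intro sum_nonneg) simp
  finally show ?thesis by linarith
qed

lemma cmod_sum_mult_le_L2:
  "cmod (\<Sum>j\<in>A. u j * v j) \<le> L2_set (\<lambda>j. cmod (u j)) A * L2_set (\<lambda>j. cmod (v j)) A"
proof -
  have "cmod (\<Sum>j\<in>A. u j * v j) \<le> (\<Sum>j\<in>A. \<bar>cmod (u j)\<bar> * \<bar>cmod (v j)\<bar>)"
    by (rule order_trans[OF norm_sum]) (simp add: norm_mult)
  also have "\<dots> \<le> L2_set (\<lambda>j. cmod (u j)) A * L2_set (\<lambda>j. cmod (v j)) A"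
    by (rule L2_set_mult_ineq)
  finally show ?thesis .
qed

lemma L2_set_square_sum: "(L2_set u A)\<^sup>2 = (\<Sum>j\<in>A. (u j)\<^sup>2)"
  by (simp add: L2_set_def sum_nonneg)

lemma L2_set_half: "L2_set (\<lambda>j. cmod (z j / 2)) A = L2_set (\<lambda>j. cmod (z j)) A / 2"
proof -
  have "L2_set (\<lambda>j. cmod (z j / 2)) A = L2_set (\<lambda>j. (1/2) * cmod (z j)) A"
    by (simp add: norm_divide)
  also have "\<dots> = (1/2) * L2_set (\<lambda>j. cmod (z j)) A"
    by (rule L2_set_right_distrib[symmetric]) simp
  finally show ?thesis by simp
qed

lemma L2_set_average: "L2_set (\<lambda>j. cmod ((u j + v j) / 2)) A
    \<le> (L2_set (\<lambda>j. cmod (u j)) A + L2_set (\<lambda>j. cmod (v j)) A) / 2"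
proof -
  have "L2_set (\<lambda>j. cmod (u j + v j)) A \<le> L2_set (\<lambda>j. cmod (u j) + cmod (v j)) A"
    by (rule L2_set_mono) (auto simp: norm_triangle_ineq)
  also have "\<dots> \<le> L2_set (\<lambda>j. cmod (u j)) A + L2_set (\<lambda>j. cmod (v j)) A"
    by (rule L2_set_triangle_ineq)
  finally show ?thesis unfolding L2_set_half by simp
qed

text \<open>Pairing with \<open>u\<close> and the lower bound for \<open>d2\<close> give
  \<open>(1 - 4 * \<theta>)\<close> times the squared norm from below; Cauchy-Schwarz and division
  by the norm turn this into a bound for the inverse average.\<close>

lemma numerov_coercive:
  assumes "0 < \<theta>" "\<theta> < 1/4" "u 0 = 0" "u (Suc N) = 0"
  shows "(1 - 4 * \<theta>) * L2_set (\<lambda>j. cmod (u j)) {1..N}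
    \<le> L2_set (\<lambda>j. cmod (numerov \<theta> u j)) {1..N}"
proof -
  let ?n = "L2_set (\<lambda>j. cmod (u j)) {1..N}"
  have sq: "?n\<^sup>2 = (\<Sum>j=1..N. (cmod (u j))\<^sup>2)"
    by (simp add: L2_set_def sum_nonneg)
  have "(\<Sum>j=1..N. numerov \<theta> u j * cnj (u j))
    = (\<Sum>j=1..N. u j * cnj (u j)) + of_real \<theta> * (\<Sum>j=1..N. d2 u j * cnj (u j))"
    by (simp add: numerov_def distrib_right sum.distrib sum_distrib_left mult.assoc)
  then have "Re (\<Sum>j=1..N. numerov \<theta> u j * cnj (u j))
    = ?n\<^sup>2 + \<theta> * Re (\<Sum>j=1..N. d2 u j * cnj (u j))"
    unfolding sq by (simp add: complex_mult_cnj cmod_power2)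
  moreover have "\<theta> * Re (\<Sum>j=1..N. d2 u j * cnj (u j)) \<ge> \<theta> * (- 4 * ?n\<^sup>2)"
    unfolding sq using assms by (intro mult_left_mono Re_sum_d2_ge) auto
  ultimately have "(1 - 4 * \<theta>) * ?n\<^sup>2 \<le> Re (\<Sum>j=1..N. numerov \<theta> u j * cnj (u j))"
    by (simp add: algebra_simps)
  also have "\<dots> \<le> cmod (\<Sum>j=1..N. numerov \<theta> u j * cnj (u j))"
    by (rule complex_Re_le_cmod)
  also have "\<dots> \<le> L2_set (\<lambda>j. cmod (numerov \<theta> u j)) {1..N} * ?n"
    using cmod_sum_mult_le_L2[of "numerov \<theta> u" "\<lambda>j. cnj (u j)"] by simp
  finally have *: "(1 - 4 * \<theta>) * ?n * ?n \<le> L2_set (\<lambda>j. cmod (numerov \<theta> u j)) {1..N} * ?n"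
    by (simp add: power2_eq_square)
  show ?thesis
  proof (cases "?n = 0")
    case False
    then have "?n > 0" by (simp add: L2_set_nonneg order_less_le)
    with * show ?thesis by (rule mult_right_le_imp_le)
  qed (simp add: L2_set_nonneg)
qed

section \<open>Three-term recurrences and the energy estimate\<close>

lemma three_term_initial_value:
  fixes A B C f :: "nat \<Rightarrow> complex"
  assumes "\<And>j. 1 \<le> j \<Longrightarrow> j \<le> n \<Longrightarrow> A j \<noteq> 0"
  shows "\<exists>u. u 0 = 0 \<and> u 1 = t \<and>
    (\<forall>j\<in>{1..n}. A j * u (Suc j) + B j * u j + C j * u (j - 1) = f j)"
  using assms
proof (induction n)
  case 0
  show ?case by (rule exI[of _ "\<lambda>j. if j = 0 then 0 else t"]) simp
next
  case (Suc n)
  then obtain u where u: "u 0 = 0" "u 1 = t"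
    "\<forall>j\<in>{1..n}. A j * u (Suc j) + B j * u j + C j * u (j - 1) = f j"
    by auto
  define u' where "u' = u(Suc (Suc n) := (f (Suc n) - B (Suc n) * u (Suc n) - C (Suc n) * u n) / A (Suc n))"
  have "A j * u' (Suc j) + B j * u' j + C j * u' (j - 1) = f j" if "j \<in> {1..Suc n}" for j
  proof (cases "j = Suc n")
    case True
    then show ?thesis using Suc.prems[of "Suc n"] by (simp add: u'_def)
  next
    case False
    with that u(3) show ?thesis by (auto simp: u'_def)
  qed
  then show ?case using u by (intro exI[of _ u']) (auto simp: u'_def)
qed

text \<open>Shooting: the solution with \<open>u 0 = 0\<close> depends affinely on \<open>u 1\<close>, and uniqueness says that
  the slope of the terminal condition is nonzero.\<close>

lemma shooting:
  fixes A B C f :: "nat \<Rightarrow> complex"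
  assumes A: "\<And>j. 1 \<le> j \<Longrightarrow> j \<le> n \<Longrightarrow> A j \<noteq> 0"
    and inj: "\<And>u. u 0 = 0 \<Longrightarrow> (\<And>j. 1 \<le> j \<Longrightarrow> j \<le> n \<Longrightarrow>
        A j * u (Suc j) + B j * u j + C j * u (j - 1) = 0)
      \<Longrightarrow> p * u (Suc n) + q * u n = 0 \<Longrightarrow> u 1 = 0"
  shows "\<exists>u. u 0 = 0 \<and> (\<forall>j\<in>{1..n}. A j * u (Suc j) + B j * u j + C j * u (j - 1) = f j)
    \<and> p * u (Suc n) + q * u n = g"
proof -
  obtain u where u: "u 0 = 0"
      "\<forall>j\<in>{1..n}. A j * u (Suc j) + B j * u j + C j * u (j - 1) = f j"
    using three_term_initial_value[of n A 0 B C f] A by blast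
  obtain w where w: "w 0 = 0" "w 1 = 1"
      "\<forall>j\<in>{1..n}. A j * w (Suc j) + B j * w j + C j * w (j - 1) = 0"
    using three_term_initial_value[of n A 1 B C "\<lambda>_. 0"] A by blast
  have nz: "p * w (Suc n) + q * w n \<noteq> 0"
    using inj[of w] w by auto
  define t where "t = (g - (p * u (Suc n) + q * u n)) / (p * w (Suc n) + q * w n)"
  define z where "z = (\<lambda>j. u j + t * w j)"
  have "A j * z (Suc j) + B j * z j + C j * z (j - 1) = f j" if "j \<in> {1..n}" for j
  proof -
    have "A j * z (Suc j) + B j * z j + C j * z (j - 1)
      = (A j * u (Suc j) + B j * u j + C j * u (j - 1))
        + t * (A j * w (Suc j) + B j * w j + C j * w (j - 1))"
      by (simp add: z_def algebra_simps)
    then show ?thesis using u w that by simp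
  qed
  moreover have "p * z (Suc n) + q * z n = g"
  proof -
    have "p * z (Suc n) + q * z n = (p * u (Suc n) + q * u n) + t * (p * w (Suc n) + q * w n)"
      by (simp add: z_def algebra_simps)
    also have "\<dots> = g" using nz by (simp add: t_def)
    finally show ?thesis .
  qed
  ultimately show ?thesis using u w by (intro exI[of _ z]) (auto simp: z_def)
qed

text \<open>Supplies the test function of the energy estimate. Coercivity gives uniqueness, and
  shooting converts it into existence.\<close>

lemma numerov_Dirichlet_solvable:
  assumes "0 < \<theta>" "\<theta> < 1/4"
  shows "\<exists>u. u 0 = 0 \<and> u (Suc n) = 0 \<and> (\<forall>j\<in>{1..n}. numerov \<theta> u j = f j)"
proof -
  have num: "numerov \<theta> u j = of_real \<theta> * u (Suc j) + (1 - 2 * of_real \<theta>) * u j + of_real \<theta> * u (j - 1)"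
    for u j by (simp add: numerov_def d2_def algebra_simps)
  \<comment> \<open>The terminal condition \<open>u (Suc n) = 0\<close> is padded to the shape
    \<open>p * u (Suc n) + q * u n = g\<close> of \<open>shooting\<close>.\<close>
  have "\<exists>u. u 0 = 0 \<and> (\<forall>j\<in>{1..n}. of_real \<theta> * u (Suc j) + (1 - 2 * of_real \<theta>) * u j
      + of_real \<theta> * u (j - 1) = f j) \<and> 1 * u (Suc n) + 0 * u n = 0"
  proof (rule shooting)
    fix u :: "nat \<Rightarrow> complex"
    assume u: "u 0 = 0" "1 * u (Suc n) + 0 * u n = 0"
      and eq: "\<And>j. 1 \<le> j \<Longrightarrow> j \<le> n \<Longrightarrow> of_real \<theta> * u (Suc j) + (1 - 2 * of_real \<theta>) * u j
        + of_real \<theta> * u (j - 1) = 0"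
    have "L2_set (\<lambda>j. cmod (numerov \<theta> u j)) {1..n} = 0"
      using eq by (simp add: L2_set_eq_0_iff num)
    with numerov_coercive[OF assms, of u n] u
    have "(1 - 4 * \<theta>) * L2_set (\<lambda>j. cmod (u j)) {1..n} \<le> 0" by simp
    with assms have "L2_set (\<lambda>j. cmod (u j)) {1..n} \<le> 0"
      by (simp add: mult_le_0_iff)
    then have "L2_set (\<lambda>j. cmod (u j)) {1..n} = 0"
      by (simp add: L2_set_nonneg order_antisym)
    then show "u 1 = 0"
      using u by (cases n) (simp_all add: L2_set_eq_0_iff)
  qed (use assms in auto)
  then show ?thesis unfolding num by auto
qed

text \<open>Testing the equation with \<open>u\<close>, where \<open>numerov \<theta> u = (w + b) / 2\<close>, makes the averaging
  operator disappear from the time derivative and keeps the difference operator symmetric.\<close>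

lemma numerov_energy:
  fixes w b f :: "nat \<Rightarrow> complex" and v :: "nat \<Rightarrow> real"
  assumes \<theta>: "0 < \<theta>" "\<theta> < 1/4" and "c \<ge> 0" "hbar > 0" "\<tau> > 0"
    and "w 0 = 0" "b 0 = 0"
    and W: "W = (\<lambda>i. (w i + b i) / 2)"
    and G: "G = (\<lambda>i. \<i> * of_real hbar * ((w i - b i) / of_real \<tau>) - of_real (v i) * W i)"
    and eq: "\<And>j. 1 \<le> j \<Longrightarrow> j \<le> N \<Longrightarrow> numerov \<theta> G j = - of_real c * d2 W j + f j"
  shows "hbar / (2 * \<tau>) * ((\<Sum>j=1..N. (cmod (w j))\<^sup>2) - (\<Sum>j=1..N. (cmod (b j))\<^sup>2))
    \<le> (L2_set (\<lambda>j. cmod (f j)) {1..N} + c * cmod (W (Suc N)) + \<theta> * cmod (G (Suc N)))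
        * (L2_set (\<lambda>j. cmod (W j)) {1..N} / (1 - 4 * \<theta>))"
proof -
  obtain u where u: "u 0 = 0" "u (Suc N) = 0" "\<forall>j\<in>{1..N}. numerov \<theta> u j = W j"
    using numerov_Dirichlet_solvable[OF \<theta>] by blast
  define U where "U = (\<lambda>i. cnj (u i))"
  have U: "U 0 = 0" "U (Suc N) = 0" "\<forall>j\<in>{1..N}. numerov \<theta> U j = cnj (W j)"
    using u by (auto simp: U_def simp flip: cnj_numerov)
  have z: "W 0 = 0" "G 0 = 0"
    using assms by auto
  have "L2_set (\<lambda>j. cmod (numerov \<theta> u j)) {1..N} = L2_set (\<lambda>j. cmod (W j)) {1..N}"
    using u by (intro L2_set_cong) auto
  then have "(1 - 4 * \<theta>) * L2_set (\<lambda>j. cmod (u j)) {1..N} \<le> L2_set (\<lambda>j. cmod (W j)) {1..N}"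
    using numerov_coercive[OF \<theta> u(1,2)] by simp
  then have nu: "L2_set (\<lambda>j. cmod (u j)) {1..N} \<le> L2_set (\<lambda>j. cmod (W j)) {1..N} / (1 - 4 * \<theta>)"
    using \<theta> by (simp add: field_simps)
  \<comment> \<open>The boundary terms contain \<open>U N\<close>, hence this pointwise bound; for
    \<open>N = 0\<close> it rests on \<open>u 0 = 0\<close>.\<close>
  have uN: "cmod (u N) \<le> L2_set (\<lambda>j. cmod (u j)) {1..N}"
    using u(1) by (cases "N = 0") (auto simp: L2_set_nonneg intro: member_le_L2_set)
  have "(\<Sum>j=1..N. G j * cnj (W j)) + of_real \<theta> * (G (Suc N) * U N)
    = (\<Sum>j=1..N. numerov \<theta> G j * U j)"
    unfolding Green_identity_numerov using U z by simp
  also have "\<dots> = (\<Sum>j=1..N. (- of_real c * d2 W j + f j) * U j)"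
    by (intro sum.cong) (use eq in auto)
  also have "\<dots> = - of_real c * (\<Sum>j=1..N. d2 W j * U j) + (\<Sum>j=1..N. f j * U j)"
    by (simp add: algebra_simps sum.distrib sum_distrib_left sum_negf sum_subtractf)
  also have "(\<Sum>j=1..N. d2 W j * U j) = (\<Sum>j=1..N. W j * d2 U j) + W (Suc N) * U N"
    unfolding Green_identity using U z by simp
  finally have main: "(\<Sum>j=1..N. G j * cnj (W j)) = - of_real c * (\<Sum>j=1..N. W j * d2 U j)
     + ((\<Sum>j=1..N. f j * U j) - of_real c * (W (Suc N) * U N) - of_real \<theta> * (G (Suc N) * U N))"
    by (simp add: algebra_simps)
  \<comment> \<open>Replacing \<open>W\<close> by \<open>u + \<theta> * d2 u\<close> leaves a real
    form plus \<open>\<theta>\<close> times a sum of squares.\<close>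
  have "(\<Sum>j=1..N. W j * d2 U j) = (\<Sum>j=1..N. u j * d2 U j) + of_real \<theta> * (\<Sum>j=1..N. d2 u j * cnj (d2 u j))"
  proof -
    have "(\<Sum>j=1..N. W j * d2 U j) = (\<Sum>j=1..N. numerov \<theta> u j * d2 U j)"
      using u by (intro sum.cong) auto
    then show ?thesis
      by (simp add: numerov_def distrib_right sum.distrib sum_distrib_left mult.assoc cnj_d2 U_def)
  qed
  then have real: "Im (\<Sum>j=1..N. W j * d2 U j) = 0"
    using Im_sum_mult_d2_cnj[OF u(1,2)] by (simp add: U_def complex_mult_cnj)
  have "hbar / (2 * \<tau>) * ((\<Sum>j=1..N. (cmod (w j))\<^sup>2) - (\<Sum>j=1..N. (cmod (b j))\<^sup>2))
     = Im (\<Sum>j=1..N. G j * cnj (W j))"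
  proof -
    \<comment> \<open>The real potential drops out of the imaginary part; the time difference
      contributes \<open>Re ((w - b) * cnj (w + b))\<close>, the difference of the squared
      moduli.\<close>
    have "Im (G j * cnj (W j)) = hbar / (2 * \<tau>) * ((cmod (w j))\<^sup>2 - (cmod (b j))\<^sup>2)" for j
      unfolding G W cmod_power2 using \<open>\<tau> > 0\<close>
      by (simp add: field_simps power2_eq_square)
    then show ?thesis by (simp add: sum_distrib_left sum_subtractf right_diff_distrib)
  qed
  also have "\<dots> = Im ((\<Sum>j=1..N. f j * U j) - of_real c * (W (Suc N) * U N)
      - of_real \<theta> * (G (Suc N) * U N))"
    unfolding main using real by simp
  also have "\<dots> \<le> cmod ((\<Sum>j=1..N. f j * U j) - of_real c * (W (Suc N) * U N)
      - of_real \<theta> * (G (Suc N) * U N))"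
    using abs_Im_le_cmod abs_le_D1 by blast
  also have "\<dots> \<le> cmod (\<Sum>j=1..N. f j * U j) + cmod (of_real c * (W (Suc N) * U N))
      + cmod (of_real \<theta> * (G (Suc N) * U N))"
    by (meson norm_triangle_ineq4 add_right_mono order_trans)
  also have "\<dots> \<le> L2_set (\<lambda>j. cmod (f j)) {1..N} * L2_set (\<lambda>j. cmod (u j)) {1..N}
      + c * cmod (W (Suc N)) * L2_set (\<lambda>j. cmod (u j)) {1..N}
      + \<theta> * cmod (G (Suc N)) * L2_set (\<lambda>j. cmod (u j)) {1..N}"
  proof (intro add_mono)
    show "cmod (\<Sum>j=1..N. f j * U j)
      \<le> L2_set (\<lambda>j. cmod (f j)) {1..N} * L2_set (\<lambda>j. cmod (u j)) {1..N}"
      using cmod_sum_mult_le_L2[of f U] by (simp add: U_def)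
    show "cmod (of_real c * (W (Suc N) * U N)) \<le> c * cmod (W (Suc N)) * L2_set (\<lambda>j. cmod (u j)) {1..N}"
      using uN \<open>c \<ge> 0\<close> by (simp add: norm_mult U_def mult.assoc mult_left_mono)
    show "cmod (of_real \<theta> * (G (Suc N) * U N)) \<le> \<theta> * cmod (G (Suc N)) * L2_set (\<lambda>j. cmod (u j)) {1..N}"
      using uN \<theta> by (simp add: norm_mult U_def mult.assoc mult_left_mono)
  qed
  also have "\<dots> = (L2_set (\<lambda>j. cmod (f j)) {1..N} + c * cmod (W (Suc N)) + \<theta> * cmod (G (Suc N)))
      * L2_set (\<lambda>j. cmod (u j)) {1..N}"
    by (simp add: algebra_simps)
  also have "\<dots> \<le> (L2_set (\<lambda>j. cmod (f j)) {1..N} + c * cmod (W (Suc N)) + \<theta> * cmod (G (Suc N)))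
      * (L2_set (\<lambda>j. cmod (W j)) {1..N} / (1 - 4 * \<theta>))"
    using nu \<open>c \<ge> 0\<close> \<theta> by (intro mult_left_mono) (auto simp: L2_set_nonneg)
  finally show ?thesis .
qed

section \<open>The kernel and the decaying root\<close>

text \<open>The recurrence is the coefficient form of \<open>P * G' = (P' / 2) * G\<close>, whose
  solutions are the constant multiples of the square root of \<open>P\<close>. It expands
  \<open>sqrt (1 - 2 * \<mu> * z + z^2)\<close> at \<open>z = \<kappa> * fps_X\<close>, a relative
  of the Legendre generating function; stating the square avoids roots of power series.\<close>

lemma kernel_rec_square:
  fixes c \<kappa> :: complex and \<mu> :: real
  shows "(Abs_fps (kernel_rec c \<kappa> \<mu>))\<^sup>2
    = fps_const (c\<^sup>2) * (1 - fps_const (2 * \<kappa> * of_real \<mu>) * fps_X + fps_const (\<kappa>\<^sup>2) * fps_X\<^sup>2)"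
proof -
  define g where "g = kernel_rec c \<kappa> \<mu>"
  define G where "G = Abs_fps g"
  define P :: "complex fps" where
    "P = 1 - fps_const (2 * \<kappa> * of_real \<mu>) * fps_X + fps_const (\<kappa>\<^sup>2) * fps_X\<^sup>2"
  have g0: "g 0 = c" and g1: "g (Suc 0) = - c * \<kappa> * of_real \<mu>" by (simp_all add: g_def)
  \<comment> \<open>Clearing the denominator \<open>m = n + 2\<close> exhibits the coefficients of a
    first-order differential equation.\<close>
  have gs: "of_nat (Suc (Suc n)) * g (Suc (Suc n))
     = of_real (2 * real n + 1) * \<kappa> * of_real \<mu> * g (Suc n) - (of_nat n - 1) * \<kappa>\<^sup>2 * g n" for n
  proof -
    define r where "r = real (Suc (Suc n))"
    have r: "r \<noteq> 0" "r = real n + 2" by (auto simp: r_def)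
    have "of_nat (Suc (Suc n)) * g (Suc (Suc n)) = of_real r * (of_real ((2 * r - 3) / r) * \<kappa> * of_real \<mu> * g (Suc n)
       - of_real ((r - 3) / r) * \<kappa>\<^sup>2 * g n)"
      by (simp only: g_def kernel_rec.simps(3) Let_def r_def of_real_of_nat_eq)
    also have "\<dots> = of_real (r * ((2 * r - 3) / r)) * \<kappa> * of_real \<mu> * g (Suc n)
       - of_real (r * ((r - 3) / r)) * \<kappa>\<^sup>2 * g n"
      by (simp only: of_real_mult right_diff_distrib mult.assoc)
    also have "r * ((2 * r - 3) / r) = 2 * real n + 1"
      using r by simp
    also have "r * ((r - 3) / r) = real n - 1"
      using r by simp
    finally show ?thesis by simp
  qed
  have P_mult: "(P * H) $ n = H $ n - 2 * \<kappa> * of_real \<mu> * (if n = 0 then 0 else H $ (n - 1))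
      + \<kappa>\<^sup>2 * (if n < 2 then 0 else H $ (n - 2))" for H n
  proof -
    have "P * H = H - fps_const (2 * \<kappa> * of_real \<mu>) * (fps_X * H) + fps_const (\<kappa>\<^sup>2) * (fps_X\<^sup>2 * H)"
      by (simp add: P_def algebra_simps)
    then show ?thesis
      by (simp add: fps_X_power_mult_nth)
  qed
  define Q where "Q = fps_const (- \<kappa> * of_real \<mu>) + fps_const (\<kappa>\<^sup>2) * fps_X"
  have P': "fps_deriv P = 2 * Q"
    by (simp add: P_def Q_def power2_eq_square numeral_fps_const algebra_simps
        flip: fps_const_mult fps_const_neg)
  have ode: "P * fps_deriv G = Q * G"
  proof (rule fps_ext)
    fix n
    have Q_mult: "(Q * G) $ n = - \<kappa> * of_real \<mu> * g n + \<kappa>\<^sup>2 * (if n = 0 then 0 else g (n - 1))"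
    proof -
      have "Q * G = fps_const (- \<kappa> * of_real \<mu>) * G + fps_const (\<kappa>\<^sup>2) * (fps_X * G)"
        by (simp add: Q_def algebra_simps)
      then show ?thesis by (simp add: G_def)
    qed
    consider "n = 0" | "n = 1" | m where "n = Suc (Suc m)"
      by (metis One_nat_def not0_implies_Suc)
    then show "(P * fps_deriv G) $ n = (Q * G) $ n"
    proof cases
      case 1
      then show ?thesis unfolding P_mult Q_mult by (simp add: G_def g0 g1)
    next
      case 2
      then show ?thesis unfolding P_mult Q_mult using gs[of 0]
        by (simp add: G_def algebra_simps)
    next
      case 3
      then show ?thesis unfolding P_mult Q_mult using gs[of "Suc m"]
        by (simp add: G_def algebra_simps)
    qed
  qed
  have P0: "P $ 0 = 1" by (simp add: P_def)
  then have P_nz: "P \<noteq> 0" by auto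
  \<comment> \<open>The quotient of \<open>G^2\<close> by \<open>P\<close> has derivative zero by
    the differential equation, so it is the constant \<open>c^2\<close>; \<open>P $ 0 = 1\<close>
    makes \<open>P\<close> invertible.\<close>
  define H where "H = G\<^sup>2 * inverse P"
  have HP: "G\<^sup>2 = H * P"
    using P0 by (simp add: H_def mult.assoc inverse_mult_eq_1)
  have "fps_deriv (G\<^sup>2) * P = 2 * G * (P * fps_deriv G)"
    by (simp add: power2_eq_square algebra_simps)
  also have "\<dots> = fps_deriv P * G\<^sup>2"
    unfolding ode P' by (simp add: power2_eq_square algebra_simps)
  finally have "fps_deriv (G\<^sup>2) * P = fps_deriv P * G\<^sup>2" .
  then have "fps_deriv H * P * P = 0"
    unfolding HP fps_deriv_mult by (simp add: algebra_simps)
  then have "fps_deriv H = 0" using P_nz by simp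
  then have "H = fps_const (H $ 0)" by (simp add: fps_deriv_eq_0_iff)
  moreover have "H $ 0 = c\<^sup>2"
    using P0 g0 by (simp add: H_def G_def power2_eq_square)
  ultimately show ?thesis
    using HP unfolding G_def g_def P_def by simp
qed

text \<open>A weighted sum of the moduli of the first \<open>m + 1\<close> coefficients is
  submultiplicative. For a small weight \<open>e\<close> it is close to \<open>cmod (F $ 0)\<close>,
  hence below 1, so it decays geometrically along the powers and controls each of these
  coefficients.\<close>

lemma fps_power_nth_tendsto_0:
  fixes F :: "complex fps"
  assumes "cmod (F $ 0) < 1"
  shows "(\<lambda>n. (F ^ n) $ m) \<longlonglongrightarrow> 0"
proof -
  define nrm where "nrm e G = (\<Sum>k\<le>m. e ^ k * cmod (G $ k))" for e and G :: "complex fps"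
  \<comment> \<open>The truncation at \<open>m\<close> makes \<open>nrm e F\<close> a polynomial in
    \<open>e\<close>, so no radius of convergence is involved.\<close>
  have "isCont (\<lambda>e. nrm e F) 0"
    unfolding nrm_def by (intro continuous_intros)
  moreover have "nrm 0 F < 1"
    using assms by (simp add: nrm_def power_0_left if_distrib[of "\<lambda>x. x * _"] cong: if_cong)
  ultimately have "\<forall>\<^sub>F e in at 0. nrm e F < 1"
    by (simp add: isCont_def order_tendsto_iff)
  then have "\<forall>\<^sub>F e in at_right 0. nrm e F < 1"
    by (rule filter_leD[OF at_le, rotated]) simp
  moreover have "\<forall>\<^sub>F e::real in at_right 0. e > 0"
    by (simp add: eventually_at_right_less)
  ultimately have "\<forall>\<^sub>F e in at_right 0. nrm e F < 1 \<and> e > 0"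
    by (rule eventually_conj)
  then obtain e :: real where e: "e > 0" "nrm e F < 1"
    using eventually_happens[of _ "at_right (0::real)"] by auto
  have nonneg: "nrm e G \<ge> 0" for G
    unfolding nrm_def using e by (intro sum_nonneg) auto
  have mult: "nrm e (G * H) \<le> nrm e G * nrm e H" for G H
  proof -
    have "nrm e (G * H) \<le> (\<Sum>k\<le>m. \<Sum>i\<le>k. (e ^ i * cmod (G $ i)) * (e ^ (k - i) * cmod (H $ (k - i))))"
      unfolding nrm_def
    proof (rule sum_mono)
      fix k
      have "e ^ k * cmod ((G * H) $ k) \<le> e ^ k * (\<Sum>i=0..k. cmod (G $ i) * cmod (H $ (k - i)))"
        unfolding fps_mult_nth using e by (intro mult_left_mono) (auto intro!: sum_norm_le simp: norm_mult)
      also have "\<dots> = (\<Sum>i\<le>k. (e ^ i * cmod (G $ i)) * (e ^ (k - i) * cmod (H $ (k - i))))"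
        unfolding sum_distrib_left atMost_atLeast0
        by (intro sum.cong refl) (auto simp: power_add[symmetric] mult_ac)
      finally show "e ^ k * cmod ((G * H) $ k) \<le> \<dots>" .
    qed
    also have "\<dots> = (\<Sum>(i, l)\<in>{(i, l). i + l \<le> m}. (e ^ i * cmod (G $ i)) * (e ^ l * cmod (H $ l)))"
      by (rule sum.triangle_reindex_eq[symmetric])
    also have "\<dots> \<le> (\<Sum>(i, l)\<in>{..m} \<times> {..m}. (e ^ i * cmod (G $ i)) * (e ^ l * cmod (H $ l)))"
      using e by (intro sum_mono2) auto
    also have "\<dots> = nrm e G * nrm e H"
      unfolding nrm_def sum_product sum.cartesian_product ..
    finally show ?thesis .
  qed
  have le: "nrm e (F ^ n) \<le> (nrm e F) ^ n" for n
  proof (induction n)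
    case 0
    show ?case by (simp add: nrm_def if_distrib[of "\<lambda>x. _ * x"] if_distrib[of cmod] cong: if_cong)
  next
    case (Suc n)
    have "nrm e (F ^ Suc n) \<le> nrm e F * nrm e (F ^ n)"
      using mult by simp
    also have "\<dots> \<le> nrm e F * nrm e F ^ n"
      using Suc nonneg by (intro mult_left_mono)
    finally show ?case by simp
  qed
  have "e ^ m * cmod ((F ^ n) $ m) \<le> nrm e (F ^ n)" for n
    unfolding nrm_def using e by (intro member_le_sum) auto
  then have "e ^ m * cmod ((F ^ n) $ m) \<le> nrm e F ^ n" for n
    using le order_trans by blast
  then have "cmod ((F ^ n) $ m) \<le> (1 / e ^ m) * nrm e F ^ n" for n
    using e by (simp add: pos_le_divide_eq mult.commute)
  then have bound: "\<forall>n. norm ((F ^ n) $ m) \<le> (1 / e ^ m) * nrm e F ^ n" by blast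
  have "(\<lambda>n. (1 / e ^ m) * nrm e F ^ n) \<longlonglongrightarrow> (1 / e ^ m) * 0"
    using nonneg[of F] e by (intro tendsto_mult tendsto_const LIMSEQ_realpow_zero) auto
  then have "(\<lambda>n. (1 / e ^ m) * nrm e F ^ n) \<longlonglongrightarrow> 0" by simp
  with bound show ?thesis
    by (rule Lim_null_comparison[OF always_eventually])
qed

text \<open>The sign of \<open>Im s\<close> selects one of the two square roots, and its quotient by
  \<open>a\<close> must then lie in the right half plane. With \<open>\<sigma> = s / a\<close> the
  relation reads \<open>a * (\<sigma>^2 - g) = 2\<close>; if \<open>Re \<sigma> \<le> 0\<close>, its
  imaginary part contradicts \<open>Im (a * \<sigma>) > 0\<close>.\<close>

lemma Re_sqrt_branch_pos:
  fixes a s :: complex and g :: real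
  assumes "Im a > 0" "Im s > 0" "g \<ge> 0" "s\<^sup>2 = 2 * a + of_real g * a\<^sup>2"
  shows "Re (s / a) > 0"
proof (rule ccontr)
  define \<sigma> where "\<sigma> = s / a"
  define x where "x = Re a"
  define y where "y = Im a"
  define p where "p = Re \<sigma>"
  define v where "v = Im \<sigma>"
  assume "\<not> Re (s / a) > 0"
  then have p: "p \<le> 0" by (simp add: p_def \<sigma>_def)
  have y: "y > 0" using assms by (simp add: y_def)
  have a: "a \<noteq> 0" using assms by auto
  have s: "s = a * \<sigma>" using a by (simp add: \<sigma>_def)
  have Ims: "x * v + y * p > 0" using assms(2) unfolding s by (simp add: x_def y_def p_def v_def)
  have "a * (a * (\<sigma>\<^sup>2 - of_real g)) = a * 2"
    using assms(4) unfolding s by (simp add: power2_eq_square algebra_simps)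
  then have eq: "a * (\<sigma>\<^sup>2 - of_real g) = 2" using a by simp
  have re: "x * (p\<^sup>2 - v\<^sup>2 - g) - y * (2 * p * v) = 2"
    using arg_cong[OF eq, of Re] by (simp add: x_def y_def p_def v_def power2_eq_square algebra_simps)
  have im: "x * (2 * p * v) + y * (p\<^sup>2 - v\<^sup>2 - g) = 0"
    using arg_cong[OF eq, of Im] by (simp add: x_def y_def p_def v_def power2_eq_square algebra_simps)
  show False
  proof (cases "p = 0")
    case True
    with im y have "v\<^sup>2 + g = 0" by simp
    with assms(3) have "v = 0" by (simp add: add_nonneg_eq_0_iff)
    with True Ims show False by simp
  next
    case False
    with p have "p < 0" by simp
    then have "(x * v + y * p) * p < 0" using Ims by (simp add: mult_pos_neg)
    then have "y * (p\<^sup>2 - v\<^sup>2 - g) > 2 * y * p\<^sup>2"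
      using im by (simp add: power2_eq_square algebra_simps)
    then have "y * (p\<^sup>2 + v\<^sup>2 + g) < 0" by (simp add: algebra_simps)
    moreover have "y * (p\<^sup>2 + v\<^sup>2 + g) \<ge> 0" using y assms(3) by simp
    ultimately show False by simp
  qed
qed

text \<open>The two roots have product 1, so it suffices to compare their moduli; with
  \<open>\<sigma> = s / a\<close> this comes down to \<open>Re \<sigma> > 0\<close>.\<close>

lemma decaying_root:
  fixes a s :: complex and h \<theta> :: real
  assumes "Im a > 0" "Im s > 0" "h > 0" "0 < \<theta>" "\<theta> < 1/4"
    and s: "s\<^sup>2 = 2 * a + of_real ((1 - 4 * \<theta>) * h\<^sup>2) * a\<^sup>2"
    and A: "A = 1/2 - of_real (\<theta> * h\<^sup>2) * cnj a"
  shows "cmod ((A + of_real (h\<^sup>2 / 2) * cnj a - of_real (h / 2) * cnj s) / A) < 1"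
proof -
  define \<sigma> where "\<sigma> = s / a"
  \<comment> \<open>\<open>b - e\<close> and \<open>b + e\<close> are \<open>A\<close> times the two
    roots of the quadratic: their sum is \<open>2 * A + h^2 * cnj a\<close>, their product
    \<open>A^2\<close>.\<close>
  define b where "b = A + of_real (h\<^sup>2 / 2) * cnj a"
  define e where "e = of_real (h / 2) * cnj s"
  have a: "a \<noteq> 0" using assms by auto
  have s': "s = a * \<sigma>" using a by (simp add: \<sigma>_def)
  have "Im A \<noteq> 0" using assms by (simp add: A)
  then have A0: "A \<noteq> 0" by auto
  have cs: "(cnj s)\<^sup>2 = 2 * cnj a + of_real ((1 - 4 * \<theta>) * h\<^sup>2) * (cnj a)\<^sup>2"
    using arg_cong[OF s, of cnj] by simp
  have "(b - e) * (b + e) = b\<^sup>2 - of_real (h\<^sup>2 / 4) * (cnj s)\<^sup>2"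
    by (simp add: e_def power2_eq_square algebra_simps)
  also have "\<dots> = A\<^sup>2"
    unfolding cs b_def A by (simp add: field_simps power2_eq_square)
  finally have prod: "cmod (b - e) * cmod (b + e) = cmod A * cmod A"
    by (simp add: power2_eq_square flip: norm_mult)
  have "a * (a * \<sigma>\<^sup>2) = a * (2 + of_real ((1 - 4 * \<theta>) * h\<^sup>2) * a)"
    using s unfolding s' by (simp add: power2_eq_square algebra_simps)
  then have "a * \<sigma>\<^sup>2 = 2 + of_real ((1 - 4 * \<theta>) * h\<^sup>2) * a" using a by simp
  then have "cnj b = a * (\<sigma>\<^sup>2 + of_real (h\<^sup>2)) / 4"
    by (simp add: b_def A algebra_simps)
  then have b: "4 * cnj b = a * (\<sigma>\<^sup>2 + of_real (h\<^sup>2))"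
    by (simp add: ac_simps)
  \<comment> \<open>Goal: write \<open>e * cnj b\<close> as a combination of \<open>\<sigma>\<close>
    and \<open>cnj \<sigma>\<close> with nonnegative real coefficients, so that its real part has
    the sign of \<open>Re \<sigma>\<close>.\<close>
  have "4 * (e * cnj b) = e * (4 * cnj b)"
    by simp
  also have "\<dots> = 4 * (of_real (h / 8) * (a * cnj a) * ((\<sigma> * cnj \<sigma>) * \<sigma> + of_real (h\<^sup>2) * cnj \<sigma>))"
    unfolding b e_def s' by (simp add: power2_eq_square algebra_simps)
  finally have "e * cnj b = of_real (h / 8) * (a * cnj a) * ((\<sigma> * cnj \<sigma>) * \<sigma> + of_real (h\<^sup>2) * cnj \<sigma>)"
    by (simp only: mult_cancel_left) simp
  also have "\<dots> = of_real (h / 8 * (cmod a)\<^sup>2) * (of_real ((cmod \<sigma>)\<^sup>2) * \<sigma> + of_real (h\<^sup>2) * cnj \<sigma>)"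
    by (simp add: complex_norm_square[symmetric])
  finally have eb: "e * cnj b = \<dots>" .
  have "Re (of_real k * (of_real u * z + of_real v * cnj z)) = k * ((u + v) * Re z)" for k u v z
    by (simp add: algebra_simps)
  then have "Re (e * cnj b) = h / 8 * (cmod a)\<^sup>2 * (((cmod \<sigma>)\<^sup>2 + h\<^sup>2) * Re \<sigma>)"
    unfolding eb .
  also have "\<dots> > 0"
  proof -
    have "Re \<sigma> > 0" unfolding \<sigma>_def
      using assms by (intro Re_sqrt_branch_pos[of _ _ "(1 - 4 * \<theta>) * h\<^sup>2"]) auto
    moreover have "(cmod \<sigma>)\<^sup>2 + h\<^sup>2 > 0" using \<open>h > 0\<close> by (simp add: add_nonneg_pos)
    ultimately show ?thesis using a \<open>h > 0\<close> by simp
  qed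
  finally have pos: "Re (e * cnj b) > 0" .
  have "(cmod (b + e))\<^sup>2 - (cmod (b - e))\<^sup>2 = 4 * Re (e * cnj b)"
    by (simp only: cmod_power2) (simp add: power2_eq_square algebra_simps)
  with pos have "(cmod (b - e))\<^sup>2 < (cmod (b + e))\<^sup>2" by simp
  then have lt: "cmod (b - e) < cmod (b + e)"
    by (rule power2_less_imp_less) simp
  have "(cmod (b - e))\<^sup>2 < (cmod A)\<^sup>2"
  proof (cases "cmod (b - e) = 0")
    case False
    then have "cmod (b - e) * cmod (b - e) < cmod (b - e) * cmod (b + e)"
      using lt by (intro mult_strict_left_mono) auto
    then show ?thesis using prod by (simp add: power2_eq_square)
  qed (use A0 in simp)
  then have "cmod (b - e) < cmod A"
    by (rule power2_less_imp_less) simp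
  then show ?thesis using A0 by (simp add: b_def e_def norm_divide)
qed

section \<open>The exterior problem\<close>

text \<open>In the time variable the exterior problem is a constant-coefficient recurrence in \<open>j\<close> over
  the ring of formal power series; its decaying solutions are geometric with ratio \<open>N\<close>.\<close>

locale exterior =
  fixes a s :: complex and h \<theta> :: real and Rk :: "nat \<Rightarrow> complex"
  assumes Im_a: "Im a > 0" and Im_s: "Im s > 0" and h: "h > 0" and \<theta>: "0 < \<theta>" "\<theta> < 1/4"
    and s_sq: "s\<^sup>2 = 2 * a + of_real ((1 - 4 * \<theta>) * h\<^sup>2) * a\<^sup>2"
    and Rk_0: "Rk 0 = - cnj s / 2"
    and Rk_sq: "4 * (Abs_fps Rk)\<^sup>2 = (fps_const (cnj a) + fps_const a * fps_X)
      * (2 * (1 + fps_X) + fps_const (of_real ((1 - 4 * \<theta>) * h\<^sup>2)) * (fps_const (cnj a) + fps_const a * fps_X))"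
begin

text \<open>\<open>fps_X\<close> delays by one time level. Thus \<open>r\<close> is the symbol of
  \<open>cnj a * w + a * b\<close> with old value \<open>b\<close>, and \<open>A\<close> below is
  the coefficient of the second difference in the exterior equation.\<close>

definition r :: "complex fps" where "r = fps_const (cnj a) + fps_const a * fps_X"
definition A :: "complex fps" where
  "A = fps_const (1/2) * (1 + fps_X) - fps_const (of_real (\<theta> * h\<^sup>2)) * r"
text \<open>The quadratic formula for \<open>A * (N - 1)^2 = h^2 * r * N\<close>, with
  \<open>h * Rk\<close> as square root of the reduced discriminant; the value \<open>Rk 0\<close>
  picks the decaying root.\<close>

definition N :: "complex fps" where
  "N = (fps_const (of_real h) * Abs_fps Rk + A + fps_const (of_real (h\<^sup>2 / 2)) * r) * inverse A"

lemma A_0: "A $ 0 = 1/2 - of_real (\<theta> * h\<^sup>2) * cnj a"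
  by (simp add: A_def r_def)

lemma A_0_nz: "A $ 0 \<noteq> 0"
proof -
  have "Im (A $ 0) \<noteq> 0" using Im_a h \<theta> by (simp add: A_0)
  then show ?thesis by auto
qed

lemma N_0: "cmod (N $ 0) < 1"
proof -
  have "N $ 0 = (A $ 0 + of_real (h\<^sup>2 / 2) * cnj a - of_real (h / 2) * cnj s) / A $ 0"
  proof -
    have "r $ 0 = cnj a" by (simp add: r_def)
    then have "N $ 0 = (of_real h * Rk 0 + A $ 0 + of_real (h\<^sup>2 / 2) * cnj a) * inverse (A $ 0)"
      unfolding N_def by simp
    also have "of_real h * Rk 0 + A $ 0 + of_real (h\<^sup>2 / 2) * cnj a
      = A $ 0 + of_real (h\<^sup>2 / 2) * cnj a - of_real (h / 2) * cnj s"
      unfolding Rk_0 by simp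
    finally show ?thesis by (simp only: divide_inverse)
  qed
  then show ?thesis
    using decaying_root[OF Im_a Im_s h \<theta> s_sq A_0] by simp
qed

lemma A_N: "A * N = fps_const (of_real h) * Abs_fps Rk + A + fps_const (of_real (h\<^sup>2 / 2)) * r"
  using A_0_nz by (simp add: N_def mult.left_commute[of A] inverse_mult_eq_1')

lemma N_eq: "A * (N\<^sup>2 - 2 * N + 1) = fps_const (of_real (h\<^sup>2)) * r * N"
proof -
  define G where "G = Abs_fps Rk"
  define H :: "complex fps" where "H = fps_const (of_real h)"
  define T :: "complex fps" where "T = fps_const (of_real \<theta>)"
  \<comment> \<open>Naming the constant series 1/2 leaves \<open>algebra\<close> with the single
    ring relation \<open>2 * hf = 1\<close>.\<close>
  define hf :: "complex fps" where "hf = fps_const (1/2)"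
  have hf: "2 * hf = 1" by (simp add: hf_def numeral_fps_const)
  have A': "A = hf * (1 + fps_X) - T * H\<^sup>2 * r"
    by (simp add: A_def hf_def T_def H_def power2_eq_square)
  have AN: "A * N = H * G + A + hf * H\<^sup>2 * r"
    unfolding A_N G_def H_def hf_def by (simp add: power2_eq_square)
  have "fps_const (of_real ((1 - 4 * \<theta>) * h\<^sup>2)) = (1 - 4 * T) * H\<^sup>2"
    by (simp add: T_def H_def power2_eq_square numeral_fps_const)
  then have G: "4 * G\<^sup>2 = r * (2 * (1 + fps_X) + (1 - 4 * T) * H\<^sup>2 * r)"
    using Rk_sq by (simp add: G_def r_def)
  have "4 * (A * (A * (N\<^sup>2 - 2 * N + 1))) = 4 * (A * N - A)\<^sup>2"
    by (simp add: power2_eq_square algebra_simps)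
  also have "\<dots> = 4 * (H * G + hf * H\<^sup>2 * r)\<^sup>2"
    unfolding AN by simp
  also have "\<dots> = H\<^sup>2 * (4 * G\<^sup>2) + 8 * hf * H^3 * G * r + 4 * hf\<^sup>2 * H^4 * r\<^sup>2"
    by (simp add: power2_eq_square power3_eq_cube power4_eq_xxxx algebra_simps)
  also have "\<dots> = 4 * (H\<^sup>2 * r * (H * G + A + hf * H\<^sup>2 * r))"
    unfolding G A' using hf by algebra
  also have "\<dots> = 4 * (A * (H\<^sup>2 * r * N))"
    unfolding AN[symmetric] by (simp add: algebra_simps)
  finally have "A * (A * (N\<^sup>2 - 2 * N + 1)) = A * (H\<^sup>2 * r * N)"
    by simp
  moreover have "A \<noteq> 0" using A_0_nz by auto
  ultimately show ?thesis by (simp add: H_def power2_eq_square)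
qed

lemma A_mult_nth:
  "(A * u) $ m = (u $ m + (if m = 0 then 0 else u $ (m - 1))) / 2
     - of_real (\<theta> * h\<^sup>2) * (cnj a * u $ m + a * (if m = 0 then 0 else u $ (m - 1)))"
proof -
  have "A * u = fps_const (1/2) * (u + fps_X * u)
     - fps_const (of_real (\<theta> * h\<^sup>2)) * (fps_const (cnj a) * u + fps_const a * (fps_X * u))"
    by (simp add: A_def r_def algebra_simps)
  then show ?thesis by (simp only: fps_sub_nth fps_mult_left_const_nth fps_add_nth fps_X_mult_nth) simp
qed

lemma r_mult_nth: "(r * u) $ m = cnj a * u $ m + a * (if m = 0 then 0 else u $ (m - 1))"
proof -
  have "r * u = fps_const (cnj a) * u + fps_const a * (fps_X * u)"
    by (simp add: r_def algebra_simps)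
  then show ?thesis by simp
qed

text \<open>\<open>ext f g m n\<close> is the value at time level \<open>m\<close> and node \<open>n\<close> to the right of the node carrying
  the trace \<open>f\<close>, so \<open>g\<close> is the trace at \<open>n = 1\<close>.\<close>

definition ext :: "(nat \<Rightarrow> complex) \<Rightarrow> (nat \<Rightarrow> complex) \<Rightarrow> nat \<Rightarrow> nat \<Rightarrow> complex" where
  "ext f g m n = (if n = 0 then f m else (N ^ (n - 1) * Abs_fps g) $ m)"

lemma ext_1: "ext f g m (Suc 0) = g m"
  by (simp add: ext_def)

lemma ext_tendsto_0: "(\<lambda>n. ext f g m n) \<longlonglongrightarrow> 0"
proof -
  have "(\<lambda>n. \<Sum>i=0..m. (N ^ n) $ i * Abs_fps g $ (m - i)) \<longlonglongrightarrow> (\<Sum>i=0..m. 0 * Abs_fps g $ (m - i))"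
    by (intro tendsto_sum tendsto_mult tendsto_const fps_power_nth_tendsto_0 N_0)
  then have "(\<lambda>n. (N ^ n * Abs_fps g) $ m) \<longlonglongrightarrow> 0"
    by (simp add: fps_mult_nth)
  then have "(\<lambda>n. ext f g m (Suc n)) \<longlonglongrightarrow> 0"
    by (simp add: ext_def)
  then show ?thesis by (rule LIMSEQ_imp_Suc)
qed

text \<open>Zero initial traces give a zero initial exterior; here the condition on the initial data
  in the last two columns enters the stability bound.\<close>

lemma ext_0_level: "g 0 = 0 \<Longrightarrow> n > 0 \<Longrightarrow> ext f g 0 n = 0"
  by (simp add: ext_def)

text \<open>Time level \<open>-1\<close> is taken to be zero, so that level \<open>0\<close> of the equation is the homogeneous
  one-step problem; the uniqueness proof of a single step uses that level.\<close>

definition tbc_residual :: "(nat \<Rightarrow> complex) \<Rightarrow> (nat \<Rightarrow> complex) \<Rightarrow> nat \<Rightarrow> complex" where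
  "tbc_residual f g m = (let f' = if m = 0 then 0 else f (m - 1); g' = if m = 0 then 0 else g (m - 1) in
     ((g m + g') / 2 - (f m + f') / 2) + of_real (h\<^sup>2)
       * (of_real \<theta> * (cnj a * f m + a * f') + of_real (1/2 - \<theta>) * (cnj a * g m + a * g'))
     - of_real h * conv Rk g m)"

text \<open>For \<open>n \<ge> 2\<close> all three nodes carry powers of \<open>N\<close>, and the
  equation is a multiple of \<open>N_eq\<close>. At \<open>n = 1\<close> the left neighbour is the
  independent trace \<open>f\<close>, and the defect of the equation is minus
  \<open>tbc_residual\<close>.\<close>

lemma ext_equation_fps:
  fixes f g
  defines "w \<equiv> \<lambda>n. Abs_fps (\<lambda>m. ext f g m n)"
  assumes n: "n \<ge> 1" and tbc: "n = 1 \<Longrightarrow> tbc_residual f g m = 0"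
  shows "(A * (w (Suc n) - 2 * w n + w (n - 1))) $ m = (fps_const (of_real (h\<^sup>2)) * (r * w n)) $ m"
proof -
  have w: "w (Suc k) = N ^ k * Abs_fps g" for k
    unfolding w_def ext_def by (simp add: fps_nth_inverse)
  show ?thesis
  proof (cases "n = 1")
    case False
    with n obtain k where k: "n = Suc (Suc k)"
      by (metis One_nat_def not0_implies_Suc not_one_le_zero)
    have "A * (w (Suc n) - 2 * w n + w (n - 1)) = (A * (N\<^sup>2 - 2 * N + 1)) * (N ^ k * Abs_fps g)"
      unfolding k by (simp add: w power2_eq_square algebra_simps)
    also have "\<dots> = fps_const (of_real (h\<^sup>2)) * (r * w n)"
      unfolding N_eq k by (simp add: w algebra_simps)
    finally show ?thesis by simp
  next
    case True
    have w0: "w 0 = Abs_fps f" and w1: "w (Suc 0) = Abs_fps g" and w2: "w (Suc (Suc 0)) = N * Abs_fps g"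
      by (simp_all add: w w_def ext_def fps_nth_inverse)
    have "A * (w (Suc n) - 2 * w n + w (n - 1)) - fps_const (of_real (h\<^sup>2)) * (r * w n)
      = (A * N) * Abs_fps g - A * (2 * Abs_fps g) + A * Abs_fps f - fps_const (of_real (h\<^sup>2)) * (r * Abs_fps g)"
      using True by (simp add: w0 w1 w2 algebra_simps)
    also have "\<dots> = fps_const (of_real h) * (Abs_fps Rk * Abs_fps g) + fps_const (of_real (h\<^sup>2 / 2)) * (r * Abs_fps g)
        - fps_const (of_real (h\<^sup>2)) * (r * Abs_fps g) - A * Abs_fps g + A * Abs_fps f"
      unfolding A_N by (simp add: algebra_simps)
    finally have eq: "A * (w (Suc n) - 2 * w n + w (n - 1)) - fps_const (of_real (h\<^sup>2)) * (r * w n) = \<dots>" .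
    define f' g' where fg': "f' = (if m = 0 then 0 else f (m - 1))" "g' = (if m = 0 then 0 else g (m - 1))"
    define k where "k = (of_real (h\<^sup>2) :: complex)"
    define t where "t = (of_real \<theta> :: complex)"
    have of_real: "of_real (h\<^sup>2 / 2) = k / 2" "of_real (\<theta> * h\<^sup>2) = t * k" "of_real (1/2 - \<theta>) = 1/2 - t"
      by (simp_all add: k_def t_def)
    define f1 where "f1 = cnj a * f m + a * f'"
    define g1 where "g1 = cnj a * g m + a * g'"
    have Ag: "(A * Abs_fps g) $ m = (g m + g') / 2 - t * k * g1"
      and Af: "(A * Abs_fps f) $ m = (f m + f') / 2 - t * k * f1"
      unfolding A_mult_nth of_real fg' f1_def g1_def by simp_all
    have rg: "(r * Abs_fps g) $ m = g1"
      unfolding r_mult_nth fg' g1_def by simp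
    have Rg: "(Abs_fps Rk * Abs_fps g) $ m = conv Rk g m"
      by (simp add: fps_mult_nth conv_def)
    have E1: "tbc_residual f g m = (g m + g') / 2 - (f m + f') / 2 + k * (t * f1 + (1/2 - t) * g1)
        - of_real h * conv Rk g m"
      unfolding tbc_residual_def Let_def fg'[symmetric] of_real f1_def g1_def k_def t_def ..
    have E2: "(A * (w (Suc n) - 2 * w n + w (n - 1)) - fps_const (of_real (h\<^sup>2)) * (r * w n)) $ m
      = of_real h * conv Rk g m + k / 2 * g1 - k * g1 - ((g m + g') / 2 - t * k * g1)
        + ((f m + f') / 2 - t * k * f1)"
      unfolding eq fps_sub_nth fps_add_nth fps_mult_left_const_nth Ag Af rg Rg of_real k_def ..
    have "(A * (w (Suc n) - 2 * w n + w (n - 1)) - fps_const (of_real (h\<^sup>2)) * (r * w n)) $ m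
      = - tbc_residual f g m"
      unfolding E1 E2 by (simp add: algebra_simps)
    with tbc True show ?thesis by (simp only: fps_sub_nth) simp
  qed
qed

text \<open>The choice of \<open>a\<close> gives \<open>c * a = V / 2 + i * hbar / \<tau>\<close>,
  so time difference and potential combine into \<open>- c * (cnj a * w + a * b)\<close>;
  coefficient \<open>m\<close> of the power series identity then is the Numerov equation.\<close>

lemma ext_equation:
  fixes c hbar \<tau> V :: real
  assumes pos: "c > 0" "hbar > 0" "\<tau> > 0"
    and a: "a = of_real (V / (2 * c)) + \<i> * of_real (hbar / (\<tau> * c))"
    and n: "n \<ge> 1" and tbc: "n = 1 \<Longrightarrow> tbc_residual f g m = 0"
  defines "w \<equiv> ext f g m" and "b \<equiv> (\<lambda>n. if m = 0 then 0 else ext f g (m - 1) n)"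
  shows "numerov \<theta> (\<lambda>i. \<i> * of_real hbar * ((w i - b i) / of_real \<tau>) - of_real V * ((w i + b i) / 2)) n
    = - of_real (c / h\<^sup>2) * d2 (\<lambda>i. (w i + b i) / 2) n"
proof -
  define y where "y = (\<lambda>i. cnj a * w i + a * b i)"
  have G: "(\<lambda>i. \<i> * of_real hbar * ((w i - b i) / of_real \<tau>) - of_real V * ((w i + b i) / 2))
    = (\<lambda>i. - of_real c * y i)"
    unfolding y_def a using pos by (simp add: field_simps fun_eq_iff)
  define k where "k = (of_real (h\<^sup>2) :: complex)"
  define t where "t = (of_real \<theta> :: complex)"
  have "d2 (\<lambda>i. (w i + b i) / 2) n = (d2 w n + d2 b n) / 2"
    by (simp add: d2_def field_simps)
  also have "\<dots> = k * numerov \<theta> y n"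
  proof -
    define W where "W = (\<lambda>n. Abs_fps (\<lambda>m. ext f g m n))"
    have W: "(W (Suc n) - 2 * W n + W (n - 1)) $ l = d2 (ext f g l) n" for l
      by (simp add: W_def d2_def numeral_fps_const)
    have b: "(if m = 0 then 0 else d2 (ext f g (m - 1)) n) = d2 b n"
        "(if m = 0 then 0 else W n $ (m - 1)) = b n" "W n $ m = w n"
      by (simp_all add: b_def d2_def W_def w_def)
    have of_real: "of_real (\<theta> * h\<^sup>2) = t * k"
      by (simp add: k_def t_def)
    have num: "numerov \<theta> y n = cnj a * w n + a * b n + t * (cnj a * d2 w n + a * d2 b n)"
      by (simp add: numerov_def y_def d2_def t_def algebra_simps)
    have "(A * (W (Suc n) - 2 * W n + W (n - 1))) $ m = (fps_const (of_real (h\<^sup>2)) * (r * W n)) $ m"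
      unfolding W_def by (rule ext_equation_fps[OF n tbc])
    then have "(d2 w n + d2 b n) / 2 - t * k * (cnj a * d2 w n + a * d2 b n) = k * (cnj a * w n + a * b n)"
      unfolding A_mult_nth fps_mult_left_const_nth r_mult_nth W b of_real
      by (simp add: w_def k_def)
    then show ?thesis unfolding num by (simp add: algebra_simps)
  qed
  finally have "d2 (\<lambda>i. (w i + b i) / 2) n = of_real (h\<^sup>2) * numerov \<theta> y n"
    by (simp add: k_def)
  moreover have "numerov \<theta> (\<lambda>i. - of_real c * y i) n = - of_real c * numerov \<theta> y n"
    by (simp add: numerov_def d2_def algebra_simps)
  ultimately show ?thesis unfolding G using h by simp
qed

end

section \<open>The discrete sine transform\<close>

definition sine_transform :: "nat \<Rightarrow> nat \<Rightarrow> (nat \<Rightarrow> complex) \<Rightarrow> complex" where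
  "sine_transform K q z = of_real (2 / real K) *
     (\<Sum>k=1..K-1. z k * of_real (sin (pi * real q * real k / real K)))"

text \<open>The Dirichlet kernel: each term times \<open>2 * sin (x / 2)\<close> is a difference of
  consecutive sines.\<close>

lemma sum_cos_multiples:
  fixes x :: real
  shows "2 * sin (x / 2) * (\<Sum>k=1..n. cos (real k * x)) = sin ((real n + 1/2) * x) - sin (x / 2)"
proof (induction n)
  case (Suc n)
  have "2 * sin (x / 2) * cos (real (Suc n) * x)
    = sin (x / 2 + real (Suc n) * x) - sin (real (Suc n) * x - x / 2)"
    by (simp only: sin_add sin_diff) (simp add: algebra_simps)
  also have "x / 2 + real (Suc n) * x = (real (Suc n) + 1/2) * x"
    by (simp add: algebra_simps)
  also have "real (Suc n) * x - x / 2 = (real n + 1/2) * x"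
    by (simp add: algebra_simps)
  finally show ?case using Suc by (simp add: distrib_left)
qed simp

text \<open>The bounds on \<open>n\<close> keep \<open>sin (x / 2)\<close> nonzero; the sum then
  depends on the parity of \<open>n\<close> only.\<close>

lemma sum_cos_pi_multiples:
  assumes "0 < n" "n < 2 * K"
  shows "(\<Sum>k=1..K-1. cos (pi * real n * real k / real K)) = - ((-1) ^ n + 1) / 2"
proof -
  have K: "K > 0" using assms by simp
  define x where "x = pi * real n / real K"
  have "0 < x / 2" "x / 2 < pi"
    using assms K by (auto simp: x_def field_simps simp flip: of_nat_mult)
  then have s: "sin (x / 2) > 0" by (rule sin_gt_zero)
  have "(real (K - 1) + 1/2) * x = real n * pi - x / 2"
    using K by (simp add: x_def of_nat_diff field_simps)
  then have "sin ((real (K - 1) + 1/2) * x) = - ((-1) ^ n * sin (x / 2))"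
    by (simp add: sin_diff)
  then have "sin (x / 2) * (2 * (\<Sum>k=1..K-1. cos (real k * x))) = sin (x / 2) * (- ((-1) ^ n + 1))"
    using sum_cos_multiples[of x "K - 1"] by (simp add: algebra_simps)
  then have "2 * (\<Sum>k=1..K-1. cos (real k * x)) = - ((-1) ^ n + 1)"
    using s by simp
  moreover have "real k * x = pi * real n * real k / real K" for k
    by (simp add: x_def)
  ultimately show ?thesis by simp
qed

text \<open>The product is a difference of cosines with frequencies \<open>q - p\<close> and
  \<open>q + p\<close> of equal parity, so the two sums cancel unless \<open>p = q\<close>. The
  order \<open>p \<le> q\<close> makes the subtraction on naturals exact.\<close>

lemma sin_orthogonality_le:
  assumes "1 \<le> p" "p \<le> q" "q \<le> K - 1"
  shows "(\<Sum>k=1..K-1. sin (pi * real q * real k / real K) * sin (pi * real p * real k / real K))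
    = (if p = q then real K / 2 else 0)"
proof -
  have sc: "sin (pi * real q * real k / real K) * sin (pi * real p * real k / real K)
    = (cos (pi * real (q - p) * real k / real K) - cos (pi * real (q + p) * real k / real K)) / 2" for k
  proof -
    have "pi * real q * real k / real K - pi * real p * real k / real K = pi * real (q - p) * real k / real K"
      "pi * real q * real k / real K + pi * real p * real k / real K = pi * real (q + p) * real k / real K"
      using assms by (simp_all add: of_nat_diff algebra_simps add_divide_distrib diff_divide_distrib)
    then show ?thesis by (simp only: sin_times_sin)
  qed
  have "(\<Sum>k=1..K-1. sin (pi * real q * real k / real K) * sin (pi * real p * real k / real K))
    = ((\<Sum>k=1..K-1. cos (pi * real (q - p) * real k / real K))
       - (\<Sum>k=1..K-1. cos (pi * real (q + p) * real k / real K))) / 2"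
    unfolding sc sum_divide_distrib[symmetric] sum_subtractf ..
  also have "(\<Sum>k=1..K-1. cos (pi * real (q + p) * real k / real K)) = - ((-1) ^ (q + p) + 1) / 2"
    using assms by (intro sum_cos_pi_multiples) auto
  also have "(\<Sum>k=1..K-1. cos (pi * real (q - p) * real k / real K))
     = (if p = q then real K - 1 else - ((-1) ^ (q - p) + 1) / 2)"
  proof (cases "p = q")
    case True
    then show ?thesis using assms by (simp add: of_nat_diff)
  next
    case False
    then show ?thesis using assms by (subst sum_cos_pi_multiples) auto
  qed
  also have "((-1)::real) ^ (q - p) = (-1) ^ (q + p)"
    using assms by (simp add: minus_one_power_iff)
  finally show ?thesis using assms by (auto simp: minus_one_power_iff)
qed

lemma sin_orthogonality:
  assumes "p \<in> {1..K-1}" "q \<in> {1..K-1}"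
  shows "(\<Sum>k=1..K-1. sin (pi * real q * real k / real K) * sin (pi * real p * real k / real K))
    = (if p = q then real K / 2 else 0)"
proof (cases "p \<le> q")
  case True
  then show ?thesis using assms by (intro sin_orthogonality_le) auto
next
  case False
  then have "(\<Sum>k=1..K-1. sin (pi * real p * real k / real K) * sin (pi * real q * real k / real K))
    = (if q = p then real K / 2 else 0)"
    using assms by (intro sin_orthogonality_le) auto
  then show ?thesis using False by (auto simp: mult.commute)
qed

lemma sine_transform_synthesis:
  assumes "q \<in> {1..K-1}"
  shows "sine_transform K q (\<lambda>k. \<Sum>p=1..K-1. c p * of_real (sin (pi * real p * real k / real K))) = c q"
proof -
  have K: "K > 0" using assms by auto
  have "(\<Sum>k=1..K-1. (\<Sum>p=1..K-1. c p * of_real (sin (pi * real p * real k / real K)))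
      * of_real (sin (pi * real q * real k / real K)))
    = (\<Sum>p=1..K-1. \<Sum>k=1..K-1. c p * of_real (sin (pi * real q * real k / real K) * sin (pi * real p * real k / real K)))"
    unfolding sum_distrib_right by (subst sum.swap) (simp add: mult_ac)
  also have "\<dots> = (\<Sum>p=1..K-1. c p * of_real (if p = q then real K / 2 else 0))"
    unfolding sum_distrib_left[symmetric] of_real_sum[symmetric]
    using assms by (intro sum.cong refl) (simp only: sin_orthogonality)
  also have "\<dots> = c q * of_real (real K / 2)"
    using assms by (subst sum.remove[of _ q]) (auto intro!: sum.neutral)
  finally have eq: "(\<Sum>k=1..K-1. (\<Sum>p=1..K-1. c p * of_real (sin (pi * real p * real k / real K)))
      * of_real (sin (pi * real q * real k / real K))) = c q * of_real (real K / 2)" .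
  show ?thesis unfolding sine_transform_def eq using K by simp
qed

text \<open>The kernel is symmetric in node and frequency, so inversion is synthesis with the two
  indices exchanged.\<close>

lemma sine_transform_inversion:
  assumes "k \<in> {1..K-1}"
  shows "(\<Sum>q=1..K-1. sine_transform K q z * of_real (sin (pi * real q * real k / real K))) = z k"
proof -
  define t where "t q k = complex_of_real (sin (pi * real q * real k / real K))" for q k
  have t: "t q k = t k q" for q k
    by (simp add: t_def mult_ac)
  have "sine_transform K q z * t q k = of_real (2 / real K) * ((\<Sum>l=1..K-1. z l * t l q) * t k q)" for q
  proof -
    have eq: "(\<Sum>l=1..K-1. z l * t q l) = (\<Sum>l=1..K-1. z l * t l q)"
      by (intro sum.cong refl arg_cong2[of _ _ _ _ "(*)"] t)
    show ?thesis
      by (simp only: sine_transform_def t_def[symmetric] eq) (simp only: t[of q k] mult.assoc)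
  qed
  then have "(\<Sum>q=1..K-1. sine_transform K q z * t q k)
    = (\<Sum>q=1..K-1. of_real (2 / real K) * ((\<Sum>l=1..K-1. z l * t l q) * t k q))"
    by (rule sum.cong[OF refl])
  also have "\<dots> = sine_transform K k (\<lambda>q. \<Sum>l=1..K-1. z l * t l q)"
    unfolding sine_transform_def t_def by (rule sum_distrib_left[symmetric])
  also have "\<dots> = z k"
    unfolding t_def by (rule sine_transform_synthesis[OF assms])
  finally show ?thesis unfolding t_def .
qed

lemma sine_transform_eq_0:
  assumes "\<And>q. q \<in> {1..K-1} \<Longrightarrow> sine_transform K q z = 0" "k \<in> {1..K-1}"
  shows "z k = 0"
  using sine_transform_inversion[OF assms(2), of z] assms(1) by simp

lemma sine_transform_Parseval:
  "(\<Sum>k=1..K-1. (cmod (z k))\<^sup>2) = real K / 2 * (\<Sum>q=1..K-1. (cmod (sine_transform K q z))\<^sup>2)"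
proof (cases "K = 0")
  case False
  have "complex_of_real (\<Sum>k=1..K-1. (cmod (z k))\<^sup>2) = (\<Sum>k=1..K-1. cnj (z k) * z k)"
    unfolding of_real_sum complex_norm_square by (simp only: mult.commute)
  also have "\<dots> = (\<Sum>k=1..K-1. cnj (z k) *
       (\<Sum>q=1..K-1. sine_transform K q z * of_real (sin (pi * real q * real k / real K))))"
    by (intro sum.cong refl) (simp only: sine_transform_inversion)
  also have "\<dots> = (\<Sum>q=1..K-1. sine_transform K q z *
       cnj (\<Sum>k=1..K-1. z k * of_real (sin (pi * real q * real k / real K))))"
    unfolding sum_distrib_left cnj_sum by (subst sum.swap) (simp add: mult_ac)
  also have "\<dots> = (\<Sum>q=1..K-1. of_real (real K / 2) * (sine_transform K q z * cnj (sine_transform K q z)))"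
  proof (intro sum.cong refl)
    fix q
    have "(\<Sum>k=1..K-1. z k * of_real (sin (pi * real q * real k / real K)))
      = of_real (real K / 2) * sine_transform K q z"
      using False by (simp add: sine_transform_def)
    then show "sine_transform K q z * cnj (\<Sum>k=1..K-1. z k * of_real (sin (pi * real q * real k / real K)))
      = of_real (real K / 2) * (sine_transform K q z * cnj (sine_transform K q z))"
      by (simp only: complex_cnj_mult complex_cnj_complex_of_real mult_ac)
  qed
  also have "\<dots> = complex_of_real (real K / 2 * (\<Sum>q=1..K-1. (cmod (sine_transform K q z))\<^sup>2))"
    unfolding sum_distrib_left of_real_sum of_real_mult complex_norm_square ..
  finally show ?thesis by (simp only: of_real_eq_iff)
qed simp

lemma d2_sin:
  assumes "k \<ge> 1"
  shows "d2 (\<lambda>k. of_real (sin (t * real k))) k = - of_real (2 - 2 * cos t) * of_real (sin (t * real k))"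
proof -
  obtain l where k: "k = Suc l" using assms by (cases k) auto
  have "sin (t * real (Suc k)) = sin (t * real k + t)" "sin (t * real l) = sin (t * real k - t)"
    by (simp_all add: k algebra_simps)
  then have "sin (t * real (Suc k)) - 2 * sin (t * real k) + sin (t * real l)
      = - (2 - 2 * cos t) * sin (t * real k)"
    unfolding sin_add sin_diff by (simp only:) (simp add: algebra_simps)
  then have "complex_of_real (sin (t * real (Suc k)) - 2 * sin (t * real k) + sin (t * real l))
     = of_real (- (2 - 2 * cos t) * sin (t * real k))" by (simp only:)
  then show ?thesis by (simp add: d2_def k)
qed

text \<open>Summation by parts moves \<open>d2\<close> onto the sines, which are its eigenfunctions
  and vanish at 0 and \<open>K\<close>.\<close>

lemma sine_transform_d2:
  assumes "z 0 = 0" "z K = 0"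
  shows "sine_transform K q (d2 z) = - of_real (2 - 2 * cos (pi * real q / real K)) * sine_transform K q z"
proof (cases "K = 0")
  case False
  define t where "t = pi * real q / real K"
  define S where "S = (\<lambda>k. complex_of_real (sin (t * real k)))"
  have S: "complex_of_real (sin (pi * real q * real k / real K)) = S k" for k
    by (simp add: S_def t_def mult_ac)
  have "t * real K = real q * pi" using False by (simp add: t_def)
  then have SK: "S 0 = 0" "S K = 0" by (simp_all add: S_def)
  have K: "Suc (K - 1) = K" using False by simp
  have "(\<Sum>k=1..K-1. d2 z k * S k) = (\<Sum>k=1..K-1. z k * d2 S k)"
    unfolding Green_identity K using assms SK by simp
  also have "\<dots> = (\<Sum>k=1..K-1. z k * (- of_real (2 - 2 * cos t) * S k))"
    unfolding S_def by (intro sum.cong refl) (simp only: d2_sin atLeastAtMost_iff)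
  also have "\<dots> = - of_real (2 - 2 * cos t) * (\<Sum>k=1..K-1. z k * S k)"
    unfolding sum_distrib_left by (intro sum.cong refl) (simp only: mult_ac)
  finally show ?thesis unfolding sine_transform_def S t_def[symmetric] by (simp only: mult_ac)
qed (simp add: sine_transform_def)

lemma sine_transform_add: "sine_transform K q (\<lambda>k. u k + v k) = sine_transform K q u + sine_transform K q v"
  unfolding sine_transform_def distrib_right sum.distrib distrib_left ..

lemma sine_transform_diff: "sine_transform K q (\<lambda>k. u k - v k) = sine_transform K q u - sine_transform K q v"
  unfolding sine_transform_def left_diff_distrib sum_subtractf right_diff_distrib ..

lemma sine_transform_cmult: "sine_transform K q (\<lambda>k. c * u k) = c * sine_transform K q u"
  unfolding sine_transform_def mult.assoc sum_distrib_left[symmetric] by (simp only: mult.left_commute)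

lemma sine_transform_divide: "sine_transform K q (\<lambda>k. u k / c) = sine_transform K q u / c"
  using sine_transform_cmult[of K q "1 / c" u] by simp

lemma sine_transform_cong:
  "(\<And>k. k \<in> {1..K-1} \<Longrightarrow> u k = v k) \<Longrightarrow> sine_transform K q u = sine_transform K q v"
  unfolding sine_transform_def by (intro arg_cong2[of _ _ _ _ "(*)"] sum.cong refl) auto

section \<open>Parameters of the modes\<close>

locale splitting_setup = splitting_scheme +
  fixes X0 :: real
  assumes hbar: "hbar > 0" and m0: "m0 > 0" and \<tau>: "\<tau> > 0"
    and Y: "Y > 0" and X0: "X0 > 0" and X: "X > X0"
    and J: "J \<ge> 1" and K: "K \<ge> 1" and hx_le: "hx \<le> X - X0"
    and V_const: "\<And>x y. x \<ge> X0 \<Longrightarrow> 0 < y \<Longrightarrow> y < Y \<Longrightarrow> V x y = Vinf"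
    and Vt_const: "\<And>x. x \<ge> X0 \<Longrightarrow> Vt x = Vinf"
begin

lemma hx_pos: "hx > 0"
  using X X0 J by (simp add: hx_def)

lemma hy_pos: "hy > 0"
  using Y K by (simp add: hy_def)

text \<open>A single cell would have \<open>hx = X > X - X0\<close>. Hence the column
  \<open>J - 1\<close> is an interior one.\<close>

lemma J_ge_2: "J \<ge> 2"
proof (rule ccontr)
  assume "\<not> J \<ge> 2"
  with J have "J = 1" by simp
  then have "hx = X" unfolding hx_def by simp
  with hx_le X0 show False by simp
qed

lemma x_ge_X0:
  assumes "j \<ge> J - 1"
  shows "x j \<ge> X0"
proof -
  have "x j \<ge> x (J - 1)"
    using assms hx_pos by (simp add: x_def mult_right_mono)
  also have "x (J - 1) = real J * hx - hx"
    using J by (simp add: x_def of_nat_diff algebra_simps)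
  also have "real J * hx = X"
    using J by (simp add: hx_def)
  finally show ?thesis using hx_le by simp
qed

text \<open>Makes both potential steps trivial in the two columns on which the boundary condition
  acts.\<close>

lemma V_eq_Vt:
  assumes "j \<ge> J - 1" "k \<in> {1..K-1}"
  shows "V (x j) (y k) = Vt (x j)"
proof -
  have "0 < y k" using assms hy_pos by (simp add: y_def)
  moreover have "y k < Y"
  proof -
    have "real k < real K" using assms(2) by auto
    then have "real k * hy < real K * hy" using hy_pos by simp
    then show ?thesis using K by (simp add: y_def hy_def)
  qed
  ultimately show ?thesis
    using V_const Vt_const x_ge_X0[OF assms(1)] by simp
qed

lemma c_hbar_pos: "c_hbar > 0"
  using hbar m0 by (simp add: c_hbar_def)

lemma lam_eq: "hy\<^sup>2 * lam q = 2 - 2 * cos (pi * real q / real K)"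
proof -
  have "pi * real q * hy / (2 * Y) = (pi * real q / real K) / 2"
    using Y K by (simp add: hy_def field_simps)
  then have "hy\<^sup>2 * lam q = (2 * sin ((pi * real q / real K) / 2))\<^sup>2"
    using hy_pos by (simp add: lam_def power_mult_distrib power_divide)
  also have "\<dots> = 2 - 2 * cos (2 * ((pi * real q / real K) / 2))"
    unfolding cos_double_sin by (simp add: power_mult_distrib)
  finally show ?thesis by simp
qed

lemma sig_bounds:
  assumes "q \<in> {1..K-1}"
  shows "2/3 < sig q" "sig q \<le> 1"
proof -
  define t where "t = pi * real q / real K"
  have "t < pi" "0 < t"
    using assms by (auto simp: t_def field_simps)
  then have "cos pi < cos t"
    by (intro cos_monotone_0_pi) auto
  then have "-1 < cos t" by simp
  moreover have "sig q = 1 - (2 - 2 * cos t) / 12"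
    unfolding sig_def t_def lam_eq[symmetric] by simp
  moreover have "cos t \<le> 1" by (rule cos_le_one)
  ultimately have "2/3 < sig q \<and> sig q \<le> 1"
    by argo
  then show "2/3 < sig q" "sig q \<le> 1" by auto
qed

text \<open>The product \<open>sig q * (1 - 4 * theta q)\<close> equals
  \<open>sig q - 1/3 > 1/3\<close>, the origin of the factor 3 in \<open>stability\<close>.\<close>

lemma theta_bounds:
  assumes "q \<in> {1..K-1}"
  shows "0 < theta q" "theta q < 1/4" "1 / (sig q * (1 - 4 * theta q)) \<le> 3"
proof -
  have s: "2/3 < sig q" using sig_bounds[OF assms] by simp
  then show "0 < theta q" "theta q < 1/4"
    by (simp_all add: theta_def field_simps)
  have "sig q * (1 - 4 * theta q) = sig q - 1/3"
    using s by (simp add: theta_def field_simps)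
  then show "1 / (sig q * (1 - 4 * theta q)) \<le> 3"
    using s by (simp add: divide_simps)
qed

lemma c_hbar_q_pos: "c_hbar_q q > 0"
  using c_hbar_pos by (simp add: c_hbar_q_def add_pos_nonneg)

text \<open>The square root of \<open>alpha q\<close> with argument in \<open>(0, pi)\<close>;
  \<open>c1 q\<close> is minus half its conjugate.\<close>

definition root_alpha :: "nat \<Rightarrow> complex" where
  "root_alpha q = of_real (sqrt (cmod (alpha q))) * exp (\<i> * of_real (arg_alpha q / 2))"

text \<open>Four times the squared generating function of the kernel is
  \<open>cnj alpha + 2 * beta * fps_X + alpha * fps_X^2\<close>, and this polynomial factors as
  \<open>r * (2 * (1 + fps_X) + g * r)\<close>.\<close>

lemma exterior_params:
  assumes q: "q \<in> {1..K-1}"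
  shows "exterior (a q) (root_alpha q)
    hx (theta q) (R q)"
proof
  define g where "g = (1 - 4 * theta q) * hx\<^sup>2"
  have g: "g > 0" using theta_bounds[OF q] hx_pos by (simp add: g_def)
  show Im_a: "Im (a q) > 0"
    using hbar \<tau> c_hbar_q_pos[of q] by (simp add: a_def)
  show "hx > 0" by (rule hx_pos)
  show "0 < theta q" "theta q < 1/4" using theta_bounds[OF q] by auto
  have alpha: "alpha q = 2 * a q + of_real g * (a q)\<^sup>2"
    by (simp add: alpha_def g_def)
  \<comment> \<open>A real \<open>alpha q\<close> forces \<open>g * Re (a q) = -1\<close>, and then
    \<open>alpha q = Re (a q) - g * (Im (a q))^2\<close> is negative. So the argument is not 0 and
    the half angle has positive sine.\<close>
  have not_pos: "\<not> (Im (alpha q) = 0 \<and> Re (alpha q) \<ge> 0)"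
  proof
    assume A: "Im (alpha q) = 0 \<and> Re (alpha q) \<ge> 0"
    have "2 * Im (a q) * (1 + g * Re (a q)) = 0"
      using A by (simp add: alpha power2_eq_square algebra_simps)
    with Im_a have "g * Re (a q) = -1" by simp
    have "Re (alpha q) = 2 * Re (a q) + (g * Re (a q)) * Re (a q) - g * (Im (a q))\<^sup>2"
      by (simp add: alpha power2_eq_square algebra_simps)
    then have "Re (alpha q) = Re (a q) - g * (Im (a q))\<^sup>2"
      unfolding \<open>g * Re (a q) = -1\<close> by simp
    moreover have "Re (a q) < 0"
      using \<open>g * Re (a q) = -1\<close> g by (smt (verit) mult_nonneg_nonneg)
    moreover have "g * (Im (a q))\<^sup>2 > 0" using g Im_a by simp
    ultimately show False using A by linarith
  qed
  have alpha_nz: "alpha q \<noteq> 0" using not_pos by auto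
  have "arg_alpha q \<noteq> 0"
    using not_pos unfolding arg_alpha_def Arg2pi_eq_0 complex_is_Real_iff by blast
  then have "0 < arg_alpha q / 2" "arg_alpha q / 2 < pi"
    using Arg2pi_ge_0[of "alpha q"] Arg2pi_lt_2pi[of "alpha q"] by (auto simp: arg_alpha_def)
  then have "sin (arg_alpha q / 2) > 0" by (rule sin_gt_zero)
  moreover have "Im (root_alpha q) = sqrt (cmod (alpha q)) * sin (arg_alpha q / 2)"
    unfolding root_alpha_def by (simp add: Im_exp)
  ultimately show "Im (root_alpha q) > 0"
    using alpha_nz by simp
  have polar: "alpha q = of_real (cmod (alpha q)) * exp (\<i> * of_real (arg_alpha q))"
    unfolding arg_alpha_def by (rule Arg2pi_eq)
  have s_sq: "(root_alpha q)\<^sup>2 = alpha q"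
  proof -
    have "(root_alpha q)\<^sup>2 = of_real ((sqrt (cmod (alpha q)))\<^sup>2) * (exp (\<i> * of_real (arg_alpha q / 2)))\<^sup>2"
      unfolding root_alpha_def power_mult_distrib of_real_power ..
    also have "(sqrt (cmod (alpha q)))\<^sup>2 = cmod (alpha q)" by simp
    also have "(exp (\<i> * of_real (arg_alpha q / 2)))\<^sup>2 = exp (\<i> * of_real (arg_alpha q))"
      unfolding exp_double[symmetric] by simp
    finally show ?thesis using polar by simp
  qed
  then show "(root_alpha q)\<^sup>2
      = 2 * a q + of_real ((1 - 4 * theta q) * hx\<^sup>2) * (a q)\<^sup>2"
    using alpha by (simp add: g_def)
  have c1: "c1 q = - cnj (root_alpha q) / 2"
    by (simp add: c1_def root_alpha_def exp_cnj)
  show "R q 0 = - cnj (root_alpha q) / 2"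
    using c1 by (simp add: R_def)
  have c1_sq: "4 * (c1 q)\<^sup>2 = cnj (alpha q)"
  proof -
    have "4 * (c1 q)\<^sup>2 = cnj ((root_alpha q)\<^sup>2)" unfolding c1 by (simp add: power2_eq_square)
    then show ?thesis using s_sq by simp
  qed
  have kap: "of_real (cmod (alpha q)) * kap q = - alpha q"
    using polar by (simp add: kap_def)
  have aa: "cnj (alpha q) * alpha q = of_real (cmod (alpha q)) * of_real (cmod (alpha q))"
    using complex_norm_square[of "alpha q"] by (simp add: power2_eq_square mult.commute)
  \<comment> \<open>\<open>kap q\<close> is \<open>- alpha q\<close> divided by its modulus and
    \<open>mu q\<close> has the same denominator; multiplying by the squared modulus clears
    both.\<close>
  have k1: "cnj (alpha q) * (2 * kap q * of_real (mu q)) = - 2 * of_real (beta q)"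
  proof -
    have nz: "complex_of_real (cmod (alpha q)) * of_real (cmod (alpha q)) \<noteq> 0" using alpha_nz by simp
    have "of_real (cmod (alpha q)) * of_real (cmod (alpha q)) * (cnj (alpha q) * (2 * kap q * of_real (mu q)))
      = 2 * (cnj (alpha q) * (of_real (cmod (alpha q)) * kap q) * (of_real (cmod (alpha q)) * of_real (mu q)))"
      by (simp only: mult_ac)
    also have "complex_of_real (cmod (alpha q)) * of_real (mu q) = of_real (beta q)"
      using alpha_nz by (simp add: mu_def)
    also have "2 * (cnj (alpha q) * (of_real (cmod (alpha q)) * kap q) * of_real (beta q))
      = of_real (cmod (alpha q)) * of_real (cmod (alpha q)) * (- 2 * of_real (beta q))"
      unfolding kap aa[symmetric] by simp
    finally show ?thesis by (rule mult_left_cancel[OF nz, THEN iffD1])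
  qed
  have k2: "cnj (alpha q) * (kap q)\<^sup>2 = alpha q"
  proof -
    have nz: "complex_of_real (cmod (alpha q)) * of_real (cmod (alpha q)) \<noteq> 0" using alpha_nz by simp
    have "of_real (cmod (alpha q)) * of_real (cmod (alpha q)) * (cnj (alpha q) * (kap q)\<^sup>2)
      = cnj (alpha q) * (of_real (cmod (alpha q)) * kap q)\<^sup>2"
      by (simp only: power2_eq_square mult_ac)
    also have "\<dots> = of_real (cmod (alpha q)) * of_real (cmod (alpha q)) * alpha q"
      unfolding kap aa[symmetric] by (simp add: power2_eq_square)
    finally show ?thesis by (rule mult_left_cancel[OF nz, THEN iffD1])
  qed
  have beta: "complex_of_real (2 * beta q) = 2 * (a q + cnj (a q)) + 2 * of_real g * (a q * cnj (a q))"
    unfolding complex_add_cnj complex_norm_square[symmetric] beta_def g_def by simp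
  have "4 * (Abs_fps (R q))\<^sup>2 = fps_const (4 * (c1 q)\<^sup>2)
     * (1 - fps_const (2 * kap q * of_real (mu q)) * fps_X + fps_const ((kap q)\<^sup>2) * fps_X\<^sup>2)"
    unfolding R_def kernel_rec_square by (simp add: numeral_fps_const)
  also have "\<dots> = fps_const (cnj (alpha q)) + fps_const (of_real (2 * beta q)) * fps_X + fps_const (alpha q) * fps_X\<^sup>2"
  proof -
    have "fps_const (cnj (alpha q)) * (1 - fps_const (2 * kap q * of_real (mu q)) * fps_X + fps_const ((kap q)\<^sup>2) * fps_X\<^sup>2)
      = fps_const (cnj (alpha q)) - fps_const (cnj (alpha q) * (2 * kap q * of_real (mu q))) * fps_X
        + fps_const (cnj (alpha q) * (kap q)\<^sup>2) * fps_X\<^sup>2"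
      unfolding fps_const_mult[symmetric] by (simp only: ring_distribs mult_1_right mult.assoc)
    then show ?thesis unfolding c1_sq k1 k2 by (simp flip: fps_const_neg)
  qed
  also have "\<dots> = (fps_const (cnj (a q)) + fps_const (a q) * fps_X) * (2 * (1 + fps_X)
      + fps_const (of_real g) * (fps_const (cnj (a q)) + fps_const (a q) * fps_X))"
    unfolding beta alpha
    by (simp add: power2_eq_square numeral_fps_const algebra_simps flip: fps_const_add fps_const_mult)
  finally show "4 * (Abs_fps (R q))\<^sup>2 = (fps_const (cnj (a q)) + fps_const (a q) * fps_X) * (2 * (1 + fps_X)
      + fps_const (of_real ((1 - 4 * theta q) * hx\<^sup>2)) * (fps_const (cnj (a q)) + fps_const (a q) * fps_X))"
    unfolding g_def .
qed

section \<open>The scheme for a single mode\<close>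

text \<open>The eigenvalue of the second difference in \<open>y\<close> acts as an additional
  potential; the division by \<open>sig q\<close> comes from normalising the average of the
  mode.\<close>

definition vq :: "nat \<Rightarrow> nat \<Rightarrow> real" where
  "vq q i = Vt (x i) + c_hbar * (lam q / sig q)"

lemma vq_exterior: "i \<ge> J - 1 \<Longrightarrow> vq q i = Vinf_q q"
  by (simp add: vq_def Vinf_q_def Vt_const x_ge_X0)

lemma dst_eq: "dst q Z j = sine_transform K q (Z j)"
  by (simp add: dst_def sine_transform_def)

lemma dst_diff: "dst q (\<lambda>j k. Z j k - W j k) j = dst q Z j - dst q W j"
  by (simp add: dst_eq sine_transform_diff)

lemma dst_add: "dst q (\<lambda>j k. Z j k + W j k) j = dst q Z j + dst q W j"
  by (simp add: dst_eq sine_transform_add)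

lemma dst_cmult: "dst q (\<lambda>j k. c j * Z j k) j = c j * dst q Z j"
  by (simp add: dst_eq sine_transform_cmult)

lemma dst_divide: "dst q (\<lambda>j k. Z j k / c) j = dst q Z j / c"
  by (simp add: dst_eq sine_transform_divide)

lemma dxx_eq: "dxx W j k = d2 (\<lambda>i. W i k) j / of_real (hx\<^sup>2)"
  using hx_pos by (simp add: dxx_def fdiff_def bdiff_def d2_def field_simps power2_eq_square)

lemma dyy_eq: "dyy W j k = d2 (W j) k / of_real (hy\<^sup>2)"
  using hy_pos by (simp add: dyy_def fdiff_def bdiff_def d2_def field_simps power2_eq_square)

lemma dst_dxx: "dst q (dxx W) j = d2 (dst q W) j / of_real (hx\<^sup>2)"
proof -
  have "dxx W j = (\<lambda>k. ((W (Suc j) k - 2 * W j k) + W (j - 1) k) / of_real (hx\<^sup>2))"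
    by (simp add: fun_eq_iff dxx_eq d2_def)
  then show ?thesis
    by (simp only: dst_eq sine_transform_divide sine_transform_add sine_transform_diff sine_transform_cmult d2_def)
qed

lemma dst_dyy:
  assumes "W j 0 = 0" "W j K = 0"
  shows "dst q (dyy W) j = - of_real (lam q) * dst q W j"
proof -
  have "dyy W j = (\<lambda>k. d2 (W j) k / of_real (hy\<^sup>2))"
    by (simp add: fun_eq_iff dyy_eq)
  then have "dst q (dyy W) j = - of_real (2 - 2 * cos (pi * real q / real K)) * dst q W j / of_real (hy\<^sup>2)"
    by (simp only: dst_eq sine_transform_divide sine_transform_d2[OF assms])
  also have "complex_of_real (2 - 2 * cos (pi * real q / real K)) = of_real (hy\<^sup>2) * of_real (lam q)"
    by (simp only: lam_eq[symmetric] of_real_mult)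
  finally show ?thesis using hy_pos by simp
qed

text \<open>The \<open>y\<close> part lowers the coefficient of the identity from 1 to
  \<open>sig q\<close>; taking this factor out turns the weight 1/12 of the \<open>x\<close> part
  into \<open>theta q\<close>.\<close>

lemma dst_s_N:
  assumes "W j 0 = 0" "W j K = 0" "q \<in> {1..K-1}"
  shows "dst q (s_N W) j = of_real (sig q) * numerov (theta q) (dst q W) j"
proof -
  have s: "sig q \<noteq> 0" using sig_bounds[OF assms(3)] by auto
  have "s_N W j = (\<lambda>k. W j k + of_real (hx\<^sup>2 / 12) * dxx W j k + of_real (hy\<^sup>2 / 12) * dyy W j k)"
    by (simp add: fun_eq_iff s_N_def)
  then have "dst q (s_N W) j = dst q W j + of_real (hx\<^sup>2 / 12) * dst q (dxx W) j + of_real (hy\<^sup>2 / 12) * dst q (dyy W) j"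
    by (simp only: dst_eq sine_transform_add sine_transform_cmult)
  also have "\<dots> = dst q W j + d2 (dst q W) j / 12 - of_real (hy\<^sup>2 / 12 * lam q) * dst q W j"
    unfolding dst_dxx dst_dyy[where W = W, OF assms(1,2)] using hx_pos by simp
  also have "complex_of_real (hy\<^sup>2 / 12 * lam q) = of_real (1 - sig q)"
    by (simp add: sig_def)
  also have "dst q W j + d2 (dst q W) j / 12 - of_real (1 - sig q) * dst q W j
     = of_real (sig q) * dst q W j + of_real (sig q * theta q) * d2 (dst q W) j"
    using s by (simp add: theta_def algebra_simps)
  finally show ?thesis
    by (simp add: numerov_def algebra_simps)
qed

lemma dst_Delta:
  assumes "\<And>i. i \<in> {j - 1, j, Suc j} \<Longrightarrow> W i 0 = 0 \<and> W i K = 0"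
  shows "dst q (Delta_hN W) j = of_real (sig q / hx\<^sup>2) * d2 (dst q W) j
    - of_real (lam q) * (dst q W j + d2 (dst q W) j / 12)"
proof -
  have "Delta_hN W j = (\<lambda>k. (dxx W j k + of_real (hy\<^sup>2 / 12) * dyy (dxx W) j k)
     + (dyy W j k + of_real (hx\<^sup>2 / 12) * dxx (dyy W) j k))"
    by (simp add: fun_eq_iff Delta_hN_def s_Nx_def s_Ny_def)
  then have "dst q (Delta_hN W) j = (dst q (dxx W) j + of_real (hy\<^sup>2 / 12) * dst q (dyy (dxx W)) j)
     + (dst q (dyy W) j + of_real (hx\<^sup>2 / 12) * dst q (dxx (dyy W)) j)"
    by (simp only: dst_eq sine_transform_add sine_transform_cmult)
  also have "dst q (dyy (dxx W)) j = - of_real (lam q) * dst q (dxx W) j"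
    by (rule dst_dyy) (simp_all add: dxx_eq d2_def assms)
  also have "dst q (dxx (dyy W)) j = - of_real (lam q) * d2 (dst q W) j / of_real (hx\<^sup>2)"
    unfolding dst_dxx by (simp add: d2_def dst_dyy assms algebra_simps)
  also have "dst q (dyy W) j = - of_real (lam q) * dst q W j"
    by (rule dst_dyy) (simp_all add: assms)
  also have "dst q (dxx W) j + of_real (hy\<^sup>2 / 12) * (- of_real (lam q) * dst q (dxx W) j)
     = of_real (sig q) * dst q (dxx W) j"
    by (simp add: sig_def algebra_simps)
  also have "of_real (hx\<^sup>2 / 12) * (- of_real (lam q) * d2 (dst q W) j / of_real (hx\<^sup>2)) = - of_real (lam q) * d2 (dst q W) j / 12"
    using hx_pos by simp
  finally show ?thesis
    unfolding dst_dxx by (simp add: algebra_simps)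
qed

text \<open>The reason for the modified coefficient: \<open>Delta_hN\<close> couples
  \<open>lam q\<close> to \<open>d2\<close> with weight 1/12, whereas the additional potential
  inside \<open>numerov\<close> carries the weight \<open>theta q\<close>. The mismatch is absorbed
  into the coefficient of \<open>d2\<close>.\<close>

lemma c_hbar_q_eq:
  assumes "q \<in> {1..K-1}"
  shows "sig q * (c_hbar_q q / hx\<^sup>2) = c_hbar * sig q / hx\<^sup>2 + c_hbar * lam q * (theta q - 1/12)"
proof -
  have s: "sig q \<noteq> 0" using sig_bounds[OF assms] by auto
  have "sig q * (c_hbar_q q / hx\<^sup>2) = c_hbar * sig q / hx\<^sup>2 + c_hbar * lam q * (hy\<^sup>2 / 12 * lam q) / (12 * sig q)"
    using s hx_pos by (simp add: c_hbar_q_def field_simps power2_eq_square)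
  also have "hy\<^sup>2 / 12 * lam q = 1 - sig q"
    by (simp add: sig_def)
  finally show ?thesis using s by (simp add: theta_def field_simps)
qed

definition main_residual :: "mesh_fun \<Rightarrow> mesh_fun \<Rightarrow> mesh_fun \<Rightarrow> mesh_fun" where
  "main_residual t b G j k = \<i> * of_real hbar * s_N (\<lambda>j k. (t j k - b j k) / of_real \<tau>) j k
     - (- of_real c_hbar * Delta_hN (\<lambda>j k. (t j k + b j k) / 2) j k
            + s_N (\<lambda>j k. of_real (Vt (x j)) * ((t j k + b j k) / 2)) j k
            + G j k)"

definition mode_residual :: "nat \<Rightarrow> (nat \<Rightarrow> complex) \<Rightarrow> (nat \<Rightarrow> complex) \<Rightarrow> nat \<Rightarrow> complex" where
  "mode_residual q w b j =
     numerov (theta q) (\<lambda>i. \<i> * of_real hbar * ((w i - b i) / of_real \<tau>) - of_real (vq q i) * ((w i + b i) / 2)) j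
     + of_real (c_hbar_q q / hx\<^sup>2) * d2 (\<lambda>i. (w i + b i) / 2) j"

lemma mode_residual_cong:
  assumes "\<And>i. i \<in> {j - 1, j, Suc j} \<Longrightarrow> w i = w' i \<and> b i = b' i"
  shows "mode_residual q w b j = mode_residual q w' b' j"
  using assms unfolding mode_residual_def
  by (intro arg_cong2[of _ _ _ _ "(+)"] arg_cong2[of _ _ _ _ "(*)"] refl numerov_cong d2_cong) auto

lemma dst_main_residual:
  assumes z: "\<And>i. i \<in> {j - 1, j, Suc j} \<Longrightarrow> t i 0 = 0 \<and> t i K = 0 \<and> b i 0 = 0 \<and> b i K = 0"
    and q: "q \<in> {1..K-1}"
  shows "dst q (main_residual t b G) j
    = of_real (sig q) * mode_residual q (dst q t) (dst q b) j - dst q G j"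
proof -
  define D where "D = (\<lambda>i. (dst q t i - dst q b i) / of_real \<tau>)"
  define W where "W = (\<lambda>i. (dst q t i + dst q b i) / 2)"
  define P where "P = (\<lambda>i. of_real (Vt (x i)) * W i)"
  have s: "sig q \<noteq> 0" using sig_bounds[OF q] by auto
  have D: "dst q (\<lambda>j k. (t j k - b j k) / of_real \<tau>) = D"
    by (rule ext) (simp only: D_def dst_divide dst_diff)
  have W: "dst q (\<lambda>j k. (t j k + b j k) / 2) = W"
    by (rule ext) (simp only: W_def dst_divide dst_add)
  have P: "dst q (\<lambda>j k. of_real (Vt (x j)) * ((t j k + b j k) / 2)) = P"
    by (rule ext) (simp only: dst_cmult W P_def)
  have "main_residual t b G j = (\<lambda>k. \<i> * of_real hbar * s_N (\<lambda>j k. (t j k - b j k) / of_real \<tau>) j k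
     - (- of_real c_hbar * Delta_hN (\<lambda>j k. (t j k + b j k) / 2) j k
            + s_N (\<lambda>j k. of_real (Vt (x j)) * ((t j k + b j k) / 2)) j k
            + G j k))"
    by (simp add: fun_eq_iff main_residual_def)
  then have "dst q (main_residual t b G) j
    = \<i> * of_real hbar * dst q (s_N (\<lambda>j k. (t j k - b j k) / of_real \<tau>)) j
     - (- of_real c_hbar * dst q (Delta_hN (\<lambda>j k. (t j k + b j k) / 2)) j
            + dst q (s_N (\<lambda>j k. of_real (Vt (x j)) * ((t j k + b j k) / 2))) j
            + dst q G j)"
    by (simp only: dst_eq sine_transform_add sine_transform_diff sine_transform_cmult)
  also have "dst q (s_N (\<lambda>j k. (t j k - b j k) / of_real \<tau>)) j = of_real (sig q) * numerov (theta q) D j"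
    using z q by (subst dst_s_N) (simp_all add: D)
  also have "dst q (s_N (\<lambda>j k. of_real (Vt (x j)) * ((t j k + b j k) / 2))) j = of_real (sig q) * numerov (theta q) P j"
    unfolding P[symmetric] by (rule dst_s_N) (use z q in auto)
  also have "dst q (Delta_hN (\<lambda>j k. (t j k + b j k) / 2)) j = of_real (sig q / hx\<^sup>2) * d2 W j
     - of_real (lam q) * (W j + d2 W j / 12)"
    using z by (subst dst_Delta) (simp_all add: W)
  finally have lhs: "dst q (main_residual t b G) j
    = \<i> * of_real hbar * (of_real (sig q) * numerov (theta q) D j)
     - (- of_real c_hbar * (of_real (sig q / hx\<^sup>2) * d2 W j - of_real (lam q) * (W j + d2 W j / 12))
            + of_real (sig q) * numerov (theta q) P j + dst q G j)" .
  have v: "of_real (vq q i) * W i = P i + of_real (c_hbar * lam q / sig q) * W i" for i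
    by (simp add: P_def vq_def algebra_simps)
  have "numerov (theta q) (\<lambda>i. \<i> * of_real hbar * D i - of_real (vq q i) * W i) j
    = \<i> * of_real hbar * numerov (theta q) D j - numerov (theta q) P j
      - of_real (c_hbar * lam q / sig q) * numerov (theta q) W j"
    unfolding v numerov_def d2_def by (simp only: ring_distribs) (simp only: mult_ac add_ac diff_conv_add_uminus minus_add_distrib minus_minus mult_minus_left mult_minus_right)
  then have "of_real (sig q) * mode_residual q (dst q t) (dst q b) j
    = of_real (sig q) * (\<i> * of_real hbar * numerov (theta q) D j) - of_real (sig q) * numerov (theta q) P j
      - of_real (sig q) * of_real (c_hbar * lam q / sig q) * numerov (theta q) W j
      + of_real (sig q) * of_real (c_hbar_q q / hx\<^sup>2) * d2 W j"
    unfolding mode_residual_def D_def W_def by (simp only: ring_distribs mult.assoc)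
  also have "complex_of_real (sig q) * of_real (c_hbar * lam q / sig q) = of_real (c_hbar * lam q)"
    using s by simp
  also have "complex_of_real (sig q) * of_real (c_hbar_q q / hx\<^sup>2)
     = of_real (c_hbar * sig q / hx\<^sup>2) + of_real (c_hbar * lam q) * of_real (theta q) - of_real (c_hbar * lam q) / 12"
  proof -
    have "complex_of_real (sig q) * of_real (c_hbar_q q / hx\<^sup>2) = of_real (sig q * (c_hbar_q q / hx\<^sup>2))"
      by (simp only: of_real_mult)
    then show ?thesis unfolding c_hbar_q_eq[OF q] by (simp add: algebra_simps)
  qed
  finally show ?thesis
    unfolding lhs numerov_def[of _ W] by (simp add: algebra_simps)
qed

section \<open>A mode together with its exterior extension\<close>

definition ext_q where "ext_q q = exterior.ext (a q) hx (theta q) (R q)"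
definition tbc_residual_q where "tbc_residual_q q = exterior.tbc_residual (a q) hx (theta q) (R q)"

lemma ext_q_0: "q \<in> {1..K-1} \<Longrightarrow> ext_q q f g m 0 = f m"
  unfolding ext_q_def by (simp add: exterior.ext_def[OF exterior_params])

lemma ext_q_1: "q \<in> {1..K-1} \<Longrightarrow> ext_q q f g m (Suc 0) = g m"
  unfolding ext_q_def by (rule exterior.ext_1[OF exterior_params])

lemma ext_q_tendsto_0: "q \<in> {1..K-1} \<Longrightarrow> (\<lambda>n. ext_q q f g m n) \<longlonglongrightarrow> 0"
  unfolding ext_q_def by (rule exterior.ext_tendsto_0[OF exterior_params])

lemma ext_q_0_level: "q \<in> {1..K-1} \<Longrightarrow> f 0 = 0 \<Longrightarrow> g 0 = 0 \<Longrightarrow> ext_q q f g 0 n = 0"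
  unfolding ext_q_def
  by (cases "n = 0") (auto simp: exterior.ext_0_level[OF exterior_params] exterior.ext_def[OF exterior_params])

lemma tbc_residual_q_eq:
  assumes "q \<in> {1..K-1}"
  shows "tbc_residual_q q f g m = (let f' = if m = 0 then 0 else f (m - 1); g' = if m = 0 then 0 else g (m - 1) in
     ((g m + g') / 2 - (f m + f') / 2) + of_real (hx\<^sup>2)
       * (of_real (theta q) * (cnj (a q) * f m + a q * f') + of_real (1/2 - theta q) * (cnj (a q) * g m + a q * g'))
     - of_real hx * conv (R q) g m)"
  unfolding tbc_residual_q_def exterior.tbc_residual_def[OF exterior_params[OF assms]] ..

lemma ext_q_equation:
  assumes q: "q \<in> {1..K-1}" and n: "n \<ge> 1" and tbc: "n = 1 \<Longrightarrow> tbc_residual_q q f g m = 0"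
  defines "w \<equiv> ext_q q f g m" and "b \<equiv> (\<lambda>n. if m = 0 then 0 else ext_q q f g (m - 1) n)"
  shows "numerov (theta q) (\<lambda>i. \<i> * of_real hbar * ((w i - b i) / of_real \<tau>) - of_real (Vinf_q q) * ((w i + b i) / 2)) n
    = - of_real (c_hbar_q q / hx\<^sup>2) * d2 (\<lambda>i. (w i + b i) / 2) n"
  unfolding w_def b_def ext_q_def
  using tbc by (intro exterior.ext_equation[OF exterior_params[OF q] c_hbar_q_pos hbar \<tau> a_def n])
    (simp add: tbc_residual_q_def)

text \<open>Exterior index 0 is the column \<open>J - 1\<close> and index 1 the column
  \<open>J\<close>, so the stencil centred at \<open>J\<close> lies wholly in the exterior
  part.\<close>

definition glue where
  "glue q u f g m i = (if i < J - 1 then u i else ext_q q f g m (i - (J - 1)))"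

lemma glue_inner:
  assumes "q \<in> {1..K-1}" "u (J - 1) = f m" "u J = g m" "i \<le> J"
  shows "glue q u f g m i = u i"
proof -
  consider "i < J - 1" | "i = J - 1" | "i = J" using assms(4) by linarith
  then show ?thesis
  proof cases
    case 3
    have "\<not> J < J - 1" "J - (J - 1) = Suc 0" using J by auto
    then show ?thesis using assms 3 by (simp add: glue_def ext_q_1)
  qed (use assms in \<open>simp_all add: glue_def ext_q_0\<close>)
qed

lemma glue_tendsto_0:
  assumes "q \<in> {1..K-1}"
  shows "glue q u f g m \<longlonglongrightarrow> 0"
proof -
  have "(\<lambda>i. glue q u f g m (i + (J - 1))) \<longlonglongrightarrow> 0"
    using ext_q_tendsto_0[OF assms] by (simp add: glue_def)
  then show ?thesis by (rule LIMSEQ_offset)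
qed

text \<open>The glued functions satisfy one Numerov equation at all nodes \<open>j \<ge> 1\<close>,
  with the source cut off after \<open>J - 1\<close>. \<open>\<eta>\<close> collects the boundary
  terms at \<open>N + 1\<close>, which vanish in the limit because the glued functions do. The case
  \<open>m = 0\<close> covers a step from a zero old value.\<close>

lemma mode_energy:
  fixes u b F f g
  assumes q: "q \<in> {1..K-1}"
    and z: "u 0 = 0" "b 0 = 0"
    and u: "u (J - 1) = f m" "u J = g m"
    and b: "b (J - 1) = (if m = 0 then 0 else f (m - 1))" "b J = (if m = 0 then 0 else g (m - 1))"
    and eq: "\<And>j. j \<in> {1..J-1} \<Longrightarrow> mode_residual q u b j = F j"
    and tbc: "tbc_residual_q q f g m = 0"
    and b': "m > 0 \<Longrightarrow> b' = glue q b f g (m - 1)" "m = 0 \<Longrightarrow> b = (\<lambda>_. 0) \<and> b' = (\<lambda>_. 0)"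
  defines "w \<equiv> glue q u f g m"
  shows "\<exists>\<eta>. \<eta> \<longlonglongrightarrow> 0 \<and> (\<forall>N. 0 \<le> \<eta> N) \<and> (\<forall>N\<ge>J.
    hbar / (2 * \<tau>) * ((\<Sum>j=1..N. (cmod (w j))\<^sup>2) - (\<Sum>j=1..N. (cmod (b' j))\<^sup>2))
    \<le> (L2_set (\<lambda>j. cmod (F j)) {1..J-1} / (1 - 4 * theta q) + \<eta> N)
        * L2_set (\<lambda>j. cmod ((w j + b' j) / 2)) {1..N})"
proof -
  define c where "c = c_hbar_q q / hx\<^sup>2"
  define W where "W = (\<lambda>i. (w i + b' i) / 2)"
  define G where "G = (\<lambda>i. \<i> * of_real hbar * ((w i - b' i) / of_real \<tau>) - of_real (vq q i) * W i)"
  define \<eta> where "\<eta> N = (c * cmod (W (Suc N)) + theta q * cmod (G (Suc N))) / (1 - 4 * theta q)" for N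
  define \<phi> where "\<phi> j = (if j \<le> J - 1 then F j else 0)" for j
  note \<theta> = theta_bounds[OF q]
  have c: "c > 0" using c_hbar_q_pos[of q] hx_pos by (simp add: c_def)
  have w_in: "w i = u i" if "i \<le> J" for i
    unfolding w_def using q u that by (intro glue_inner)
  have b_in: "b' i = b i" if "i \<le> J" for i
    using q b that b' by (cases "m = 0") (auto intro: glue_inner)
  have w_ex: "w (i + (J - 1)) = ext_q q f g m i" for i
    by (simp add: w_def glue_def)
  have b_ex: "b' (i + (J - 1)) = (if m = 0 then 0 else ext_q q f g (m - 1) i)" for i
    using b' by (simp add: glue_def)
  have full: "numerov (theta q) G j = - of_real c * d2 W j + \<phi> j" if "1 \<le> j" for j
  proof (cases "j \<le> J - 1")
    case True
    then have "mode_residual q w b' j = F j"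
      using eq[of j] that J w_in b_in by (subst mode_residual_cong[of j w u b' b]) auto
    then show ?thesis
      using True by (simp add: mode_residual_def G_def W_def \<phi>_def c_def algebra_simps)
  next
    case False
    \<comment> \<open>\<open>n = 1\<close> is the column \<open>J\<close>; only there is the
      boundary condition consumed.\<close>
    define n where "n = j - (J - 1)"
    have n: "n \<ge> 1" "j = n + (J - 1)" using False by (auto simp: n_def)
    have "numerov (theta q) G j = numerov (theta q) (\<lambda>i. G (i + (J - 1))) n"
      unfolding n(2) by (rule numerov_shift) (rule n)
    also have "\<dots> = - of_real c * d2 (\<lambda>i. W (i + (J - 1))) n"
      using ext_q_equation[OF q n(1) tbc]
      unfolding G_def W_def w_ex b_ex c_def by (simp add: vq_exterior)
    also have "d2 (\<lambda>i. W (i + (J - 1))) n = d2 W j"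
      unfolding n(2) by (rule d2_shift[symmetric]) (rule n)
    finally show ?thesis using False by (simp add: \<phi>_def)
  qed
  have energy: "hbar / (2 * \<tau>) * ((\<Sum>j=1..N. (cmod (w j))\<^sup>2) - (\<Sum>j=1..N. (cmod (b' j))\<^sup>2))
    \<le> (L2_set (\<lambda>j. cmod (F j)) {1..J-1} / (1 - 4 * theta q) + \<eta> N) * L2_set (\<lambda>j. cmod (W j)) {1..N}"
    if N: "N \<ge> J" for N
  proof -
    have "L2_set (\<lambda>j. cmod (\<phi> j)) {1..N} = L2_set (\<lambda>j. cmod (F j)) {1..J-1}"
    proof -
      have "(\<Sum>j=1..N. (cmod (\<phi> j))\<^sup>2) = (\<Sum>j=1..J-1. (cmod (F j))\<^sup>2)"
        by (rule sum.mono_neutral_cong_right) (use N in \<open>auto simp: \<phi>_def\<close>)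
      then show ?thesis by (simp only: L2_set_def)
    qed
    moreover have "hbar / (2 * \<tau>) * ((\<Sum>j=1..N. (cmod (w j))\<^sup>2) - (\<Sum>j=1..N. (cmod (b' j))\<^sup>2))
      \<le> (L2_set (\<lambda>j. cmod (\<phi> j)) {1..N} + c * cmod (W (Suc N)) + theta q * cmod (G (Suc N)))
        * (L2_set (\<lambda>j. cmod (W j)) {1..N} / (1 - 4 * theta q))"
      using \<theta> c hbar \<tau> w_in[of 0] b_in[of 0] z full
      by (intro numerov_energy[where c = c and v = "vq q"]) (auto simp: W_def G_def)
    ultimately show ?thesis
      by (simp add: \<eta>_def field_simps add_divide_distrib)
  qed
  have w0: "w \<longlonglongrightarrow> 0" unfolding w_def using q by (rule glue_tendsto_0)
  have b0: "b' \<longlonglongrightarrow> 0" using b' glue_tendsto_0[OF q] by (cases "m = 0") auto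
  have "W \<longlonglongrightarrow> (0 + 0) / 2"
    unfolding W_def by (intro tendsto_divide tendsto_add w0 b0 tendsto_const) simp
  then have W0: "(\<lambda>i. cmod (W i)) \<longlonglongrightarrow> 0"
    by (intro tendsto_norm_zero) simp
  \<comment> \<open>From \<open>J - 1\<close> on the potential is constant, so \<open>G\<close> is a
    fixed linear combination of null sequences.\<close>
  have "(\<lambda>i. G (i + (J - 1))) \<longlonglongrightarrow>
      \<i> * of_real hbar * ((0 - 0) / of_real \<tau>) - of_real (Vinf_q q) * ((0 + 0) / 2)"
  proof -
    have "(\<lambda>i. G (i + (J - 1))) = (\<lambda>i. \<i> * of_real hbar * ((w (i + (J - 1)) - b' (i + (J - 1))) / of_real \<tau>)
      - of_real (Vinf_q q) * ((w (i + (J - 1)) + b' (i + (J - 1))) / 2))"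
      by (simp add: G_def W_def vq_exterior)
    then show ?thesis
      using \<tau> LIMSEQ_ignore_initial_segment[OF w0, of "J - 1"] LIMSEQ_ignore_initial_segment[OF b0, of "J - 1"]
      by (simp only:) (intro tendsto_intros, auto)
  qed
  then have "(\<lambda>i. G (i + (J - 1))) \<longlonglongrightarrow> 0" by simp
  then have "G \<longlonglongrightarrow> 0" by (rule LIMSEQ_offset)
  then have G0: "(\<lambda>i. cmod (G i)) \<longlonglongrightarrow> 0" by (rule tendsto_norm_zero)
  have "\<eta> \<longlonglongrightarrow> (c * 0 + theta q * 0) / (1 - 4 * theta q)"
    unfolding \<eta>_def using \<theta> LIMSEQ_Suc[OF W0] LIMSEQ_Suc[OF G0]
    by (intro tendsto_intros) auto
  then have "\<eta> \<longlonglongrightarrow> 0" by simp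
  moreover have "\<eta> N \<ge> 0" for N
    using c \<theta> by (simp add: \<eta>_def)
  ultimately show ?thesis
    using energy unfolding W_def by blast
qed

text \<open>Without source and old value the energy estimate bounds the norm on \<open>1..N\<close>
  by \<open>\<tau> / hbar * \<eta> N\<close>, which tends to zero. Level 0 of the residual is the
  right one, since its convolution is just \<open>R q 0 * u J\<close>.\<close>

lemma mode_unique:
  assumes q: "q \<in> {1..K-1}" and u0: "u 0 = 0"
    and eq: "\<And>j. j \<in> {1..J-1} \<Longrightarrow> mode_residual q u (\<lambda>_. 0) j = 0"
    and tbc: "tbc_residual_q q (\<lambda>_. u (J - 1)) (\<lambda>_. u J) 0 = 0"
  shows "u 1 = 0"
proof -
  define w where "w = glue q u (\<lambda>_. u (J - 1)) (\<lambda>_. u J) 0"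
  obtain \<eta> where \<eta>: "\<eta> \<longlonglongrightarrow> 0" "\<And>N. 0 \<le> \<eta> N" and en: "\<And>N. N \<ge> J \<Longrightarrow>
    hbar / (2 * \<tau>) * ((\<Sum>j=1..N. (cmod (w j))\<^sup>2) - (\<Sum>j=1..N. (cmod (0::complex))\<^sup>2))
    \<le> (L2_set (\<lambda>j. cmod 0) {1..J-1} / (1 - 4 * theta q) + \<eta> N)
        * L2_set (\<lambda>j. cmod ((w j + 0) / 2)) {1..N}"
    using mode_energy[where f = "\<lambda>_. u (J - 1)" and g = "\<lambda>_. u J" and m = 0 and F = "\<lambda>_. 0"
        and b = "\<lambda>_. 0" and b' = "\<lambda>_. 0" and u = u, OF q u0 refl refl refl _ _ eq tbc]
    unfolding w_def by auto
  have "cmod (u 1) \<le> \<tau> / hbar * \<eta> N" if N: "N \<ge> J" for N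
  proof -
    let ?p = "L2_set (\<lambda>j. cmod (w j)) {1..N}"
    have half: "L2_set (\<lambda>j. cmod ((w j + 0) / 2)) {1..N} = ?p / 2"
    proof -
      have "L2_set (\<lambda>j. cmod ((w j + 0) / 2)) {1..N} = L2_set (\<lambda>j. (1/2) * cmod (w j)) {1..N}"
        by (simp add: norm_divide)
      also have "\<dots> = (1/2) * ?p" by (subst L2_set_right_distrib) auto
      finally show ?thesis by simp
    qed
    have "hbar / (2 * \<tau>) * ?p\<^sup>2 \<le> \<eta> N * (?p / 2)"
      using en[OF N] unfolding half L2_set_square_sum by (simp add: L2_set_def)
    then have "?p * ?p \<le> (\<tau> / hbar * \<eta> N) * ?p"
      using hbar \<tau> by (simp add: field_simps power2_eq_square)
    then have "?p \<le> \<tau> / hbar * \<eta> N"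
    proof (cases "?p = 0")
      case False
      then have "?p > 0" by (simp add: L2_set_nonneg order_less_le)
      then show ?thesis using \<open>?p * ?p \<le> _\<close> by (rule mult_right_le_imp_le[rotated])
    qed (use hbar \<tau> \<eta> in simp)
    moreover have "cmod (w 1) \<le> ?p"
      using N J by (intro member_le_L2_set) auto
    moreover have "w 1 = u 1"
      unfolding w_def using q J by (intro glue_inner) auto
    ultimately show ?thesis by simp
  qed
  moreover have "(\<lambda>N. \<tau> / hbar * \<eta> N) \<longlonglongrightarrow> \<tau> / hbar * 0"
    by (intro tendsto_intros \<eta>)
  ultimately have "cmod (u 1) \<le> \<tau> / hbar * 0"
    by (intro LIMSEQ_le_const[of "\<lambda>N. \<tau> / hbar * \<eta> N"]) auto
  then show ?thesis by simp
qed

section \<open>Solvability of one time level for one mode\<close>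

lemma mode_residual_linear:
  fixes u b :: "nat \<Rightarrow> complex" and q :: nat
  defines "\<kappa> \<equiv> \<lambda>i. \<i> * of_real (hbar / \<tau>) - of_real (vq q i / 2)"
  defines "c \<equiv> complex_of_real (c_hbar_q q / hx\<^sup>2 / 2)"
  shows "mode_residual q u b j = (of_real (theta q) * \<kappa> (Suc j) + c) * u (Suc j)
     + ((1 - 2 * of_real (theta q)) * \<kappa> j - 2 * c) * u j
     + (of_real (theta q) * \<kappa> (j - 1) + c) * u (j - 1) + mode_residual q (\<lambda>_. 0) b j"
proof -
  define B where "B i = \<i> * of_real hbar * (b i / of_real \<tau>) + of_real (vq q i) * (b i / 2)" for i
  have G: "\<i> * of_real hbar * ((w i - b i) / of_real \<tau>) - of_real (vq q i) * ((w i + b i) / 2)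
    = \<kappa> i * w i - B i" for i and w :: "nat \<Rightarrow> complex"
    by (simp add: \<kappa>_def B_def algebra_simps diff_divide_distrib add_divide_distrib)
  have c: "complex_of_real (c_hbar_q q / hx\<^sup>2) = 2 * c" by (simp add: c_def)
  have res: "mode_residual q w b j = numerov (theta q) (\<lambda>i. \<kappa> i * w i - B i) j
     + 2 * c * d2 (\<lambda>i. (w i + b i) / 2) j" for w
    unfolding mode_residual_def G c ..
  show ?thesis
    unfolding res numerov_def d2_def
    by (simp add: algebra_simps add_divide_distrib)
qed

text \<open>The unknown new trace enters the convolution through \<open>r 0\<close> alone; the rest
  is history.\<close>

lemma conv_update: "conv r (g(m := z)) m = r 0 * z + conv r (g(m := 0)) m"
  unfolding conv_def
  by (auto simp: sum.atLeast_Suc_atMost intro!: sum.cong)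

lemma tbc_residual_update:
  assumes "q \<in> {1..K-1}"
  shows "tbc_residual_q q (f(m := t)) (g(m := z)) m
    = (1/2 + of_real (hx\<^sup>2) * of_real (1/2 - theta q) * cnj (a q) - of_real hx * R q 0) * z
      + (- 1/2 + of_real (hx\<^sup>2) * of_real (theta q) * cnj (a q)) * t
      + tbc_residual_q q (f(m := 0)) (g(m := 0)) m"
proof -
  have ne: "m \<noteq> 0 \<Longrightarrow> m - 1 \<noteq> m" by simp
  show ?thesis
    unfolding tbc_residual_q_eq[OF assms] conv_update[of _ g m z] Let_def
    using ne by (simp add: algebra_simps add_divide_distrib)
qed

text \<open>Shooting with the boundary condition as terminal condition. Its homogeneous part does
  not depend on the time level, so uniqueness at level 0 settles all levels.\<close>

lemma mode_exists:
  assumes q: "q \<in> {1..K-1}"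
  shows "\<exists>u. u 0 = 0 \<and> (\<forall>j\<in>{1..J-1}. mode_residual q u b j = F j)
    \<and> tbc_residual_q q (f(m := u (J - 1))) (g(m := u J)) m = 0"
proof -
  define \<kappa> where "\<kappa> = (\<lambda>i. \<i> * of_real (hbar / \<tau>) - complex_of_real (vq q i / 2))"
  define c where "c = complex_of_real (c_hbar_q q / hx\<^sup>2 / 2)"
  define A where "A j = of_real (theta q) * \<kappa> (Suc j) + c" for j
  define B where "B j = (1 - 2 * of_real (theta q)) * \<kappa> j - 2 * c" for j
  define C where "C j = of_real (theta q) * \<kappa> (j - 1) + c" for j
  define pz where "pz = 1/2 + of_real (hx\<^sup>2) * of_real (1/2 - theta q) * cnj (a q) - of_real hx * R q 0"
  define py where "py = - 1/2 + of_real (hx\<^sup>2) * of_real (theta q) * cnj (a q)"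
  have res: "mode_residual q u b j = A j * u (Suc j) + B j * u j + C j * u (j - 1) + mode_residual q (\<lambda>_. 0) b j" for u b j
    unfolding A_def B_def C_def \<kappa>_def c_def by (rule mode_residual_linear)
  have res0: "mode_residual q (\<lambda>_. 0) (\<lambda>_. 0) j = 0" for j
    by (simp add: mode_residual_def numerov_def d2_def)
  have tbc: "tbc_residual_q q (f(m := t)) (g(m := z)) m = pz * z + py * t + tbc_residual_q q (f(m := 0)) (g(m := 0)) m" for f g m t z
    unfolding pz_def py_def by (rule tbc_residual_update[OF q])
  have J': "Suc (J - 1) = J" using J by simp
  have "\<exists>u. u 0 = 0 \<and> (\<forall>j\<in>{1..J-1}. A j * u (Suc j) + B j * u j + C j * u (j - 1)
      = F j - mode_residual q (\<lambda>_. 0) b j) \<and> pz * u (Suc (J - 1)) + py * u (J - 1)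
      = - tbc_residual_q q (f(m := 0)) (g(m := 0)) m"
  proof (rule shooting)
    fix j
    \<comment> \<open>The time difference alone contributes the imaginary part, so the recurrence
      can be solved for \<open>u (Suc j)\<close> whatever the potential.\<close>
    have "Im (A j) = theta q * (hbar / \<tau>)" by (simp add: A_def \<kappa>_def c_def)
    also have "\<dots> \<noteq> 0" using theta_bounds[OF q] hbar \<tau> by simp
    finally show "A j \<noteq> 0" by auto
  next
    fix u :: "nat \<Rightarrow> complex"
    assume u0: "u 0 = 0" and eq: "\<And>j. 1 \<le> j \<Longrightarrow> j \<le> J - 1 \<Longrightarrow> A j * u (Suc j) + B j * u j + C j * u (j - 1) = 0"
      and bc: "pz * u (Suc (J - 1)) + py * u (J - 1) = 0"
    show "u 1 = 0"
    proof (rule mode_unique[where q = q and u = u, OF q u0])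
      show "mode_residual q u (\<lambda>_. 0) j = 0" if "j \<in> {1..J-1}" for j
        using eq[of j] that unfolding res[of u "\<lambda>_. 0" j] res0 by simp
      \<comment> \<open>A zero history turns the homogeneous terminal condition into the level 0
        residual.\<close>
      have "tbc_residual_q q (\<lambda>_. u (J - 1)) (\<lambda>_. u J) 0
        = tbc_residual_q q ((\<lambda>_. 0)(0 := u (J - 1))) ((\<lambda>_. 0)(0 := u J)) 0"
        unfolding tbc_residual_q_eq[OF q] by (simp add: conv_def)
      also have "\<dots> = pz * u J + py * u (J - 1) + tbc_residual_q q ((\<lambda>_. 0)(0 := 0)) ((\<lambda>_. 0)(0 := 0)) 0"
        by (rule tbc)
      also have "tbc_residual_q q ((\<lambda>_. 0)(0 := 0)) ((\<lambda>_. 0)(0 := 0)) 0 = 0"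
        unfolding tbc_residual_q_eq[OF q] by (simp add: conv_def)
      finally show "tbc_residual_q q (\<lambda>_. u (J - 1)) (\<lambda>_. u J) 0 = 0"
        using bc unfolding J' by simp
    qed
  qed
  then obtain u where u0: "u 0 = 0" and eq: "\<forall>j\<in>{1..J-1}. A j * u (Suc j) + B j * u j + C j * u (j - 1)
      = F j - mode_residual q (\<lambda>_. 0) b j" and bc: "pz * u (Suc (J - 1)) + py * u (J - 1)
      = - tbc_residual_q q (f(m := 0)) (g(m := 0)) m"
    by blast
  have "mode_residual q u b j = F j" if "j \<in> {1..J-1}" for j
    unfolding res[of u b j] using eq that by simp
  moreover have "tbc_residual_q q (f(m := u (J - 1))) (g(m := u J)) m = 0"
    using bc tbc[where f = f and g = g and m = m and t = "u (J - 1)" and z = "u J"] unfolding J' by simp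
  ultimately show ?thesis using u0 by blast
qed

text \<open>Multiplication by \<open>hx / c_hbar_q q\<close> turns one form into the other. By the
  conditions \<open>b\<close> the breve traces are those of the previous level, so a single pair of
  histories \<open>f\<close> and \<open>g\<close> encodes both families.\<close>

lemma TBC_iff:
  assumes q: "q \<in> {1..K-1}" and m: "m \<ge> 1"
    and g: "\<And>p. p \<le> m \<Longrightarrow> g p = dst q (if p = 0 then \<Psi> 0 else \<Psi>t p) J"
    and f: "f m = dst q (\<Psi>t m) (J - 1)"
    and b: "dst q (\<Psi>b m) J = g (m - 1)" "dst q (\<Psi>b m) (J - 1) = f (m - 1)"
  shows "TBC \<Psi> \<Psi>b \<Psi>t m q \<longleftrightarrow> tbc_residual_q q f g m = 0"
proof -
  define w where "w = dst q (\<Psi>t m)"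
  define b' where "b' = dst q (\<Psi>b m)"
  define c where "c = complex_of_real (c_hbar_q q)"
  define h where "h = complex_of_real hx"
  define r where "r = (\<lambda>j. cnj (a q) * w j + a q * b' j)"
  define C where "C = conv (R q) g m"
  have c: "c \<noteq> 0" using c_hbar_q_pos[of q] by (simp add: c_def)
  have h: "h \<noteq> 0" using hx_pos by (simp add: h_def)
  have conv: "conv (R q) (\<lambda>p. dst q (if p = 0 then \<Psi> 0 else \<Psi>t p) J) m = C"
    unfolding C_def conv_def by (intro sum.cong refl) (simp add: g)
  have G: "\<i> * of_real hbar * ((w j - b' j) / of_real \<tau>) - of_real (Vinf_q q) * ((b' j + w j) / 2)
     = - c * r j" for j
  proof -
    have ca: "c * a q = of_real (Vinf_q q / 2) + \<i> * of_real (hbar / \<tau>)"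
      using c \<tau> by (simp add: a_def c_def field_simps)
    have cca: "c * cnj (a q) = of_real (Vinf_q q / 2) - \<i> * of_real (hbar / \<tau>)"
      using arg_cong[OF ca, of cnj] by (simp add: c_def)
    have "- c * r j = - (c * cnj (a q)) * w j - (c * a q) * b' j"
      by (simp add: r_def algebra_simps)
    then show ?thesis
      unfolding ca cca by (simp add: algebra_simps diff_divide_distrib add_divide_distrib)
  qed
  have "TBC \<Psi> \<Psi>b \<Psi>t m q \<longleftrightarrow>
    c * (((w J + b' J) / 2 - (w (J - 1) + b' (J - 1)) / 2) / h)
    - h * (of_real (theta q) * (- c * r (J - 1)) + of_real (1/2 - theta q) * (- c * r J)) = c * C"
    unfolding TBC_def conv w_def[symmetric] b'_def[symmetric] G bdiff_def s_minus_def c_def h_def ..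
  also have "\<dots> \<longleftrightarrow> ((w J + b' J) / 2 - (w (J - 1) + b' (J - 1)) / 2)
      + h\<^sup>2 * (of_real (theta q) * r (J - 1) + of_real (1/2 - theta q) * r J) - h * C = 0"
    (is "?l = c * C \<longleftrightarrow> ?r = 0")
  proof -
    have "?r = h / c * (?l - c * C)"
      using c h by (simp add: field_simps power2_eq_square)
    then show ?thesis using c h by simp
  qed
  also have "?r = tbc_residual_q q f g m"
    using m g[of m] f b unfolding tbc_residual_q_eq[OF q] Let_def
    by (simp add: r_def C_def h_def w_def b'_def)
  finally show ?thesis .
qed

section \<open>Stability and uniqueness\<close>

text \<open>One time level of \<open>solves\<close> in isolation; it looks only at levels up to
  \<open>m\<close>, which permits construction level by level.\<close>

definition step where
  "step F \<Psi> \<Psi>b \<Psi>t m \<longleftrightarrow>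
       (\<forall>(j, k)\<in>omega \<union> Gamma1.
          \<i> * of_real hbar * ((\<Psi>b m j k - \<Psi> (m - 1) j k) / of_real (\<tau> / 2))
          = of_real (V (x j) (y k) - Vt (x j)) * ((\<Psi>b m j k + \<Psi> (m - 1) j k) / 2)) \<and>
       (\<forall>(j, k)\<in>omega \<union> Gamma1.
          \<i> * of_real hbar * ((\<Psi> m j k - \<Psi>t m j k) / of_real (\<tau> / 2))
          = of_real (V (x j) (y k) - Vt (x j)) * ((\<Psi> m j k + \<Psi>t m j k) / 2)) \<and>
       (\<forall>(j, k)\<in>omega.
          \<i> * of_real hbar * s_N (\<lambda>j k. (\<Psi>t m j k - \<Psi>b m j k) / of_real \<tau>) j k
          = - of_real c_hbar * Delta_hN (\<lambda>j k. (\<Psi>t m j k + \<Psi>b m j k) / 2) j k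
            + s_N (\<lambda>j k. of_real (Vt (x j)) * ((\<Psi>t m j k + \<Psi>b m j k) / 2)) j k
            + F m j k) \<and>
       (\<forall>(j, k)\<in>Gamma. \<Psi>b m j k = 0 \<and> \<Psi>t m j k = 0 \<and> \<Psi> m j k = 0) \<and>
       (\<forall>q\<in>{1..K - 1}. TBC \<Psi> \<Psi>b \<Psi>t m q)"

lemma solves_iff:
  "solves \<Psi>0 F \<Psi> \<Psi>b \<Psi>t \<longleftrightarrow> (\<forall>(j, k)\<in>omega_bar. \<Psi> 0 j k = \<Psi>0 j k) \<and> (\<forall>m\<ge>1. step F \<Psi> \<Psi>b \<Psi>t m)"
  unfolding solves_def step_def ..

lemma mem_omega: "(j, k) \<in> omega \<longleftrightarrow> j \<in> {1..J-1} \<and> k \<in> {1..K-1}"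
  by (simp add: omega_def)

lemma mem_omega_Gamma1: "(j, k) \<in> omega \<union> Gamma1 \<longleftrightarrow> j \<in> {1..J} \<and> k \<in> {1..K-1}"
  using J by (auto simp: omega_def Gamma1_def)

lemma mem_Gamma: "(j, k) \<in> Gamma \<longleftrightarrow> j \<le> J \<and> k \<le> K \<and> (j = 0 \<or> k = 0 \<or> k = K)"
  using J K by (auto simp: omega_def Gamma1_def Gamma_def bd_omega_def omega_bar_def)

text \<open>The Cayley factor of a Crank-Nicolson half step with multiplication by
  \<open>v\<close>.\<close>

definition phase :: "real \<Rightarrow> complex" where
  "phase v = (\<i> * of_real (2 * hbar / \<tau>) + of_real (v / 2)) / (\<i> * of_real (2 * hbar / \<tau>) - of_real (v / 2))"

lemma phase_denominator_nz: "\<i> * of_real (2 * hbar / \<tau>) - complex_of_real (v / 2) \<noteq> 0"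
proof
  assume "\<i> * of_real (2 * hbar / \<tau>) - complex_of_real (v / 2) = 0"
  then have "Im (\<i> * of_real (2 * hbar / \<tau>) - complex_of_real (v / 2)) = Im 0"
    by (rule arg_cong)
  then show False using hbar \<tau> by simp
qed

lemma phase_iff:
  "\<i> * of_real hbar * ((z - w) / of_real (\<tau> / 2)) = of_real v * ((z + w) / 2) \<longleftrightarrow> z = phase v * w"
proof -
  define A where "A = \<i> * complex_of_real (2 * hbar / \<tau>)"
  define B where "B = complex_of_real (v / 2)"
  have l: "\<i> * of_real hbar * ((z - w) / of_real (\<tau> / 2)) = A * (z - w)"
    using \<tau> by (simp add: A_def)
  have r: "of_real v * ((z + w) / 2) = B * (z + w)"
    by (simp add: B_def)
  have "A - B \<noteq> 0"
    unfolding A_def B_def by (rule phase_denominator_nz)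
  then have "z = (A + B) / (A - B) * w \<longleftrightarrow> (A - B) * z = (A + B) * w"
    by (simp add: field_simps)
  also have "\<dots> \<longleftrightarrow> A * (z - w) = B * (z + w)"
    by (auto simp: algebra_simps)
  finally show ?thesis
    unfolding l r phase_def A_def[symmetric] B_def[symmetric] by (rule sym)
qed

lemma cmod_phase: "cmod (phase v) = 1"
proof -
  have "cmod (\<i> * of_real (2 * hbar / \<tau>) + of_real (v / 2)) = cmod (\<i> * of_real (2 * hbar / \<tau>) - complex_of_real (v / 2))"
    by (simp add: cmod_def)
  then show ?thesis
    using phase_denominator_nz[of v] by (simp only: phase_def norm_divide) simp
qed

lemma phase_0: "phase 0 = 1"
  using phase_denominator_nz[of 0] by (simp add: phase_def)

lemma step_pointwise:
  assumes "step F \<Psi> \<Psi>b \<Psi>t m" "j \<in> {1..J}" "k \<in> {1..K-1}"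
  shows "\<Psi>b m j k = phase (V (x j) (y k) - Vt (x j)) * \<Psi> (m - 1) j k"
    "\<Psi> m j k = phase (V (x j) (y k) - Vt (x j)) * \<Psi>t m j k"
proof -
  have "(j, k) \<in> omega \<union> Gamma1" using assms mem_omega_Gamma1 by blast
  then show "\<Psi>b m j k = phase (V (x j) (y k) - Vt (x j)) * \<Psi> (m - 1) j k"
    "\<Psi> m j k = phase (V (x j) (y k) - Vt (x j)) * \<Psi>t m j k"
    using assms(1) unfolding step_def phase_iff by blast+
qed

text \<open>Links the three families at the boundary: the trace history passes unchanged through the
  splitting.\<close>

lemma step_right_end:
  assumes "step F \<Psi> \<Psi>b \<Psi>t m" "j \<in> {J - 1, J}" "k \<in> {1..K-1}"
  shows "\<Psi>b m j k = \<Psi> (m - 1) j k" "\<Psi> m j k = \<Psi>t m j k"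
proof -
  have "j \<in> {1..J}" "j \<ge> J - 1" using assms J_ge_2 by auto
  then show "\<Psi>b m j k = \<Psi> (m - 1) j k" "\<Psi> m j k = \<Psi>t m j k"
    using step_pointwise[OF assms(1) _ assms(3), of j] V_eq_Vt[OF _ assms(3), of j] by (auto simp: phase_0)
qed

lemma step_Gamma:
  assumes "step F \<Psi> \<Psi>b \<Psi>t m" "j \<le> J" "k \<le> K" "j = 0 \<or> k = 0 \<or> k = K"
  shows "\<Psi>b m j k = 0 \<and> \<Psi>t m j k = 0 \<and> \<Psi> m j k = 0"
proof -
  have "(j, k) \<in> Gamma" using assms mem_Gamma by blast
  then show ?thesis using assms(1) unfolding step_def by blast
qed

lemma dst_cong: "(\<And>k. k \<in> {1..K-1} \<Longrightarrow> Z j k = W i k) \<Longrightarrow> dst q Z j = dst q W i"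
  unfolding dst_eq by (rule sine_transform_cong)

lemma dst_zero: "(\<And>k. k \<in> {1..K-1} \<Longrightarrow> Z j k = 0) \<Longrightarrow> dst q Z j = 0"
  by (simp add: dst_def)

text \<open>An equivalence, since stability needs the passage to modes and existence the way back,
  which rests on injectivity of the sine transform.\<close>

lemma main_equation_iff:
  assumes "\<And>i. i \<le> J \<Longrightarrow> t i 0 = 0 \<and> t i K = 0 \<and> b i 0 = 0 \<and> b i K = 0"
  shows "(\<forall>(j, k)\<in>omega. main_residual t b G j k = 0) \<longleftrightarrow>
    (\<forall>q\<in>{1..K-1}. \<forall>j\<in>{1..J-1}. mode_residual q (dst q t) (dst q b) j = dst q G j / of_real (sig q))"
proof -
  have "(\<forall>(j, k)\<in>omega. main_residual t b G j k = 0) \<longleftrightarrow>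
    (\<forall>q\<in>{1..K-1}. \<forall>j\<in>{1..J-1}. dst q (main_residual t b G) j = 0)"
  proof (intro iffI ballI)
    fix q j
    assume "\<forall>(j, k)\<in>omega. main_residual t b G j k = 0" "j \<in> {1..J-1}"
    then show "dst q (main_residual t b G) j = 0"
      by (intro dst_zero) (auto simp: mem_omega)
  next
    fix jk
    assume *: "\<forall>q\<in>{1..K-1}. \<forall>j\<in>{1..J-1}. dst q (main_residual t b G) j = 0" and "jk \<in> omega"
    then obtain j k where jk: "jk = (j, k)" "j \<in> {1..J-1}" "k \<in> {1..K-1}"
      using mem_omega by (cases jk) auto
    have "main_residual t b G j k = 0"
      by (rule sine_transform_eq_0[OF _ jk(3)]) (use * jk in \<open>simp flip: dst_eq\<close>)
    then show "case jk of (j, k) \<Rightarrow> main_residual t b G j k = 0"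
      by (simp add: jk)
  qed
  moreover have "dst q (main_residual t b G) j = 0 \<longleftrightarrow>
      mode_residual q (dst q t) (dst q b) j = dst q G j / of_real (sig q)"
    if "q \<in> {1..K-1}" "j \<in> {1..J-1}" for q j
  proof -
    have "sig q \<noteq> 0" using sig_bounds[OF that(1)] by auto
    moreover have "dst q (main_residual t b G) j
      = of_real (sig q) * mode_residual q (dst q t) (dst q b) j - dst q G j"
      by (rule dst_main_residual) (use assms that in auto)
    ultimately show ?thesis by (auto simp: field_simps)
  qed
  ultimately show ?thesis by simp
qed

lemma step_main:
  assumes "step F \<Psi> \<Psi>b \<Psi>t m"
  shows "\<forall>(j, k)\<in>omega. main_residual (\<Psi>t m) (\<Psi>b m) (F m) j k = 0"
  using assms unfolding step_def main_residual_def by auto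

lemma step_mode:
  assumes st: "step F \<Psi> \<Psi>b \<Psi>t m" and "q \<in> {1..K-1}" "j \<in> {1..J-1}"
  shows "mode_residual q (dst q (\<Psi>t m)) (dst q (\<Psi>b m)) j = dst q (F m) j / of_real (sig q)"
proof -
  have "\<forall>(j, k)\<in>omega. main_residual (\<Psi>t m) (\<Psi>b m) (F m) j k = 0"
    by (rule step_main[OF st])
  moreover have "\<And>i. i \<le> J \<Longrightarrow> \<Psi>t m i 0 = 0 \<and> \<Psi>t m i K = 0 \<and> \<Psi>b m i 0 = 0 \<and> \<Psi>b m i K = 0"
    using step_Gamma[OF st] by blast
  ultimately show ?thesis using main_equation_iff[of "\<Psi>t m" "\<Psi>b m" "F m"] assms by blast
qed

section \<open>Norms over all modes\<close>

definition mode_norm :: "(nat \<Rightarrow> nat \<Rightarrow> complex) \<Rightarrow> nat \<Rightarrow> real" where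
  "mode_norm u N = L2_set (\<lambda>q. L2_set (\<lambda>j. cmod (u q j)) {1..N}) {1..K-1}"

lemma mode_norm_nonneg: "mode_norm u N \<ge> 0"
  by (simp add: mode_norm_def L2_set_nonneg)

lemma mode_norm_sq: "(mode_norm u N)\<^sup>2 = (\<Sum>j=1..N. \<Sum>q=1..K-1. (cmod (u q j))\<^sup>2)"
  unfolding mode_norm_def L2_set_square_sum by (rule sum.swap)

lemma mode_norm_eqI:
  assumes "\<And>j. j \<in> {1..N} \<Longrightarrow> (\<Sum>q=1..K-1. (cmod (u q j))\<^sup>2) = (\<Sum>q=1..K-1. (cmod (v q j))\<^sup>2)"
  shows "mode_norm u N = mode_norm v N"
proof -
  have "(mode_norm u N)\<^sup>2 = (mode_norm v N)\<^sup>2"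
    unfolding mode_norm_sq by (intro sum.cong refl assms)
  then show ?thesis using mode_norm_nonneg by (simp add: power2_eq_iff_nonneg)
qed

lemma mode_norm_mono: "N \<le> N' \<Longrightarrow> mode_norm u N \<le> mode_norm u N'"
  by (rule power2_le_imp_le[OF _ mode_norm_nonneg])
    (auto simp: mode_norm_sq intro!: sum_mono2 sum_nonneg)

lemma Parseval_dst: "(\<Sum>k=1..K-1. (cmod (U j k))\<^sup>2) = real K / 2 * (\<Sum>q=1..K-1. (cmod (dst q U j))\<^sup>2)"
  unfolding dst_eq by (rule sine_transform_Parseval)

text \<open>Parseval gives both mesh norms the same factor, so stability can be proved for modes and
  scaled at the end.\<close>

lemma mesh_norm_eq:
  "sqrt (\<Sum>j=1..N. \<Sum>k=1..K-1. (cmod (U j k))\<^sup>2 * hx * hy)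
    = sqrt (hx * hy * real K / 2) * mode_norm (\<lambda>q. dst q U) N"
proof -
  have "(\<Sum>j=1..N. \<Sum>k=1..K-1. (cmod (U j k))\<^sup>2 * hx * hy) = hx * hy * (\<Sum>j=1..N. \<Sum>k=1..K-1. (cmod (U j k))\<^sup>2)"
    by (simp add: sum_distrib_left mult_ac)
  also have "\<dots> = (hx * hy * real K / 2) * (mode_norm (\<lambda>q. dst q U) N)\<^sup>2"
    unfolding mode_norm_sq Parseval_dst sum_distrib_left[symmetric] by simp
  finally show ?thesis
    by (simp only: real_sqrt_mult real_sqrt_abs abs_of_nonneg[OF mode_norm_nonneg])
qed

lemma norm_omega_tilde_eq: "norm_omega_tilde U = sqrt (hx * hy * real K / 2) * mode_norm (\<lambda>q. dst q U) J"
  unfolding norm_omega_tilde_def by (rule mesh_norm_eq)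

lemma norm_omega_eq: "norm_omega U = sqrt (hx * hy * real K / 2) * mode_norm (\<lambda>q. dst q U) (J - 1)"
  unfolding norm_omega_def by (rule mesh_norm_eq)

text \<open>Multiplication by the potential mixes the modes, but it preserves moduli in physical space;
  Parseval carries this over to the extended functions.\<close>

lemma mode_norm_glue_cong:
  assumes "\<And>j k. j \<in> {1..J} \<Longrightarrow> k \<in> {1..K-1} \<Longrightarrow> cmod (U j k) = cmod (U' j k)"
  shows "mode_norm (\<lambda>q. glue q (dst q U) (f q) (g q) m) N = mode_norm (\<lambda>q. glue q (dst q U') (f q) (g q) m) N"
proof (rule mode_norm_eqI)
  fix j
  assume j: "j \<in> {1..N}"
  show "(\<Sum>q=1..K-1. (cmod (glue q (dst q U) (f q) (g q) m j))\<^sup>2) = (\<Sum>q=1..K-1. (cmod (glue q (dst q U') (f q) (g q) m j))\<^sup>2)"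
  proof (cases "j < J - 1")
    case True
    have "real K / 2 * (\<Sum>q=1..K-1. (cmod (dst q U j))\<^sup>2) = real K / 2 * (\<Sum>q=1..K-1. (cmod (dst q U' j))\<^sup>2)"
      unfolding Parseval_dst[symmetric] using assms True j by (intro sum.cong) auto
    then show ?thesis using True K by (simp add: glue_def)
  qed (simp add: glue_def)
qed

lemma quadratic_increment:
  fixes p r B :: real
  assumes "p \<ge> 0" "r \<ge> 0" "B \<ge> 0" "hbar / (2 * \<tau>) * (p\<^sup>2 - r\<^sup>2) \<le> B * ((p + r) / 2)"
  shows "p - r \<le> \<tau> / hbar * B"
proof (cases "p + r = 0")
  case False
  then have "p + r > 0" using assms by linarith
  moreover have "(p - r) * (p + r) \<le> (\<tau> / hbar * B) * (p + r)"
    using assms(4) hbar \<tau> by (simp add: field_simps power2_eq_square)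
  ultimately show ?thesis by (rule mult_right_le_imp_le[rotated])
next
  case True
  then have "p = 0" "r = 0" using assms by linarith+
  then show ?thesis using assms hbar \<tau> by simp
qed

text \<open>The modes are summed by Cauchy-Schwarz before dividing by the sum of the norms, because
  the potential steps mix the modes and preserve only the joint norm.\<close>

lemma mode_norm_increment:
  assumes en: "\<And>q. q \<in> {1..K-1} \<Longrightarrow>
      hbar / (2 * \<tau>) * ((\<Sum>j=1..N. (cmod (w q j))\<^sup>2) - (\<Sum>j=1..N. (cmod (b q j))\<^sup>2))
      \<le> B q * L2_set (\<lambda>j. cmod ((w q j + b q j) / 2)) {1..N}"
    and B: "\<And>q. q \<in> {1..K-1} \<Longrightarrow> 0 \<le> B q"
  shows "mode_norm w N \<le> mode_norm b N + \<tau> / hbar * L2_set B {1..K-1}"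
proof -
  let ?W = "\<lambda>q. L2_set (\<lambda>j. cmod ((w q j + b q j) / 2)) {1..N}"
  have "hbar / (2 * \<tau>) * ((mode_norm w N)\<^sup>2 - (mode_norm b N)\<^sup>2)
    = (\<Sum>q=1..K-1. hbar / (2 * \<tau>) * ((\<Sum>j=1..N. (cmod (w q j))\<^sup>2) - (\<Sum>j=1..N. (cmod (b q j))\<^sup>2)))"
    unfolding mode_norm_def L2_set_square_sum by (simp only: sum_distrib_left sum_subtractf right_diff_distrib)
  also have "\<dots> \<le> (\<Sum>q=1..K-1. B q * ?W q)"
    by (intro sum_mono en)
  also have "\<dots> \<le> (\<Sum>q=1..K-1. \<bar>B q\<bar> * \<bar>?W q\<bar>)"
    using B by (intro sum_mono) (simp add: L2_set_nonneg)
  also have "\<dots> \<le> L2_set B {1..K-1} * L2_set ?W {1..K-1}"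
    by (rule L2_set_mult_ineq)
  also have "\<dots> \<le> L2_set B {1..K-1} * ((mode_norm w N + mode_norm b N) / 2)"
  proof (rule mult_left_mono)
    have "L2_set ?W {1..K-1} \<le> L2_set (\<lambda>q. (1/2) * (L2_set (\<lambda>j. cmod (w q j)) {1..N} + L2_set (\<lambda>j. cmod (b q j)) {1..N})) {1..K-1}"
      using L2_set_average by (intro L2_set_mono) (auto simp: L2_set_nonneg)
    also have "\<dots> = (1/2) * L2_set (\<lambda>q. L2_set (\<lambda>j. cmod (w q j)) {1..N} + L2_set (\<lambda>j. cmod (b q j)) {1..N}) {1..K-1}"
      by (rule L2_set_right_distrib[symmetric]) simp
    also have "\<dots> \<le> (1/2) * (mode_norm w N + mode_norm b N)"
      unfolding mode_norm_def by (intro mult_left_mono L2_set_triangle_ineq) simp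
    finally show "L2_set ?W {1..K-1} \<le> (mode_norm w N + mode_norm b N) / 2" by simp
  qed (rule L2_set_nonneg)
  finally have "mode_norm w N - mode_norm b N \<le> \<tau> / hbar * L2_set B {1..K-1}"
    by (rule quadratic_increment[OF mode_norm_nonneg mode_norm_nonneg L2_set_nonneg])
  then show ?thesis by linarith
qed

text \<open>The recursion in time runs for glued families on \<open>1..N\<close> with an error
  \<open>\<epsilon> N\<close>; after \<open>M\<close> levels the accumulated error still tends to
  zero as \<open>N\<close> grows. Zero initial traces leave no exterior norm on the right.\<close>

lemma stability:
  assumes sol: "solves \<Psi>0 F \<Psi> \<Psi>b \<Psi>t"
    and zero: "\<And>k. k \<in> {1..K-1} \<Longrightarrow> \<Psi>0 J k = 0 \<and> \<Psi>0 (J - 1) k = 0"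
  shows "norm_omega_tilde (\<Psi> M) \<le> norm_omega_tilde \<Psi>0 + 3 / hbar * (\<Sum>m=1..M. norm_omega (F m) * \<tau>)"
proof -
  have init: "\<Psi> 0 j k = \<Psi>0 j k" if "j \<le> J" "k \<le> K" for j k
    using sol that unfolding solves_iff by (auto simp: omega_bar_def)
  have st: "step F \<Psi> \<Psi>b \<Psi>t m" if "m \<ge> 1" for m
    using sol that unfolding solves_iff by blast
  define f where "f q m = dst q (if m = 0 then \<Psi> 0 else \<Psi>t m) (J - 1)" for q m
  define g where "g q m = dst q (if m = 0 then \<Psi> 0 else \<Psi>t m) J" for q m
  have trace: "dst q (\<Psi> m) (J - 1) = f q m" "dst q (\<Psi> m) J = g q m" for q m
  proof -
    have "dst q (\<Psi> m) j = dst q (if m = 0 then \<Psi> 0 else \<Psi>t m) j" if "j \<in> {J - 1, J}" for j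
      by (rule dst_cong) (use step_right_end(2)[OF st that] in auto)
    then show "dst q (\<Psi> m) (J - 1) = f q m" "dst q (\<Psi> m) J = g q m"
      by (simp_all add: f_def g_def)
  qed
  have trace_b: "dst q (\<Psi>b m) (J - 1) = f q (m - 1)" "dst q (\<Psi>b m) J = g q (m - 1)" if m: "m \<ge> 1" for q m
  proof -
    have "dst q (\<Psi>b m) j = dst q (\<Psi> (m - 1)) j" if "j \<in> {J - 1, J}" for j
      by (rule dst_cong) (use step_right_end(1)[OF st[OF m] that] in auto)
    then show "dst q (\<Psi>b m) (J - 1) = f q (m - 1)" "dst q (\<Psi>b m) J = g q (m - 1)"
      by (simp_all flip: trace)
  qed
  have tbc: "tbc_residual_q q (f q) (g q) m = 0" if "q \<in> {1..K-1}" "m \<ge> 1" for q m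
  proof -
    have "TBC \<Psi> \<Psi>b \<Psi>t m q" using st[OF that(2)] that(1) unfolding step_def by blast
    moreover have "TBC \<Psi> \<Psi>b \<Psi>t m q \<longleftrightarrow> tbc_residual_q q (f q) (g q) m = 0"
      by (rule TBC_iff[OF that]) (use that trace_b in \<open>auto simp: f_def g_def\<close>)
    ultimately show ?thesis by blast
  qed
  \<comment> \<open>The interior is \<open>\<Psi> m\<close> and the exterior is built from tilde
    traces; the two agree in the columns \<open>J - 1\<close> and \<open>J\<close>.\<close>
  define psi where "psi m = (\<lambda>q. glue q (dst q (\<Psi> m)) (f q) (g q) m)" for m
  define \<phi> where "\<phi> m = mode_norm (\<lambda>q. dst q (F m)) (J - 1)" for m
  have increment: "\<exists>\<epsilon>. \<epsilon> \<longlonglongrightarrow> 0 \<and> (\<forall>N\<ge>J. mode_norm (psi m) N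
     \<le> mode_norm (psi (m - 1)) N + \<tau> / hbar * (3 * \<phi> m) + \<epsilon> N)" if m: "m \<ge> 1" for m
  proof -
    define w where "w q = glue q (dst q (\<Psi>t m)) (f q) (g q) m" for q
    define b where "b q = glue q (dst q (\<Psi>b m)) (f q) (g q) (m - 1)" for q
    define G where "G q j = dst q (F m) j / of_real (sig q)" for q j
    have ex: "\<exists>\<eta>. \<eta> \<longlonglongrightarrow> 0 \<and> (\<forall>N. 0 \<le> \<eta> N) \<and> (\<forall>N\<ge>J.
       hbar / (2 * \<tau>) * ((\<Sum>j=1..N. (cmod (w q j))\<^sup>2) - (\<Sum>j=1..N. (cmod (b q j))\<^sup>2))
       \<le> (L2_set (\<lambda>j. cmod (G q j)) {1..J-1} / (1 - 4 * theta q) + \<eta> N)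
        * L2_set (\<lambda>j. cmod ((w q j + b q j) / 2)) {1..N})" if q: "q \<in> {1..K-1}" for q
      unfolding w_def
    proof (rule mode_energy[OF q])
      have "\<Psi>t m 0 k = 0 \<and> \<Psi>b m 0 k = 0" if "k \<in> {1..K-1}" for k
        using step_Gamma[OF st[OF m], of 0 k] that by auto
      then show "dst q (\<Psi>t m) 0 = 0" "dst q (\<Psi>b m) 0 = 0"
        by (auto intro: dst_zero)
      show "dst q (\<Psi>t m) (J - 1) = f q m" "dst q (\<Psi>t m) J = g q m"
        using m by (simp_all add: f_def g_def)
      show "dst q (\<Psi>b m) (J - 1) = (if m = 0 then 0 else f q (m - 1))"
        "dst q (\<Psi>b m) J = (if m = 0 then 0 else g q (m - 1))"
        using trace_b[OF m] m by simp_all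
      show "mode_residual q (dst q (\<Psi>t m)) (dst q (\<Psi>b m)) j = G q j" if "j \<in> {1..J-1}" for j
        unfolding G_def by (rule step_mode[OF st[OF m] q that])
      show "tbc_residual_q q (f q) (g q) m = 0" by (rule tbc[OF q m])
      show "b q = glue q (dst q (\<Psi>b m)) (f q) (g q) (m - 1)" by (simp add: b_def)
      show "dst q (\<Psi>b m) = (\<lambda>_. 0) \<and> b q = (\<lambda>_. 0)" if "m = 0" using m that by simp
    qed
    \<comment> \<open>The modes are finitely many, so one null sequence per mode can be chosen and
      summed into \<open>\<epsilon>\<close>.\<close>
    have "\<exists>\<eta>. \<forall>q\<in>{1..K-1}. \<eta> q \<longlonglongrightarrow> 0 \<and> (\<forall>N. 0 \<le> \<eta> q N) \<and> (\<forall>N\<ge>J.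
       hbar / (2 * \<tau>) * ((\<Sum>j=1..N. (cmod (w q j))\<^sup>2) - (\<Sum>j=1..N. (cmod (b q j))\<^sup>2))
       \<le> (L2_set (\<lambda>j. cmod (G q j)) {1..J-1} / (1 - 4 * theta q) + \<eta> q N)
        * L2_set (\<lambda>j. cmod ((w q j + b q j) / 2)) {1..N})"
      by (intro bchoice ballI ex)
    then obtain \<eta> where \<eta>: "\<And>q. q \<in> {1..K-1} \<Longrightarrow> \<eta> q \<longlonglongrightarrow> 0" "\<And>q N. q \<in> {1..K-1} \<Longrightarrow> 0 \<le> \<eta> q N"
      and en: "\<And>q N. q \<in> {1..K-1} \<Longrightarrow> N \<ge> J \<Longrightarrow>
       hbar / (2 * \<tau>) * ((\<Sum>j=1..N. (cmod (w q j))\<^sup>2) - (\<Sum>j=1..N. (cmod (b q j))\<^sup>2))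
       \<le> (L2_set (\<lambda>j. cmod (G q j)) {1..J-1} / (1 - 4 * theta q) + \<eta> q N)
        * L2_set (\<lambda>j. cmod ((w q j + b q j) / 2)) {1..N}"
      by blast
    have G: "L2_set (\<lambda>j. cmod (G q j)) {1..J-1} / (1 - 4 * theta q) \<le> 3 * L2_set (\<lambda>j. cmod (dst q (F m) j)) {1..J-1}"
      if q: "q \<in> {1..K-1}" for q
    proof -
      have s: "sig q > 0" using sig_bounds[OF q] by simp
      have "L2_set (\<lambda>j. cmod (G q j)) {1..J-1} = L2_set (\<lambda>j. (1 / sig q) * cmod (dst q (F m) j)) {1..J-1}"
        using s by (simp add: G_def norm_divide)
      also have "\<dots> = (1 / sig q) * L2_set (\<lambda>j. cmod (dst q (F m) j)) {1..J-1}"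
        by (rule L2_set_right_distrib[symmetric]) (use s in simp)
      finally have "L2_set (\<lambda>j. cmod (G q j)) {1..J-1} / (1 - 4 * theta q)
        = 1 / (sig q * (1 - 4 * theta q)) * L2_set (\<lambda>j. cmod (dst q (F m) j)) {1..J-1}"
        by simp
      also have "\<dots> \<le> 3 * L2_set (\<lambda>j. cmod (dst q (F m) j)) {1..J-1}"
        using theta_bounds[OF q] by (intro mult_right_mono L2_set_nonneg) auto
      finally show ?thesis .
    qed
    have B_nonneg: "0 \<le> L2_set (\<lambda>j. cmod (G q j)) {1..J-1} / (1 - 4 * theta q) + \<eta> q N"
      if "q \<in> {1..K-1}" for q N
      using \<eta>(2)[OF that] theta_bounds(2)[OF that]
      by (intro add_nonneg_nonneg divide_nonneg_nonneg L2_set_nonneg) simp_all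
    define \<epsilon> where "\<epsilon> N = \<tau> / hbar * (\<Sum>q=1..K-1. \<eta> q N)" for N
    have "mode_norm (psi m) N \<le> mode_norm (psi (m - 1)) N + \<tau> / hbar * (3 * \<phi> m) + \<epsilon> N" if N: "N \<ge> J" for N
    proof -
      have "L2_set (\<lambda>q. L2_set (\<lambda>j. cmod (G q j)) {1..J-1} / (1 - 4 * theta q) + \<eta> q N) {1..K-1}
         \<le> L2_set (\<lambda>q. 3 * L2_set (\<lambda>j. cmod (dst q (F m) j)) {1..J-1} + \<eta> q N) {1..K-1}"
        by (intro L2_set_mono add_right_mono G B_nonneg)
      also have "\<dots> \<le> L2_set (\<lambda>q. 3 * L2_set (\<lambda>j. cmod (dst q (F m) j)) {1..J-1}) {1..K-1}
          + L2_set (\<lambda>q. \<eta> q N) {1..K-1}"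
        by (rule L2_set_triangle_ineq)
      also have "L2_set (\<lambda>q. 3 * L2_set (\<lambda>j. cmod (dst q (F m) j)) {1..J-1}) {1..K-1} = 3 * \<phi> m"
        unfolding \<phi>_def mode_norm_def by (rule L2_set_right_distrib[symmetric]) simp
      also have "L2_set (\<lambda>q. \<eta> q N) {1..K-1} \<le> (\<Sum>q=1..K-1. \<eta> q N)"
        using \<eta>(2) by (intro L2_set_le_sum) auto
      finally have "\<tau> / hbar * L2_set (\<lambda>q. L2_set (\<lambda>j. cmod (G q j)) {1..J-1} / (1 - 4 * theta q) + \<eta> q N) {1..K-1}
          \<le> \<tau> / hbar * (3 * \<phi> m + (\<Sum>q=1..K-1. \<eta> q N))"
        using hbar \<tau> by (intro mult_left_mono) simp_all
      moreover have "mode_norm w N \<le> mode_norm b N + \<tau> / hbar *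
          L2_set (\<lambda>q. L2_set (\<lambda>j. cmod (G q j)) {1..J-1} / (1 - 4 * theta q) + \<eta> q N) {1..K-1}"
        by (intro mode_norm_increment en B_nonneg N)
      ultimately have "mode_norm w N \<le> mode_norm b N + \<tau> / hbar * (3 * \<phi> m + (\<Sum>q=1..K-1. \<eta> q N))"
        by linarith
      \<comment> \<open>\<open>w\<close> and \<open>psi m\<close> share the exterior part; inside
        they differ by factors of modulus 1 in physical space.\<close>
      moreover have "mode_norm w N = mode_norm (psi m) N"
      proof -
        have "cmod (\<Psi>t m j k) = cmod (\<Psi> m j k)" if "j \<in> {1..J}" "k \<in> {1..K-1}" for j k
          using step_pointwise(2)[OF st[OF m] that] by (simp add: norm_mult cmod_phase)
        then show ?thesis unfolding w_def psi_def by (rule mode_norm_glue_cong)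
      qed
      moreover have "mode_norm b N = mode_norm (psi (m - 1)) N"
      proof -
        have "cmod (\<Psi>b m j k) = cmod (\<Psi> (m - 1) j k)" if "j \<in> {1..J}" "k \<in> {1..K-1}" for j k
          using step_pointwise(1)[OF st[OF m] that] by (simp add: norm_mult cmod_phase)
        then show ?thesis unfolding b_def psi_def by (rule mode_norm_glue_cong)
      qed
      ultimately show ?thesis by (simp add: \<epsilon>_def distrib_left)
    qed
    moreover have "\<epsilon> \<longlonglongrightarrow> \<tau> / hbar * (\<Sum>q=1..K-1. 0)"
      unfolding \<epsilon>_def by (intro tendsto_mult tendsto_const tendsto_sum \<eta>(1))
    ultimately show ?thesis by (intro exI[of _ \<epsilon>]) simp
  qed
  have total: "\<exists>\<epsilon>. \<epsilon> \<longlonglongrightarrow> 0 \<and> (\<forall>N\<ge>J. mode_norm (psi M) N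
     \<le> mode_norm (psi 0) N + \<tau> / hbar * (3 * (\<Sum>m=1..M. \<phi> m)) + \<epsilon> N)" for M
  proof (induction M)
    case 0
    show ?case by (intro exI[of _ "\<lambda>_. 0"]) simp
  next
    case (Suc M)
    then obtain \<epsilon> where e: "\<epsilon> \<longlonglongrightarrow> 0" "\<And>N. N \<ge> J \<Longrightarrow> mode_norm (psi M) N
      \<le> mode_norm (psi 0) N + \<tau> / hbar * (3 * (\<Sum>m=1..M. \<phi> m)) + \<epsilon> N" by blast
    obtain \<delta> where d: "\<delta> \<longlonglongrightarrow> 0" "\<And>N. N \<ge> J \<Longrightarrow> mode_norm (psi (Suc M)) N
      \<le> mode_norm (psi M) N + \<tau> / hbar * (3 * \<phi> (Suc M)) + \<delta> N"
      using increment[of "Suc M"] by auto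
    have "mode_norm (psi (Suc M)) N
      \<le> mode_norm (psi 0) N + \<tau> / hbar * (3 * (\<Sum>m=1..Suc M. \<phi> m)) + (\<epsilon> N + \<delta> N)" if "N \<ge> J" for N
      using e(2)[OF that] d(2)[OF that] by (simp add: algebra_simps)
    moreover have "(\<lambda>N. \<epsilon> N + \<delta> N) \<longlonglongrightarrow> 0 + 0"
      by (intro tendsto_add e d)
    ultimately show ?case by (intro exI[of _ "\<lambda>N. \<epsilon> N + \<delta> N"]) simp
  qed
  have psi_in: "psi m q j = dst q (\<Psi> m) j" if "q \<in> {1..K-1}" "j \<le> J" for m q j
    unfolding psi_def using that trace by (intro glue_inner)
  have psi0: "mode_norm (psi 0) N = mode_norm (\<lambda>q. dst q \<Psi>0) J" if N: "N \<ge> J" for N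
  proof -
    have "f q 0 = 0" "g q 0 = 0" for q
      unfolding f_def g_def using zero init K by (auto intro!: dst_zero)
    then have out: "psi 0 q j = 0" if "q \<in> {1..K-1}" "j > J" for q j
      using that by (simp add: psi_def glue_def ext_q_0_level)
    have "(mode_norm (psi 0) N)\<^sup>2 = (mode_norm (\<lambda>q. dst q \<Psi>0) J)\<^sup>2"
      unfolding mode_norm_sq
    proof (rule sum.mono_neutral_cong_right)
      show "\<forall>j\<in>{1..N} - {1..J}. (\<Sum>q=1..K-1. (cmod (psi 0 q j))\<^sup>2) = 0"
        by (auto simp: out intro!: sum.neutral)
      have "dst q (\<Psi> 0) j = dst q \<Psi>0 j" if "j \<le> J" for q j
        by (rule dst_cong) (use init that in auto)
      then show "(\<Sum>q=1..K-1. (cmod (psi 0 q j))\<^sup>2) = (\<Sum>q=1..K-1. (cmod (dst q \<Psi>0 j))\<^sup>2)"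
        if "j \<in> {1..J}" for j
        using that by (intro sum.cong refl) (simp add: psi_in)
    qed (use N in auto)
    then show ?thesis using mode_norm_nonneg by (simp add: power2_eq_iff_nonneg)
  qed
  obtain \<epsilon> where \<epsilon>: "\<epsilon> \<longlonglongrightarrow> 0" "\<And>N. N \<ge> J \<Longrightarrow> mode_norm (psi M) N
     \<le> mode_norm (psi 0) N + \<tau> / hbar * (3 * (\<Sum>m=1..M. \<phi> m)) + \<epsilon> N"
    using total by blast
  \<comment> \<open>Restricting the left side to \<open>1..J\<close> leaves
    \<open>\<epsilon> N\<close> as the only term that varies with \<open>N\<close>.\<close>
  have "mode_norm (\<lambda>q. dst q (\<Psi> M)) J
     \<le> mode_norm (\<lambda>q. dst q \<Psi>0) J + \<tau> / hbar * (3 * (\<Sum>m=1..M. \<phi> m)) + \<epsilon> N" if N: "N \<ge> J" for N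
  proof -
    have "mode_norm (\<lambda>q. dst q (\<Psi> M)) J = mode_norm (psi M) J"
      by (rule mode_norm_eqI) (auto simp: psi_in)
    also have "\<dots> \<le> mode_norm (psi M) N" using N by (rule mode_norm_mono)
    finally show ?thesis using \<epsilon>(2)[OF N] psi0[OF N] by linarith
  qed
  moreover have "(\<lambda>N. mode_norm (\<lambda>q. dst q \<Psi>0) J + \<tau> / hbar * (3 * (\<Sum>m=1..M. \<phi> m)) + \<epsilon> N)
     \<longlonglongrightarrow> mode_norm (\<lambda>q. dst q \<Psi>0) J + \<tau> / hbar * (3 * (\<Sum>m=1..M. \<phi> m)) + 0"
    by (intro tendsto_add tendsto_const \<epsilon>(1))
  ultimately have *: "mode_norm (\<lambda>q. dst q (\<Psi> M)) J
     \<le> mode_norm (\<lambda>q. dst q \<Psi>0) J + \<tau> / hbar * (3 * (\<Sum>m=1..M. \<phi> m)) + 0"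
    by (intro LIMSEQ_le_const) auto
  define c where "c = sqrt (hx * hy * real K / 2)"
  have "c \<ge> 0" using hx_pos hy_pos by (simp add: c_def)
  with * have "c * mode_norm (\<lambda>q. dst q (\<Psi> M)) J
     \<le> c * (mode_norm (\<lambda>q. dst q \<Psi>0) J + \<tau> / hbar * (3 * (\<Sum>m=1..M. \<phi> m)))"
    by (intro mult_left_mono) auto
  also have "\<dots> = c * mode_norm (\<lambda>q. dst q \<Psi>0) J + 3 / hbar * (\<Sum>m=1..M. (c * \<phi> m) * \<tau>)"
    by (simp add: algebra_simps sum_distrib_left sum_divide_distrib)
  finally show ?thesis
    unfolding norm_omega_tilde_eq norm_omega_eq c_def \<phi>_def .
qed

section \<open>Differences of two solutions\<close>

lemma dxx_diff: "dxx (\<lambda>j k. u j k - v j k) = (\<lambda>j k. dxx u j k - dxx v j k)"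
  using hx_pos by (simp add: fun_eq_iff dxx_eq d2_def field_simps)

lemma dyy_diff: "dyy (\<lambda>j k. u j k - v j k) = (\<lambda>j k. dyy u j k - dyy v j k)"
  using hy_pos by (simp add: fun_eq_iff dyy_eq d2_def field_simps)

lemma s_N_diff: "s_N (\<lambda>j k. u j k - v j k) j k = s_N u j k - s_N v j k"
  unfolding s_N_def dxx_diff dyy_diff by (simp only: algebra_simps)

lemma Delta_hN_diff: "Delta_hN (\<lambda>j k. u j k - v j k) j k = Delta_hN u j k - Delta_hN v j k"
  unfolding Delta_hN_def s_Nx_def s_Ny_def dxx_diff dyy_diff by (simp only: algebra_simps)

lemma main_residual_diff:
  "main_residual (\<lambda>j k. t j k - t' j k) (\<lambda>j k. b j k - b' j k) (\<lambda>_ _. 0) j k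
    = main_residual t b G j k - main_residual t' b' G j k"
proof -
  have D: "(\<lambda>j k. ((t j k - t' j k) - (b j k - b' j k)) / of_real \<tau>)
    = (\<lambda>j k. (t j k - b j k) / of_real \<tau> - (t' j k - b' j k) / of_real \<tau>)"
    by (simp add: fun_eq_iff diff_divide_distrib)
  have W: "(\<lambda>j k. ((t j k - t' j k) + (b j k - b' j k)) / 2)
    = (\<lambda>j k. (t j k + b j k) / 2 - (t' j k + b' j k) / 2)"
    by (simp add: fun_eq_iff field_simps)
  have P: "(\<lambda>j k. of_real (Vt (x j)) * (((t j k - t' j k) + (b j k - b' j k)) / 2))
    = (\<lambda>j k. of_real (Vt (x j)) * ((t j k + b j k) / 2) - of_real (Vt (x j)) * ((t' j k + b' j k) / 2))"
    by (simp add: fun_eq_iff field_simps)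
  show ?thesis
    unfolding main_residual_def D W P s_N_diff Delta_hN_diff by (simp add: algebra_simps)
qed

lemma TBC_diff:
  assumes "TBC \<Psi> \<Psi>b \<Psi>t m q" "TBC \<Psi>' \<Psi>b' \<Psi>t' m q"
  shows "TBC (\<lambda>m j k. \<Psi> m j k - \<Psi>' m j k) (\<lambda>m j k. \<Psi>b m j k - \<Psi>b' m j k) (\<lambda>m j k. \<Psi>t m j k - \<Psi>t' m j k) m q"
proof -
  have c: "conv (R q) (\<lambda>p. dst q (if p = 0 then (\<lambda>j k. \<Psi> 0 j k - \<Psi>' 0 j k) else (\<lambda>j k. \<Psi>t p j k - \<Psi>t' p j k)) J) m
    = conv (R q) (\<lambda>p. dst q (if p = 0 then \<Psi> 0 else \<Psi>t p) J) m
      - conv (R q) (\<lambda>p. dst q (if p = 0 then \<Psi>' 0 else \<Psi>t' p) J) m"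
    unfolding conv_def sum_subtractf[symmetric]
    by (intro sum.cong refl) (simp add: dst_diff algebra_simps)
  show ?thesis
    using arg_cong2[OF assms[unfolded TBC_def], of "(-)"]
    unfolding TBC_def c dst_diff bdiff_def s_minus_def
    by (simp add: algebra_simps diff_divide_distrib add_divide_distrib)
qed

lemma solves_diff:
  assumes "solves \<Psi>0 F \<Psi> \<Psi>b \<Psi>t" "solves \<Psi>0 F \<Psi>' \<Psi>b' \<Psi>t'"
  shows "solves (\<lambda>_ _. 0) (\<lambda>_ _ _. 0) (\<lambda>m j k. \<Psi> m j k - \<Psi>' m j k)
    (\<lambda>m j k. \<Psi>b m j k - \<Psi>b' m j k) (\<lambda>m j k. \<Psi>t m j k - \<Psi>t' m j k)"
proof -
  have "step (\<lambda>_ _ _. 0) (\<lambda>m j k. \<Psi> m j k - \<Psi>' m j k)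
    (\<lambda>m j k. \<Psi>b m j k - \<Psi>b' m j k) (\<lambda>m j k. \<Psi>t m j k - \<Psi>t' m j k) m" if m: "m \<ge> 1" for m
  proof -
    have s: "step F \<Psi> \<Psi>b \<Psi>t m" "step F \<Psi>' \<Psi>b' \<Psi>t' m"
      using assms m unfolding solves_iff by blast+
    have ph: "\<Psi>b m j k - \<Psi>b' m j k = phase (V (x j) (y k) - Vt (x j)) * (\<Psi> (m - 1) j k - \<Psi>' (m - 1) j k)"
      "\<Psi> m j k - \<Psi>' m j k = phase (V (x j) (y k) - Vt (x j)) * (\<Psi>t m j k - \<Psi>t' m j k)"
      if "(j, k) \<in> omega \<union> Gamma1" for j k
      using that step_pointwise[OF s(1)] step_pointwise[OF s(2)] unfolding mem_omega_Gamma1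
      by (simp_all add: right_diff_distrib)
    have "main_residual (\<Psi>t m) (\<Psi>b m) (F m) j k = 0" "main_residual (\<Psi>t' m) (\<Psi>b' m) (F m) j k = 0"
      if "(j, k) \<in> omega" for j k
      using step_main[OF s(1)] step_main[OF s(2)] that by blast+
    then have "main_residual (\<lambda>j k. \<Psi>t m j k - \<Psi>t' m j k) (\<lambda>j k. \<Psi>b m j k - \<Psi>b' m j k) (\<lambda>_ _. 0) j k = 0"
      if "(j, k) \<in> omega" for j k
      using that by (simp add: main_residual_diff[where G = "F m"])
    then have main: "\<i> * of_real hbar * s_N (\<lambda>j k. ((\<Psi>t m j k - \<Psi>t' m j k) - (\<Psi>b m j k - \<Psi>b' m j k)) / of_real \<tau>) j k
      = - of_real c_hbar * Delta_hN (\<lambda>j k. ((\<Psi>t m j k - \<Psi>t' m j k) + (\<Psi>b m j k - \<Psi>b' m j k)) / 2) j k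
            + s_N (\<lambda>j k. of_real (Vt (x j)) * (((\<Psi>t m j k - \<Psi>t' m j k) + (\<Psi>b m j k - \<Psi>b' m j k)) / 2)) j k
            + 0" if "(j, k) \<in> omega" for j k
      using that unfolding main_residual_def by simp
    have ga: "\<Psi>b m j k - \<Psi>b' m j k = 0 \<and> \<Psi>t m j k - \<Psi>t' m j k = 0 \<and> \<Psi> m j k - \<Psi>' m j k = 0"
      if "(j, k) \<in> Gamma" for j k
      using step_Gamma[OF s(1)] step_Gamma[OF s(2)] that unfolding mem_Gamma by auto
    have "TBC (\<lambda>m j k. \<Psi> m j k - \<Psi>' m j k) (\<lambda>m j k. \<Psi>b m j k - \<Psi>b' m j k) (\<lambda>m j k. \<Psi>t m j k - \<Psi>t' m j k) m q"
      if "q \<in> {1..K-1}" for q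
      using s that unfolding step_def by (intro TBC_diff) blast+
    then show ?thesis
      unfolding step_def phase_iff using ph main ga by blast
  qed
  moreover have "\<forall>(j, k)\<in>omega_bar. \<Psi> 0 j k - \<Psi>' 0 j k = 0"
  proof clarify
    fix j k assume "(j, k) \<in> omega_bar"
    then have "\<Psi> 0 j k = \<Psi>0 j k" "\<Psi>' 0 j k = \<Psi>0 j k"
      using assms unfolding solves_iff by blast+
    then show "\<Psi> 0 j k - \<Psi>' 0 j k = 0" by simp
  qed
  ultimately show ?thesis unfolding solves_iff by blast
qed

lemma norm_omega_tilde_eq_0_D:
  assumes "norm_omega_tilde U \<le> 0" "j \<in> {1..J}" "k \<in> {1..K-1}"
  shows "U j k = 0"
proof -
  have nn: "(cmod (U j k))\<^sup>2 * hx * hy \<ge> 0" for j k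
    using hx_pos hy_pos by simp
  have "(\<Sum>j=1..J. \<Sum>k=1..K-1. (cmod (U j k))\<^sup>2 * hx * hy) \<ge> 0"
    by (intro sum_nonneg nn)
  with assms(1) have "(\<Sum>j=1..J. \<Sum>k=1..K-1. (cmod (U j k))\<^sup>2 * hx * hy) = 0"
    unfolding norm_omega_tilde_def by simp
  then have "(\<Sum>k=1..K-1. (cmod (U j k))\<^sup>2 * hx * hy) = 0"
    using assms(2) nn by (subst (asm) sum_nonneg_eq_0_iff) (auto intro: sum_nonneg)
  then have "(cmod (U j k))\<^sup>2 * hx * hy = 0"
    using assms(3) nn by (subst (asm) sum_nonneg_eq_0_iff) auto
  then show ?thesis using hx_pos hy_pos by simp
qed

text \<open>The difference has zero data, so stability determines \<open>\<Psi>\<close>. Breve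
  values follow from the previous level, tilde values by cancelling the nonzero phase; on
  \<open>Gamma\<close> they are prescribed.\<close>

lemma uniqueness:
  assumes sol: "solves \<Psi>0 F \<Psi> \<Psi>b \<Psi>t" "solves \<Psi>0 F \<Psi>' \<Psi>b' \<Psi>t'"
  shows "same_solution \<Psi> \<Psi>b \<Psi>t \<Psi>' \<Psi>b' \<Psi>t'"
proof -
  have st: "step F \<Psi> \<Psi>b \<Psi>t m" "step F \<Psi>' \<Psi>b' \<Psi>t' m" if "m \<ge> 1" for m
    using sol that unfolding solves_iff by blast+
  have inner: "\<Psi> m j k = \<Psi>' m j k" if "j \<in> {1..J}" "k \<in> {1..K-1}" for m j k
  proof -
    have "norm_omega_tilde (\<lambda>j k. \<Psi> m j k - \<Psi>' m j k) \<le> 0"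
      using stability[OF solves_diff[OF sol], of m] by (simp add: norm_omega_tilde_def norm_omega_def)
    from norm_omega_tilde_eq_0_D[OF this that] show ?thesis by simp
  qed
  show ?thesis
    unfolding same_solution_def
  proof (intro ballI, clarify, intro conjI allI impI)
    fix j k assume "(j, k) \<in> omega_bar"
    then have jk: "j \<le> J" "k \<le> K" by (auto simp: omega_bar_def)
    consider "j \<in> {1..J}" "k \<in> {1..K-1}" | "j = 0 \<or> k = 0 \<or> k = K" using jk by fastforce
    note cases = this
    show "\<Psi> m j k = \<Psi>' m j k" for m
    proof (cases "m = 0")
      case True
      have "\<Psi> 0 j k = \<Psi>0 j k" "\<Psi>' 0 j k = \<Psi>0 j k"
        using sol \<open>(j, k) \<in> omega_bar\<close> unfolding solves_iff by blast+
      then show ?thesis using True by simp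
    next
      case False
      then have "m \<ge> 1" by simp
      show ?thesis using cases
        by cases (use inner step_Gamma[OF st(1)[OF \<open>m \<ge> 1\<close>] jk] step_Gamma[OF st(2)[OF \<open>m \<ge> 1\<close>] jk] in auto)
    qed
    fix m :: nat assume m: "m \<ge> 1"
    show "\<Psi>b m j k = \<Psi>b' m j k" using cases
    proof cases
      case 1
      then show ?thesis using step_pointwise(1)[OF st(1)[OF m]] step_pointwise(1)[OF st(2)[OF m]] inner by simp
    next
      case 2
      then show ?thesis using step_Gamma[OF st(1)[OF m] jk] step_Gamma[OF st(2)[OF m] jk] by simp
    qed
    show "\<Psi>t m j k = \<Psi>t' m j k" using cases
    proof cases
      case 1
      then have "phase (V (x j) (y k) - Vt (x j)) * \<Psi>t m j k = phase (V (x j) (y k) - Vt (x j)) * \<Psi>t' m j k"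
        using step_pointwise(2)[OF st(1)[OF m]] step_pointwise(2)[OF st(2)[OF m]] inner by metis
      moreover have "phase (V (x j) (y k) - Vt (x j)) \<noteq> 0"
        using cmod_phase[of "V (x j) (y k) - Vt (x j)"] by auto
      ultimately show ?thesis by simp
    next
      case 2
      then show ?thesis using step_Gamma[OF st(1)[OF m] jk] step_Gamma[OF st(2)[OF m] jk] by simp
    qed
  qed
qed

section \<open>Existence\<close>

lemma conv_cong: "(\<And>p. p \<le> m \<Longrightarrow> g p = g' p) \<Longrightarrow> conv r g m = conv r g' m"
  by (simp add: conv_def)

lemma step_cong:
  assumes "\<And>p. p \<le> m \<Longrightarrow> \<Psi> p = \<Psi>' p \<and> \<Psi>b p = \<Psi>b' p \<and> \<Psi>t p = \<Psi>t' p"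
  shows "step F \<Psi> \<Psi>b \<Psi>t m \<longleftrightarrow> step F \<Psi>' \<Psi>b' \<Psi>t' m"
proof -
  have e: "\<Psi> m = \<Psi>' m" "\<Psi>b m = \<Psi>b' m" "\<Psi>t m = \<Psi>t' m" "\<Psi> (m - 1) = \<Psi>' (m - 1)"
    using assms by auto
  have "conv (R q) (\<lambda>p. dst q (if p = 0 then \<Psi> 0 else \<Psi>t p) J) m
    = conv (R q) (\<lambda>p. dst q (if p = 0 then \<Psi>' 0 else \<Psi>t' p) J) m" for q
    using assms by (intro conv_cong) auto
  then show ?thesis unfolding step_def TBC_def e by simp
qed

text \<open>The potential steps are explicit, so only the tilde function is solved for, mode by
  mode. The previous step serves to identify the breve traces with the tilde traces of level
  \<open>m - 1\<close>.\<close>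

lemma step_exists:
  assumes m: "m \<ge> 1"
    and prev: "m > 1 \<Longrightarrow> step F \<Psi> \<Psi>b \<Psi>t (m - 1)"
    and zero: "\<And>j k. (j, k) \<in> Gamma \<Longrightarrow> \<Psi> (m - 1) j k = 0"
  shows "\<exists>P Pb Pt. step F (\<Psi>(m := P)) (\<Psi>b(m := Pb)) (\<Psi>t(m := Pt)) m"
proof -
  define ph where "ph j k = phase (V (x j) (y k) - Vt (x j))" for j k
  define Pb where "Pb j k = ph j k * \<Psi> (m - 1) j k" for j k
  define f where "f q p = dst q (if p = 0 then \<Psi> 0 else \<Psi>t p) (J - 1)" for q p
  define g where "g q p = dst q (if p = 0 then \<Psi> 0 else \<Psi>t p) J" for q p
  have "\<exists>u. u 0 = 0 \<and> (\<forall>j\<in>{1..J-1}. mode_residual q u (dst q Pb) j = dst q (F m) j / of_real (sig q))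
     \<and> tbc_residual_q q ((f q)(m := u (J - 1))) ((g q)(m := u J)) m = 0" if "q \<in> {1..K-1}" for q
    by (rule mode_exists[OF that])
  then have "\<exists>u. \<forall>q\<in>{1..K-1}. u q 0 = 0 \<and> (\<forall>j\<in>{1..J-1}. mode_residual q (u q) (dst q Pb) j = dst q (F m) j / of_real (sig q))
     \<and> tbc_residual_q q ((f q)(m := u q (J - 1))) ((g q)(m := u q J)) m = 0"
    by (intro bchoice ballI)
  then obtain u where u0: "\<And>q. q \<in> {1..K-1} \<Longrightarrow> u q 0 = 0"
    and ueq: "\<And>q j. q \<in> {1..K-1} \<Longrightarrow> j \<in> {1..J-1} \<Longrightarrow>
       mode_residual q (u q) (dst q Pb) j = dst q (F m) j / of_real (sig q)"
    and utbc: "\<And>q. q \<in> {1..K-1} \<Longrightarrow> tbc_residual_q q ((f q)(m := u q (J - 1))) ((g q)(m := u q J)) m = 0"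
    by blast
  \<comment> \<open>A sine sum vanishes at \<open>k = 0\<close> and \<open>k = K\<close> by itself,
    and \<open>u q 0 = 0\<close> settles \<open>j = 0\<close>; this gives the values on
    \<open>Gamma\<close>.\<close>
  define Pt where "Pt j k = (\<Sum>q=1..K-1. u q j * of_real (sin (pi * real q * real k / real K)))" for j k
  define P where "P j k = ph j k * Pt j k" for j k
  have dst_Pt: "dst q Pt = u q" if "q \<in> {1..K-1}" for q
  proof
    fix j
    have "Pt j = (\<lambda>k. \<Sum>q=1..K-1. u q j * of_real (sin (pi * real q * real k / real K)))"
      by (simp add: fun_eq_iff Pt_def)
    then show "dst q Pt j = u q j"
      unfolding dst_eq using sine_transform_synthesis[OF that, of "\<lambda>q. u q j"] by simp
  qed
  have Pt_Gamma: "Pt j k = 0" if "(j, k) \<in> Gamma" for j k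
  proof -
    have "sin (pi * real q * real K / real K) = 0" for q
      using K by (simp add: mult.commute)
    then show ?thesis using that u0 K unfolding mem_Gamma Pt_def by (auto intro!: sum.neutral)
  qed
  have Pb_Gamma: "Pb j k = 0" if "(j, k) \<in> Gamma" for j k
    using zero[OF that] by (simp add: Pb_def)
  have main: "\<forall>(j, k)\<in>omega. main_residual Pt Pb (F m) j k = 0"
  proof (subst main_equation_iff)
    show "Pt i 0 = 0 \<and> Pt i K = 0 \<and> Pb i 0 = 0 \<and> Pb i K = 0" if "i \<le> J" for i
      using Pt_Gamma Pb_Gamma that unfolding mem_Gamma by simp
    show "\<forall>q\<in>{1..K-1}. \<forall>j\<in>{1..J-1}. mode_residual q (dst q Pt) (dst q Pb) j = dst q (F m) j / of_real (sig q)"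
      using ueq dst_Pt by simp
  qed
  have trace: "dst q Pb j = dst q (if m - 1 = 0 then \<Psi> 0 else \<Psi>t (m - 1)) j" if "j \<in> {J - 1, J}" for q j
  proof (rule dst_cong)
    fix k assume k: "k \<in> {1..K-1}"
    have "ph j k = 1" using V_eq_Vt[OF _ k, of j] that by (auto simp: ph_def phase_0)
    moreover have "\<Psi> (m - 1) j k = \<Psi>t (m - 1) j k" if "m > 1"
      using step_right_end(2)[OF prev[OF that] \<open>j \<in> _\<close> k] .
    ultimately show "Pb j k = (if m - 1 = 0 then \<Psi> 0 else \<Psi>t (m - 1)) j k"
      using m by (auto simp: Pb_def)
  qed
  have tbc: "TBC (\<Psi>(m := P)) (\<Psi>b(m := Pb)) (\<Psi>t(m := Pt)) m q" if q: "q \<in> {1..K-1}" for q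
  proof (subst TBC_iff[OF q m])
    show "tbc_residual_q q ((f q)(m := u q (J - 1))) ((g q)(m := u q J)) m = 0" by (rule utbc[OF q])
    show "((g q)(m := u q J)) p = dst q (if p = 0 then (\<Psi>(m := P)) 0 else (\<Psi>t(m := Pt)) p) J" if "p \<le> m" for p
      using m by (simp add: g_def dst_Pt[OF q])
    show "((f q)(m := u q (J - 1))) m = dst q ((\<Psi>t(m := Pt)) m) (J - 1)"
      by (simp add: dst_Pt[OF q])
    show "dst q ((\<Psi>b(m := Pb)) m) J = ((g q)(m := u q J)) (m - 1)"
      "dst q ((\<Psi>b(m := Pb)) m) (J - 1) = ((f q)(m := u q (J - 1))) (m - 1)"
      using m trace[of J q] trace[of "J - 1" q] by (auto simp: f_def g_def)
  qed
  have e: "(\<Psi>(m := P)) m = P" "(\<Psi>b(m := Pb)) m = Pb" "(\<Psi>t(m := Pt)) m = Pt"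
      "(\<Psi>(m := P)) (m - 1) = \<Psi> (m - 1)"
    using m by auto
  have "step F (\<Psi>(m := P)) (\<Psi>b(m := Pb)) (\<Psi>t(m := Pt)) m"
    unfolding step_def phase_iff e
  proof (intro conjI)
    show "\<forall>(j, k)\<in>omega \<union> Gamma1. Pb j k = phase (V (x j) (y k) - Vt (x j)) * \<Psi> (m - 1) j k"
      "\<forall>(j, k)\<in>omega \<union> Gamma1. P j k = phase (V (x j) (y k) - Vt (x j)) * Pt j k"
      unfolding Pb_def P_def ph_def by blast+
    show "\<forall>(j, k)\<in>omega. \<i> * of_real hbar * s_N (\<lambda>j k. (Pt j k - Pb j k) / of_real \<tau>) j k
          = - of_real c_hbar * Delta_hN (\<lambda>j k. (Pt j k + Pb j k) / 2) j k
            + s_N (\<lambda>j k. of_real (Vt (x j)) * ((Pt j k + Pb j k) / 2)) j k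
            + F m j k"
      using main unfolding main_residual_def right_minus_eq .
    show "\<forall>(j, k)\<in>Gamma. Pb j k = 0 \<and> Pt j k = 0 \<and> P j k = 0"
      using Pb_Gamma Pt_Gamma unfolding P_def by auto
    show "\<forall>q\<in>{1..K - 1}. TBC (\<Psi>(m := P)) (\<Psi>b(m := Pb)) (\<Psi>t(m := Pt)) m q"
      using tbc by blast
  qed
  then show ?thesis by blast
qed

text \<open>Dependent choice produces finite stages that agree on earlier levels; their diagonal
  solves the scheme because a step looks only at levels up to its own.\<close>

lemma existence:
  assumes zero: "\<And>j k. (j, k) \<in> Gamma \<Longrightarrow> \<Psi>0 j k = 0"
  shows "\<exists>\<Psi> \<Psi>b \<Psi>t. solves \<Psi>0 F \<Psi> \<Psi>b \<Psi>t"
proof -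
  define P where "P n S \<longleftrightarrow> (case S of (\<Psi>, \<Psi>b, \<Psi>t) \<Rightarrow> \<Psi> 0 = \<Psi>0 \<and> (\<forall>m. 1 \<le> m \<and> m \<le> n \<longrightarrow> step F \<Psi> \<Psi>b \<Psi>t m))"
    for n :: nat and S :: "(nat \<Rightarrow> mesh_fun) \<times> (nat \<Rightarrow> mesh_fun) \<times> (nat \<Rightarrow> mesh_fun)"
  define agree where "agree n S S' \<longleftrightarrow> (\<forall>p\<le>n. fst S p = fst S' p \<and> fst (snd S) p = fst (snd S') p
      \<and> snd (snd S) p = snd (snd S') p)"
    for n :: nat and S S' :: "(nat \<Rightarrow> mesh_fun) \<times> (nat \<Rightarrow> mesh_fun) \<times> (nat \<Rightarrow> mesh_fun)"
  have "\<exists>S. \<forall>n. P n (S n) \<and> agree n (S n) (S (Suc n))"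
  proof (rule dependent_nat_choice)
    show "\<exists>S. P 0 S"
      by (intro exI[of _ "(\<lambda>_. \<Psi>0, \<lambda>_ _ _. 0, \<lambda>_ _ _. 0)"]) (simp add: P_def)
  next
    fix S n assume PS: "P n S"
    obtain \<Psi> \<Psi>b \<Psi>t where S: "S = (\<Psi>, \<Psi>b, \<Psi>t)" by (metis prod.collapse)
    have init: "\<Psi> 0 = \<Psi>0" and st: "\<And>m. 1 \<le> m \<Longrightarrow> m \<le> n \<Longrightarrow> step F \<Psi> \<Psi>b \<Psi>t m"
      using PS by (simp_all add: P_def S)
    have "\<exists>A B C. step F (\<Psi>(Suc n := A)) (\<Psi>b(Suc n := B)) (\<Psi>t(Suc n := C)) (Suc n)"
    proof (rule step_exists)
      \<comment> \<open>At the first level this is the compatibility condition on the initial data,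
        later the boundary values of the preceding step.\<close>
      show "\<Psi> (Suc n - 1) j k = 0" if "(j, k) \<in> Gamma" for j k
        using init zero[OF that] st[of n] step_Gamma[of F \<Psi> \<Psi>b \<Psi>t n j k] that unfolding mem_Gamma
        by (cases "n = 0") auto
    qed (use st in auto)
    then obtain A B C where new: "step F (\<Psi>(Suc n := A)) (\<Psi>b(Suc n := B)) (\<Psi>t(Suc n := C)) (Suc n)"
      by blast
    have "step F (\<Psi>(Suc n := A)) (\<Psi>b(Suc n := B)) (\<Psi>t(Suc n := C)) m" if "1 \<le> m" "m \<le> Suc n" for m
    proof (cases "m = Suc n")
      case False
      then have "m \<le> n" using that by simp
      then show ?thesis
        using st[OF that(1)] step_cong[of m "\<Psi>(Suc n := A)" \<Psi> "\<Psi>b(Suc n := B)" \<Psi>b "\<Psi>t(Suc n := C)" \<Psi>t] by simp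
    qed (use new in simp)
    then show "\<exists>S'. P (Suc n) S' \<and> agree n S S'"
      using init by (intro exI[of _ "(\<Psi>(Suc n := A), \<Psi>b(Suc n := B), \<Psi>t(Suc n := C))"])
        (auto simp: P_def agree_def S)
  qed
  then obtain S where S: "\<And>n. P n (S n)" "\<And>n. agree n (S n) (S (Suc n))" by blast
  have later: "fst (S n) p = fst (S p) p \<and> fst (snd (S n)) p = fst (snd (S p)) p
      \<and> snd (snd (S n)) p = snd (snd (S p)) p" if "p \<le> n" for n p
    using that
  proof (induction n rule: dec_induct)
    case (step n)
    then show ?case using S(2)[of n] by (simp add: agree_def)
  qed simp
  have "solves \<Psi>0 F (\<lambda>m. fst (S m) m) (\<lambda>m. fst (snd (S m)) m) (\<lambda>m. snd (snd (S m)) m)"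
    unfolding solves_iff
  proof (intro conjI allI impI)
    show "\<forall>(j, k)\<in>omega_bar. fst (S 0) 0 j k = \<Psi>0 j k"
      using S(1)[of 0] by (auto simp: P_def split: prod.splits)
    fix m :: nat assume "m \<ge> 1"
    then have "step F (fst (S m)) (fst (snd (S m))) (snd (snd (S m))) m"
      using S(1)[of m] by (auto simp: P_def split: prod.splits)
    then show "step F (\<lambda>m. fst (S m) m) (\<lambda>m. fst (snd (S m)) m) (\<lambda>m. snd (snd (S m)) m) m"
      by (subst step_cong) (use later[of _ m] in auto)
  qed
  then show ?thesis by blast
qed

end

theorem proposition3:
  fixes hbar m0 X X0 Y Vinf \<tau> L \<alpha> :: real
    and V :: "real \<Rightarrow> real \<Rightarrow> real" and Vt :: "real \<Rightarrow> real"
    and J K :: nat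
    and \<Psi>0 :: mesh_fun and F :: "nat \<Rightarrow> mesh_fun"
  assumes "hbar > 0" and "m0 > 0" and "\<tau> > 0"
    and "Y > 0" and "X0 > 0" and "X > X0"
    and "J \<ge> 1" and "K \<ge> 1" and "splitting_scheme.hx X J \<le> X - X0"
    and "\<And>x y. x \<ge> X0 \<Longrightarrow> 0 < y \<Longrightarrow> y < Y \<Longrightarrow> V x y = Vinf"
    and "\<And>x. x \<ge> X0 \<Longrightarrow> Vt x = Vinf"
    and "0 \<le> \<alpha>" and "\<alpha> \<le> 1" and "L \<ge> 0"
    and "\<And>x x'. 0 \<le> x \<Longrightarrow> x \<le> x' \<Longrightarrow> x' \<le> X \<Longrightarrow> \<bar>Vt x' - Vt x\<bar> \<le> L * \<bar>x' - x\<bar> powr \<alpha>"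
    and "L * \<tau> * splitting_scheme.hx X J powr \<alpha> < 8 * hbar"
    and "\<forall>(j, k)\<in>splitting_scheme.Gamma J K. \<Psi>0 j k = 0"
  shows "(\<exists>\<Psi> \<Psi>b \<Psi>t. splitting_scheme.solves hbar m0 X Y Vinf V Vt J K \<tau> \<Psi>0 F \<Psi> \<Psi>b \<Psi>t)
    \<and> (\<forall>\<Psi> \<Psi>b \<Psi>t \<Psi>' \<Psi>b' \<Psi>t'.
         splitting_scheme.solves hbar m0 X Y Vinf V Vt J K \<tau> \<Psi>0 F \<Psi> \<Psi>b \<Psi>t \<longrightarrow>
         splitting_scheme.solves hbar m0 X Y Vinf V Vt J K \<tau> \<Psi>0 F \<Psi>' \<Psi>b' \<Psi>t' \<longrightarrow>
         splitting_scheme.same_solution J K \<Psi> \<Psi>b \<Psi>t \<Psi>' \<Psi>b' \<Psi>t')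
    \<and> ((\<forall>(j, k)\<in>splitting_scheme.Gamma1 J K. \<Psi>0 j k = 0) \<longrightarrow>
       (\<forall>k\<le>K. \<Psi>0 (J - 1) k = 0) \<longrightarrow>
       (\<forall>\<Psi> \<Psi>b \<Psi>t. splitting_scheme.solves hbar m0 X Y Vinf V Vt J K \<tau> \<Psi>0 F \<Psi> \<Psi>b \<Psi>t \<longrightarrow>
         (\<forall>M\<ge>1.
            (MAX m\<in>{0..M}. splitting_scheme.norm_omega_tilde X Y J K (\<Psi> m))
            \<le> splitting_scheme.norm_omega_tilde X Y J K \<Psi>0
              + 6 / hbar * (\<Sum>m=1..M. splitting_scheme.norm_omega X Y J K (F m) * \<tau>))))"
proof -
  interpret splitting_setup hbar m0 X Y Vinf V Vt J K \<tau> X0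
    by unfold_locales (use assms in auto)
  show ?thesis
  proof (intro conjI allI impI)
    show "\<exists>\<Psi> \<Psi>b \<Psi>t. solves \<Psi>0 F \<Psi> \<Psi>b \<Psi>t"
      by (rule existence) (use assms(17) in auto)
  next
    fix \<Psi> \<Psi>b \<Psi>t \<Psi>' \<Psi>b' \<Psi>t'
    assume "solves \<Psi>0 F \<Psi> \<Psi>b \<Psi>t" "solves \<Psi>0 F \<Psi>' \<Psi>b' \<Psi>t'"
    then show "same_solution \<Psi> \<Psi>b \<Psi>t \<Psi>' \<Psi>b' \<Psi>t'" by (rule uniqueness)
  next
    fix \<Psi> \<Psi>b \<Psi>t and M :: nat
    assume z1: "\<forall>(j, k)\<in>Gamma1. \<Psi>0 j k = 0" and z2: "\<forall>k\<le>K. \<Psi>0 (J - 1) k = 0"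
      and sol: "solves \<Psi>0 F \<Psi> \<Psi>b \<Psi>t"
    have f: "norm_omega (F m) * \<tau> \<ge> 0" for m
      using \<tau> hx_pos hy_pos by (simp add: norm_omega_def sum_nonneg)
    have zero: "\<Psi>0 J k = 0 \<and> \<Psi>0 (J - 1) k = 0" if "k \<in> {1..K-1}" for k
      using z1 z2 that by (auto simp: Gamma1_def)
    have "norm_omega_tilde (\<Psi> m) \<le> norm_omega_tilde \<Psi>0 + 6 / hbar * (\<Sum>m=1..M. norm_omega (F m) * \<tau>)"
      if "m \<le> M" for m
    proof -
      have "norm_omega_tilde (\<Psi> m) \<le> norm_omega_tilde \<Psi>0 + 3 / hbar * (\<Sum>i=1..m. norm_omega (F i) * \<tau>)"
        by (rule stability[OF sol zero])
      \<comment> \<open>The sum grows from \<open>m\<close> to \<open>M\<close> nonnegative terms,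
        and 3 is relaxed to 6.\<close>
      also have "3 / hbar * (\<Sum>i=1..m. norm_omega (F i) * \<tau>) \<le> 6 / hbar * (\<Sum>i=1..M. norm_omega (F i) * \<tau>)"
        using hbar that f by (intro mult_mono divide_right_mono sum_mono2 sum_nonneg) auto
      finally show ?thesis by simp
    qed
    then show "(MAX m\<in>{0..M}. norm_omega_tilde (\<Psi> m))
      \<le> norm_omega_tilde \<Psi>0 + 6 / hbar * (\<Sum>m=1..M. norm_omega (F m) * \<tau>)"
      by (subst Max_le_iff) auto
  qed
qed

end
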